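(* Let $p\in \mathcal J$ be a randomly chosen $\mathcal{H}$-joint and let $(F_{p,e})_{e\in E}\in\mathcal{T}_p$ be randomly chosen. For each $i\in [r]$, let $e_i$ be an edge randomly and independently chosen from $c^{-1}(i)$ so that $\mathbb{P}(e_i=e) = w(e)/\bar{w}_i$ for each $e\in c^{-1}(i)$. Then \[H(p)+\sum_{i=1}^r\bar{w}_i\left(H(F_{p,e_i}\mid p)-H(e_i)\right)\leq \sum_{i=1}^r\bar{w}_iH(F_{p,e_i})+\log_2 C_{\mathcal{H},w},\] where \[C_{\mathcal{H},w}=d!^{|w|-1}\prod_{i=1}^r \left(\frac{1}{k_i!}\right)^{\bar{w}_i}\prod_{e\in c^{-1}(i)}\left(\frac{w(e)}{\bar{w}_i}\right)^{w(e)}\] (with the convention $\left(\frac{w(e)}{\bar{w}_i}\right)^{w(e)}=1$ when $w(e)=0$).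
   Context: $\mathbb{F}$ is a field; $H(\cdot)$ denotes Shannon entropy (base 2) and $H(\cdot\mid\cdot)$ conditional entropy. $\mathcal{H}=([d],E,c)$ is an edge-colored (multi-)hypergraph with vertex set $[d]$, edge multiset $E$, coloring $c:E\to[r]$ which is $(d-k_1,\dots,d-k_r)$-uniform (each $c^{-1}(i)$ is a non-empty $(d-k_i)$-uniform simple hypergraph, $1\le k_i\le d-1$). $w:E\to\mathbb{R}_{\ge0}$ covers $\mathcal{H}$, i.e. $\sum_{e\ni j}w(e)\ge1$ for all $j\in[d]$; $|w|=\sum_e w(e)$; $\bar w_i=\sum_{e\in c^{-1}(i)}w(e)$. Each $\mathcal F_i$ is a multi-set of $k_i$-flats in $\mathbb{F}^d$. A point $p$ is an $\mathcal{H}$-joint if there are flats $(F_{p,e})_{e\in E}$ with $F_{p,e}\in\mathcal F_{c(e)}$ and an invertible affine map $A:\mathbb{F}^d\to\mathbb{F}^d$ with $A(0)=p$ and $F_{p,e}=A(\operatorname{span}\{\vec e_j\mid j\notin e\})$ for all $e$; $\mathcal J$ is the (finite) set of $\mathcal{H}$-joints, and $\mathcal{T}_p$ is the set of tuples $(F_{p,e})_{e\in E}$, $F_{p,e}\in\mathcal F_{c(e)}$, forming an $\mathcal{H}$-joint at $p$. The random edges $(e_i)$ are independent of $(p,(F_{p,e})_e)$, and $F_{p,e_i}$ denotes the flat of the tuple indexed by $e_i$. *)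

theory Defs
  imports "HOL-Probability.Probability" "HOL-Library.Multiset"
begin

text \<open>
  The ambient space is \<open>'a ^ 'd\<close> over an arbitrary field \<open>'a\<close>; the finite index type \<open>'d\<close> plays
  the role of the vertex set \<open>[d]\<close>, so \<open>d = CARD('d)\<close>.

  An edge-coloured multi-hypergraph is a finite set \<open>E\<close> of edge labels together with the map
  \<open>ends\<close> sending a label to its vertex set and the colouring \<open>c\<close>. Different labels may have
  the same vertex set (\<open>E\<close> is a multiset of edges), but not if they have the same colour
  (each colour class is a simple hypergraph).
\<close>

definition uniform_hypergraph ::
  "'e set \<Rightarrow> ('e \<Rightarrow> 'd::finite set) \<Rightarrow> nat \<Rightarrow> ('e \<Rightarrow> nat) \<Rightarrow> (nat \<Rightarrow> nat) \<Rightarrow> bool" where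
  "uniform_hypergraph E ends r c k \<longleftrightarrow>
     finite E \<and> c \<in> E \<rightarrow> {1..r} \<and>
     (\<forall>i\<in>{1..r}. 1 \<le> k i \<and> k i \<le> CARD('d) - 1 \<and>
        {e\<in>E. c e = i} \<noteq> {} \<and> inj_on ends {e\<in>E. c e = i} \<and>
        (\<forall>e\<in>{e\<in>E. c e = i}. card (ends e) = CARD('d) - k i))"

definition covers :: "'e set \<Rightarrow> ('e \<Rightarrow> 'd set) \<Rightarrow> ('e \<Rightarrow> real) \<Rightarrow> bool" where
  "covers E ends w \<longleftrightarrow> (\<forall>j. (\<Sum>e\<in>{e\<in>E. j \<in> ends e}. w e) \<ge> 1)"

definition color_weight :: "'e set \<Rightarrow> ('e \<Rightarrow> nat) \<Rightarrow> ('e \<Rightarrow> real) \<Rightarrow> nat \<Rightarrow> real" where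
  "color_weight E c w i = (\<Sum>e\<in>{e\<in>E. c e = i}. w e)"

definition is_flat :: "nat \<Rightarrow> ('a::field ^ 'd::finite) set \<Rightarrow> bool" where
  "is_flat m S \<longleftrightarrow> (\<exists>q U. vec.subspace U \<and> vec.dim U = m \<and> S = (\<lambda>v. q + v) ` U)"

definition invertible_affine :: "('a::field ^ 'd::finite \<Rightarrow> 'a ^ 'd) \<Rightarrow> bool" where
  "invertible_affine A \<longleftrightarrow>
     bij A \<and> (\<exists>L q. Vector_Spaces.linear (*s) (*s) L \<and> A = (\<lambda>x. L x + q))"

text \<open>
  The elements of a multiset, counted with multiplicity: the copies of \<open>x\<close> are the pairs \<open>(x, j)\<close>
  with \<open>j < count M x\<close>. Repeated flats are thus distinct elements, and the number of copies is
  \<open>size M\<close>.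
\<close>

definition copies :: "'b multiset \<Rightarrow> ('b \<times> nat) set" where
  "copies M = (SIGMA x:set_mset M. {..<count M x})"

definition joint_tuples ::
  "'e set \<Rightarrow> ('e \<Rightarrow> 'd::finite set) \<Rightarrow> ('e \<Rightarrow> nat) \<Rightarrow> (nat \<Rightarrow> ('a::field ^ 'd) set multiset) \<Rightarrow>
   'a ^ 'd \<Rightarrow> ('e \<Rightarrow> ('a ^ 'd) set \<times> nat) set" where
  "joint_tuples E ends c \<F> p =
     {T \<in> (\<Pi>\<^sub>E e\<in>E. copies (\<F> (c e))).
        \<exists>A. invertible_affine A \<and> A 0 = p \<and>
            (\<forall>e\<in>E. fst (T e) = A ` vec.span {axis j 1 |j. j \<notin> ends e})}"

definition joints ::
  "'e set \<Rightarrow> ('e \<Rightarrow> 'd::finite set) \<Rightarrow> ('e \<Rightarrow> nat) \<Rightarrow> (nat \<Rightarrow> ('a::field ^ 'd) set multiset) \<Rightarrow>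
   ('a ^ 'd) set" where
  "joints E ends c \<F> = {p. joint_tuples E ends c \<F> p \<noteq> {}}"

text \<open>
  Base-2 Shannon entropy of finitely-valued random variables. These are the library's
  \<open>\<H>(X)\<close> and \<open>\<H>(X | Y)\<close> of the locale \<open>information_space M 2\<close>.
\<close>

definition Ent :: "'w measure \<Rightarrow> ('w \<Rightarrow> 'b) \<Rightarrow> real" where
  "Ent M X = prob_space.entropy M 2 (count_space (X ` space M)) X"

definition Cond_Ent :: "'w measure \<Rightarrow> ('w \<Rightarrow> 'b) \<Rightarrow> ('w \<Rightarrow> 'c) \<Rightarrow> real" where
  "Cond_Ent M X Y =
     prob_space.conditional_entropy M 2 (count_space (X ` space M)) (count_space (Y ` space M)) X Y"

text \<open>
  Independence of discrete random variables: the events generated by \<open>X\<close> are independent of those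
  generated by \<open>Y\<close> (\<open>indep_set\<close> includes their measurability). The library's \<open>indep_var\<close>
  does not apply because it requires both variables to have the same value type.
\<close>

definition indep_discrete :: "'w measure \<Rightarrow> ('w \<Rightarrow> 'b) \<Rightarrow> ('w \<Rightarrow> 'c) \<Rightarrow> bool" where
  "indep_discrete M X Y \<longleftrightarrow>
     prob_space.indep_set M {X -` A \<inter> space M |A. True} {Y -` B \<inter> space M |B. True}"

text \<open>
  The \<open>if\<close> is the convention \<open>0\<^sup>0 = 1\<close>, which \<open>powr\<close> does not follow. The vertex set enters
  only through its size \<open>d\<close>.
\<close>

definition joints_const ::
  "nat \<Rightarrow> 'e set \<Rightarrow> nat \<Rightarrow> ('e \<Rightarrow> nat) \<Rightarrow> (nat \<Rightarrow> nat) \<Rightarrow> ('e \<Rightarrow> real) \<Rightarrow> real" where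
  "joints_const d E r c k w =
     fact d powr ((\<Sum>e\<in>E. w e) - 1) *
     (\<Prod>i=1..r. (1 / fact (k i)) powr color_weight E c w i *
        (\<Prod>e\<in>{e\<in>E. c e = i}.
           if w e = 0 then 1 else (w e / color_weight E c w i) powr w e))"

end

theory Submission
  imports Defs "HOL-Library.Function_Algebras"
begin

text \<open>
  The entropies \<open>H(e\<^sub>i)\<close> cancel against the weight factors of the constant. With
  \<open>W = |w| - 1\<close>, and \<open>X\<^sub>i\<close> the flat of the random edge of colour \<open>i\<close>, what remains is
  \<open>\<Sum>\<^sub>i w\<^sub>i (H(p | X\<^sub>i) + log k\<^sub>i!) \<le> W (H(p) + log d!)\<close>.

  This follows from the polynomial method with handicaps. Let the points of the support of \<open>p\<close>
  impose vanishing conditions of growing order on polynomials of degree at most \<open>n\<close>, in turn, a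
  point with a larger handicap being ahead of the others, and let \<open>b(p, F)\<close> be the number of
  conditions on the restriction to the flat \<open>F\<close> that are due to \<open>p\<close> and independent of the earlier
  ones. For a \<open>k\<close>-flat these numbers add up to at most \<open>(n + k) choose k\<close>, and for the whole space
  to exactly \<open>(n + d) choose d\<close>. Passing to leading exponents, the conditions at \<open>p\<close> in the whole
  space project into those on the flats through \<open>p\<close>, so Shearer's inequality gives
  \<open>b(p, space)^W \<le> (n+1)^c (\<Prod>\<^sub>e b(p, F\<^sub>e)^w(e))\<close>, where \<open>c\<close> is the excess of the cover.

  The handicaps can be chosen so that the right-hand side is, up to lower order terms, at least
  \<open>(P(p) n^d / d!)^W\<close> at every point simultaneously. Gibbs' inequality for the conditional
  distribution of \<open>p\<close> given \<open>X\<^sub>i\<close> against \<open>b(\<cdot>, X\<^sub>i)\<close> then yields the claim as \<open>n\<close> tends to infinity.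
\<close>

section \<open>Joint kernels of linear functionals\<close>

text \<open>The law of \<open>p\<close> is arbitrary, while the number of conditions in the whole
  space is fixed. The handicaps decide how this total is shared: raising one handicap cannot enlarge
  the shares of the other points, and a single unit changes the share of the point itself by a
  controlled amount. So a discrete choice can reach shares proportional to any law, up to a bounded
  loss in the degree.

  Conditions are counted by dimensions, and orders of vanishing by degrees after a substitution,
  never by derivatives; this works in every characteristic. A basis of the conditions at a joint
  that suits all flats of the tuple at once is not at hand. Leading exponents replace it: they form
  a finite set of exponent vectors whose coordinate projections are within reach of Shearer's
  inequality.

  The flats contribute the power \<open>n\<close> to the \<open>\<Sum> w_i k_i\<close>, the whole
  space \<open>n\<close> to the \<open>W d\<close>. These exponents differ by exactly the excess of
  the cover, which the factor \<open>(n+1)^c\<close> makes up for. Only the factorials of the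
  binomial coefficients survive the limit; they are the factorials of the constant.\<close>

context vector_space
begin

text \<open>Rank-nullity for one functional: a vector \<open>g\<close> with
  \<open>l g \<noteq> 0\<close> completes a basis of the kernel to one of \<open>W\<close>. The
  finite spanning set \<open>D\<close> stands in for finite dimension, since the space of all
  functions used later is not finite-dimensional.\<close>

lemma dim_kernel_step:
  fixes l :: "'b \<Rightarrow> 'a"
  assumes W: "subspace W" "W \<subseteq> span D" "finite D"
    and add: "\<And>f g. l (f + g) = l f + l g" and scl: "\<And>a f. l (scale a f) = a * l f"
  shows "dim W = dim {f \<in> W. l f = 0} + (if \<exists>f\<in>W. l f \<noteq> 0 then 1 else 0)"
proof (cases "\<exists>f\<in>W. l f \<noteq> 0")
  case False
  then have "{f \<in> W. l f = 0} = W" by auto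
  with False show ?thesis by simp
next
  case True
  then obtain g where g: "g \<in> W" "l g \<noteq> 0" by blast
  define K where "K = {f \<in> W. l f = 0}"
  have l0: "l 0 = 0" using scl[of 0 0] by simp
  have K: "subspace K"
    unfolding K_def using W(1) by (auto simp: subspace_def add scl l0)
  obtain B where B: "B \<subseteq> K" "independent B" "K \<subseteq> span B" "card B = dim K"
    by (rule basis_exists)
  have sB: "span B = K" using B K by (metis span_minimal subset_antisym)
  have gB: "g \<notin> span B" using g sB by (auto simp: K_def)
  have ind: "independent (insert g B)" by (rule independent_insertI[OF gB B(2)])
  have BW: "insert g B \<subseteq> W" using B(1) g(1) by (auto simp: K_def)
  have finB: "finite B"
    using independent_span_bound[OF W(3) B(2)] B(1) W(2) by (auto simp: K_def)
  have "W \<subseteq> span (insert g B)"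
  proof
    fix f assume f: "f \<in> W"
    define h where "h = f - scale (l f / l g) g"
    have "f = h + scale (l f / l g) g" by (simp add: h_def)
    then have "l f = l h + l f / l g * l g" by (metis add scl)
    then have "l h = 0" using g by simp
    moreover have "h \<in> W" unfolding h_def
      using W(1) f g(1) by (simp add: subspace_diff subspace_scale)
    ultimately have "h \<in> span B" using sB by (simp add: K_def)
    then show "f \<in> span (insert g B)"
      unfolding span_insert h_def by blast
  qed
  then have "dim W = card (insert g B)"
    using dim_unique[OF BW _ ind] by blast
  also have "\<dots> = dim K + 1"
    using gB finB B(4) span_superset by (metis Suc_eq_plus1 card_insert_disjoint in_mono)
  finally show ?thesis using True by (simp add: K_def)
qed

text \<open>The functionals are imposed one after the other in the order of \<^term>\<open>\<phi>\<close>; those counted on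
  the right are the ones that cut down the current kernel.\<close>

lemma dim_joint_kernel:
  fixes l :: "'x \<Rightarrow> 'b \<Rightarrow> 'a" and \<phi> :: "'x \<Rightarrow> nat"
  assumes X: "finite X" "inj_on \<phi> X"
    and W: "subspace W" "W \<subseteq> span D" "finite D"
    and add: "\<And>x f g. l x (f + g) = l x f + l x g"
    and scl: "\<And>x a f. l x (scale a f) = a * l x f"
  shows "dim W = dim {f \<in> W. \<forall>x\<in>X. l x f = 0} +
    card {x \<in> X. \<exists>f\<in>W. l x f \<noteq> 0 \<and> (\<forall>y\<in>X. \<phi> y < \<phi> x \<longrightarrow> l y f = 0)}"
  using X
proof (induction X rule: finite_ranking_induct[where f = \<phi>])
  case empty
  then show ?case by simp
next
  case (insert x X)
  show ?case
  proof (cases "x \<in> X")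
    case True
    then show ?thesis using insert by (simp add: insert_absorb)
  next
    case False
    have lt: "\<phi> y < \<phi> x" if "y \<in> X" for y
      using insert.hyps(2)[OF that] insert.prems False that
      by (metis inj_on_insert insert_Diff_single insert_iff le_neq_implies_less image_eqI Diff_empty Diff_insert0)
    have l0: "l x 0 = 0" for x using scl[of x 0 0] by simp
    let ?K = "{f \<in> W. \<forall>x\<in>X. l x f = 0}"
    let ?C = "{x \<in> X. \<exists>f\<in>W. l x f \<noteq> 0 \<and> (\<forall>y\<in>X. \<phi> y < \<phi> x \<longrightarrow> l y f = 0)}"
    let ?C' = "{z \<in> insert x X. \<exists>f\<in>W. l z f \<noteq> 0 \<and> (\<forall>y\<in>insert x X. \<phi> y < \<phi> z \<longrightarrow> l y f = 0)}"
    have K: "subspace ?K" using W(1) by (auto simp: subspace_def add scl l0)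
    have KD: "?K \<subseteq> span D" using W(2) by auto
    have "dim W = dim ?K + card ?C" using insert by simp
    also have "dim ?K = dim {f \<in> ?K. l x f = 0} + (if \<exists>f\<in>?K. l x f \<noteq> 0 then 1 else 0)"
      by (rule dim_kernel_step[OF K KD W(3) add scl])
    also have "{f \<in> ?K. l x f = 0} = {f \<in> W. \<forall>x\<in>insert x X. l x f = 0}" by auto
    finally have d: "dim W = dim {f \<in> W. \<forall>x\<in>insert x X. l x f = 0} +
        (if \<exists>f\<in>?K. l x f \<noteq> 0 then 1 else 0) + card ?C" .
    \<comment> \<open>\<open>x\<close> has the largest rank, so its insertion leaves the test for
      the older functionals unchanged.\<close>
    have "?C' = ?C \<union> (if \<exists>f\<in>?K. l x f \<noteq> 0 then {x} else {})"
      using lt False by (auto split: if_splits dest: less_asym)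
    then have "card ?C' = card ?C + (if \<exists>f\<in>?K. l x f \<noteq> 0 then 1 else 0)"
      using False insert.hyps(1) by auto
    then show ?thesis using d by linarith
  qed
qed

text \<open>\<open>dim\<close> is the cardinality of a basis, hence 0 in infinite dimension, so
  monotonicity rests on the finite spanning set.\<close>

lemma dim_mono_span:
  assumes "subspace V" "subspace W" "V \<subseteq> W" "W \<subseteq> span D" "finite D"
  shows "dim V \<le> dim W"
proof -
  obtain B where B: "B \<subseteq> V" "independent B" "V \<subseteq> span B" "card B = dim V"
    by (rule basis_exists)
  obtain C where C: "C \<subseteq> W" "independent C" "W \<subseteq> span C" "card C = dim W"
    by (rule basis_exists)
  have "finite C" using independent_span_bound[OF assms(5) C(2)] C(1) assms(4) by auto
  then have "card B \<le> card C"
    using independent_span_bound[OF _ B(2), of C] B(1) assms(3) C(3) by auto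
  then show ?thesis using B C by simp
qed

end

section \<open>Polynomials as functions\<close>

text \<open>A polynomial over \<^typ>\<open>'a\<close> is represented by the function that it induces on the infinite
  domain \<^typ>\<open>'a poly\<close>. Unlike the function on \<^typ>\<open>'a\<close> itself this determines the coefficients even
  if the field is finite, and substitution is composition.\<close>

definition monom_fun :: "('d::finite \<Rightarrow> nat) \<Rightarrow> ('d \<Rightarrow> 'a::field poly) \<Rightarrow> 'a poly" where
  "monom_fun \<gamma> y = (\<Prod>j\<in>UNIV. y j ^ \<gamma> j)"

definition pscale :: "'a::field \<Rightarrow> (('d \<Rightarrow> 'a poly) \<Rightarrow> 'a poly) \<Rightarrow> ('d \<Rightarrow> 'a poly) \<Rightarrow> 'a poly" where
  "pscale a f = (\<lambda>y. smult a (f y))"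

interpretation pf: vector_space "pscale :: 'a::field \<Rightarrow> (('d \<Rightarrow> 'a poly) \<Rightarrow> 'a poly) \<Rightarrow> _"
  by standard (auto simp: pscale_def fun_eq_iff smult_add_left smult_add_right)

lemma pscale_apply: "pscale a f y = smult a (f y)"
  by (simp add: pscale_def)

definition Pol :: "('d::finite \<Rightarrow> nat) set \<Rightarrow> (('d \<Rightarrow> 'a::field poly) \<Rightarrow> 'a poly) set" where
  "Pol S = pf.span (monom_fun ` S)"

definition total_degree :: "('d::finite \<Rightarrow> nat) \<Rightarrow> nat" where
  "total_degree \<gamma> = (\<Sum>j\<in>UNIV. \<gamma> j)"

lemma digits_unique:
  fixes a b :: "nat \<Rightarrow> nat"
  assumes "\<And>i. i < n \<Longrightarrow> a i < B" "\<And>i. i < n \<Longrightarrow> b i < B"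
    and "(\<Sum>i<n. a i * B ^ i) = (\<Sum>i<n. b i * B ^ i)" and "i < n"
  shows "a i = b i"
  using assms
proof (induction n arbitrary: a b i)
  case 0
  then show ?case by simp
next
  case (Suc n)
  have shift: "(\<Sum>i<Suc n. c i * B ^ i) = c 0 + B * (\<Sum>i<n. c (Suc i) * B ^ i)" for c
    unfolding sum.lessThan_Suc_shift by (simp add: sum_distrib_left mult.assoc mult.left_commute)
  have eq: "a 0 + B * (\<Sum>i<n. a (Suc i) * B ^ i) = b 0 + B * (\<Sum>i<n. b (Suc i) * B ^ i)"
    using Suc.prems(3) by (simp only: shift)
  have B: "B > 0" using Suc.prems(1)[of 0] by simp
  have "(a 0 + B * (\<Sum>i<n. a (Suc i) * B ^ i)) mod B = a 0"
    "(b 0 + B * (\<Sum>i<n. b (Suc i) * B ^ i)) mod B = b 0"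
    using Suc.prems(1,2)[of 0] by simp_all
  with eq have 0: "a 0 = b 0" by metis
  with eq B have "(\<Sum>i<n. a (Suc i) * B ^ i) = (\<Sum>i<n. b (Suc i) * B ^ i)" by simp
  then have "j < n \<Longrightarrow> a (Suc j) = b (Suc j)" for j
    using Suc.IH[of "\<lambda>i. a (Suc i)" "\<lambda>i. b (Suc i)" j] Suc.prems(1,2) by simp
  with 0 show ?case using Suc.prems(4) by (cases i) auto
qed

text \<open>The exponents of the Kronecker substitution; they separate monomials with exponents below
  \<^term>\<open>B\<close> and, being additive, also serve as a monomial order.\<close>

definition kronecker_weight :: "nat \<Rightarrow> ('d::finite \<Rightarrow> nat) \<Rightarrow> nat" where
  "kronecker_weight B \<gamma> = (\<Sum>j\<in>UNIV. \<gamma> j * B ^ to_nat_on UNIV j)"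

lemma kronecker_weight_inj:
  fixes \<gamma> \<delta> :: "'d::finite \<Rightarrow> nat"
  assumes "\<And>j. \<gamma> j < B" "\<And>j. \<delta> j < B" "kronecker_weight B \<gamma> = kronecker_weight B \<delta>"
  shows "\<gamma> = \<delta>"
proof -
  let ?i = "to_nat_on (UNIV :: 'd set)"
  have bij: "bij_betw ?i UNIV {..<CARD('d)}" by (rule to_nat_on_finite) simp
  have tr: "kronecker_weight B c = (\<Sum>i<CARD('d). c (the_inv_into UNIV ?i i) * B ^ i)" for c :: "'d \<Rightarrow> nat"
    unfolding kronecker_weight_def sum.reindex_bij_betw[OF bij, symmetric]
    using bij by (auto intro!: sum.cong simp: the_inv_into_f_f bij_betw_def)
  have "\<gamma> (the_inv_into UNIV ?i i) = \<delta> (the_inv_into UNIV ?i i)" if "i < CARD('d)" for i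
    by (rule digits_unique[of "CARD('d)" _ B _ i]) (use assms that tr in auto)
  then have "\<gamma> (the_inv_into UNIV ?i (?i j)) = \<delta> (the_inv_into UNIV ?i (?i j))" for j
    using bij by (auto simp: bij_betw_def)
  then show ?thesis using bij by (auto simp: the_inv_into_f_f bij_betw_def fun_eq_iff)
qed

lemma kronecker_weight_add: "kronecker_weight B (\<lambda>j. \<gamma> j + \<delta> j) = kronecker_weight B \<gamma> + kronecker_weight B \<delta>"
  by (simp add: kronecker_weight_def sum.distrib distrib_right)

lemma le_total_degree: "\<gamma> j \<le> total_degree \<gamma>"
  unfolding total_degree_def by (rule member_le_sum) auto

lemma total_degree_add: "total_degree (\<lambda>j. \<gamma> j + \<delta> j) = total_degree \<gamma> + total_degree \<delta>"
  by (simp add: total_degree_def sum.distrib)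

lemma finite_total_degree: "finite {\<gamma> :: 'd::finite \<Rightarrow> nat. total_degree \<gamma> \<le> n}"
proof (rule finite_subset)
  show "{\<gamma> :: 'd \<Rightarrow> nat. total_degree \<gamma> \<le> n} \<subseteq> PiE UNIV (\<lambda>_. {..n})"
    using le_total_degree order_trans by fastforce
qed (auto intro: finite_PiE)

lemma monom_fun_kron: "monom_fun \<gamma> (\<lambda>j. monom 1 (B ^ to_nat_on UNIV j)) = monom (1::'a::field) (kronecker_weight B \<gamma>)"
proof -
  have "(\<Prod>j\<in>A. monom (1::'a) (f j)) = monom 1 (\<Sum>j\<in>A. f j)" if "finite A" for A and f :: "'b \<Rightarrow> nat"
    using that by (induction rule: finite_induct) (auto simp: mult_monom monom_0 one_pCons)
  then show ?thesis by (simp add: monom_fun_def kronecker_weight_def monom_power mult.commute)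
qed

text \<open>Under the Kronecker substitution \<open>y\<close> the distinct monomials of
  \<open>T\<close> become distinct powers of one variable, and the coefficients can be read off.
  Values in \<open>'a poly\<close> rather than \<open>'a\<close> make this possible over a finite
  field.\<close>

lemma monom_fun_indep_aux:
  fixes T :: "('d::finite \<Rightarrow> nat) set" and a :: "_ \<Rightarrow> 'a::field"
  assumes T: "finite T" and z: "(\<Sum>\<gamma>\<in>T. pscale (a \<gamma>) (monom_fun \<gamma>)) = 0" and "\<delta> \<in> T"
  shows "a \<delta> = 0"
proof -
  obtain B where B: "\<And>\<gamma>. \<gamma> \<in> T \<Longrightarrow> total_degree \<gamma> < B"
    using finite_nat_set_iff_bounded[of "total_degree ` T"] T by auto
  have lt: "\<gamma> j < B" if "\<gamma> \<in> T" for \<gamma> j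
    using B[OF that] le_total_degree[of \<gamma> j] by simp
  define y where "y = (\<lambda>j::'d. monom (1::'a) (B ^ to_nat_on UNIV j))"
  have ev: "(\<Sum>\<gamma>\<in>S. pscale (a \<gamma>) (monom_fun \<gamma>)) y = (\<Sum>\<gamma>\<in>S. monom (a \<gamma>) (kronecker_weight B \<gamma>))" if "finite S" for S
    using that by (induction rule: finite_induct)
      (auto simp: pscale_apply y_def monom_fun_kron smult_monom)
  have "0 = coeff (\<Sum>\<gamma>\<in>T. monom (a \<gamma>) (kronecker_weight B \<gamma>)) (kronecker_weight B \<delta>)"
    using ev[OF T] z by simp
  also have "\<dots> = (\<Sum>\<gamma>\<in>T. if \<gamma> = \<delta> then a \<gamma> else 0)"
    unfolding coeff_sum
  proof (rule sum.cong)
    fix \<gamma> assume "\<gamma> \<in> T"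
    have "kronecker_weight B \<gamma> = kronecker_weight B \<delta> \<Longrightarrow> \<gamma> = \<delta>"
      by (rule kronecker_weight_inj[OF lt[OF \<open>\<gamma> \<in> T\<close>] lt[OF \<open>\<delta> \<in> T\<close>]])
    then show "coeff (monom (a \<gamma>) (kronecker_weight B \<gamma>)) (kronecker_weight B \<delta>) = (if \<gamma> = \<delta> then a \<gamma> else 0)"
      by (metis coeff_monom)
  qed simp
  also have "\<dots> = a \<delta>" using T \<open>\<delta> \<in> T\<close> by simp
  finally show ?thesis by simp
qed

lemma inj_monom_fun: "inj (monom_fun :: ('d::finite \<Rightarrow> nat) \<Rightarrow> ('d \<Rightarrow> 'a::field poly) \<Rightarrow> 'a poly)"
proof (rule injI, rule ccontr)
  fix \<gamma> \<delta> :: "'d \<Rightarrow> nat"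
  assume eq: "monom_fun \<gamma> = (monom_fun \<delta> :: ('d \<Rightarrow> 'a poly) \<Rightarrow> 'a poly)" and ne: "\<gamma> \<noteq> \<delta>"
  have "(if \<gamma> = \<gamma> then 1 else - 1) = (0::'a)"
    by (rule monom_fun_indep_aux[of "{\<gamma>,\<delta>}" "\<lambda>z. if z = \<gamma> then 1 else - 1"]) (use ne eq in auto)
  then show False by simp
qed

lemma independent_monom_fun:
  "pf.independent (range (monom_fun :: ('d::finite \<Rightarrow> nat) \<Rightarrow> ('d \<Rightarrow> 'a::field poly) \<Rightarrow> 'a poly))"
  unfolding pf.independent_explicit_finite_subsets
proof (intro allI impI)
  fix S and u :: "(('d \<Rightarrow> 'a poly) \<Rightarrow> 'a poly) \<Rightarrow> 'a"
  assume S: "S \<subseteq> range monom_fun" "finite S" and z: "(\<Sum>v\<in>S. pscale (u v) v) = 0"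
  obtain T where T: "finite T" "S = monom_fun ` T"
    using finite_subset_image[OF S(2,1)] by blast
  have inj: "inj_on (monom_fun :: _ \<Rightarrow> ('d \<Rightarrow> 'a poly) \<Rightarrow> 'a poly) T" using inj_monom_fun by (rule inj_on_subset) simp
  have z': "(\<Sum>\<gamma>\<in>T. pscale (u (monom_fun \<gamma>)) (monom_fun \<gamma>)) = 0"
    using z unfolding T(2) sum.reindex[OF inj] by (simp add: comp_def)
  have "u (monom_fun \<delta>) = 0" if "\<delta> \<in> T" for \<delta>
    by (rule monom_fun_indep_aux[where a = "\<lambda>\<gamma>. u (monom_fun \<gamma>)" and T = T, OF T(1) z' that])
  then show "\<forall>v\<in>S. u v = 0" unfolding T(2) by blast
qed

text \<open>Induction eta-expands function-valued terms; with these rules the simplifier would then rewrite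
  sums and products of polynomials below the lambda.\<close>

declare plus_fun_apply [simp del] zero_fun_apply [simp del] times_fun_apply [simp del]

text \<open>A linear functional on all functions, so that additivity holds without membership
  conditions. Independence of the monomials provides it; outside their span its values are
  arbitrary.\<close>

definition mcoeff :: "('d::finite \<Rightarrow> nat) \<Rightarrow> (('d \<Rightarrow> 'a::field poly) \<Rightarrow> 'a poly) \<Rightarrow> 'a" where
  "mcoeff \<gamma> = (SOME l. Vector_Spaces.linear pscale (*) l \<and>
     (\<forall>\<delta>. l (monom_fun \<delta>) = (if \<delta> = \<gamma> then 1 else 0)))"

lemma vector_space_self: "vector_space ((*) :: 'a::field \<Rightarrow> 'a \<Rightarrow> 'a)"
  by standard (auto simp: algebra_simps)

text \<open>The target is left general: the field as target gives the coefficient functionals, the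
  function space itself gives the extraction of a coefficient in some of the variables.\<close>

lemma monom_fun_extend:
  fixes h :: "('d::finite \<Rightarrow> nat) \<Rightarrow> 'b::ab_group_add" and s :: "'a::field \<Rightarrow> 'b \<Rightarrow> 'b"
  assumes "vector_space s"
  shows "\<exists>l. Vector_Spaces.linear (pscale :: 'a \<Rightarrow> _) s l \<and> (\<forall>\<delta>. l (monom_fun \<delta>) = h \<delta>)"
proof -
  interpret vp: vector_space_pair "pscale :: 'a \<Rightarrow> (('d \<Rightarrow> 'a poly) \<Rightarrow> 'a poly) \<Rightarrow> _" s
    using assms pf.vector_space_axioms by (simp add: vector_space_pair_def)
  obtain l where "Vector_Spaces.linear (pscale :: 'a \<Rightarrow> (('d \<Rightarrow> 'a poly) \<Rightarrow> 'a poly) \<Rightarrow> _) s l"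
    "\<forall>x\<in>range monom_fun. l x = h (inv monom_fun x)"
    using vp.linear_independent_extend[OF independent_monom_fun, of "\<lambda>x. h (inv monom_fun x)"] by blast
  moreover have "inv (monom_fun :: _ \<Rightarrow> ('d \<Rightarrow> 'a poly) \<Rightarrow> 'a poly) (monom_fun \<delta>) = \<delta>" for \<delta>
    by (rule inv_f_f[OF inj_monom_fun])
  ultimately show ?thesis by (intro exI[of _ l]) auto
qed

lemma mcoeff_props:
  "Vector_Spaces.linear (pscale :: 'a::field \<Rightarrow> _) (*) (mcoeff (\<gamma> :: 'd::finite \<Rightarrow> nat)) \<and> (\<forall>\<delta>. mcoeff \<gamma> (monom_fun \<delta> :: ('d \<Rightarrow> 'a poly) \<Rightarrow> 'a poly) = (if \<delta> = \<gamma> then 1 else 0))"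
  unfolding mcoeff_def
  using someI_ex[OF monom_fun_extend[OF vector_space_self, where h = "\<lambda>\<delta> :: 'd \<Rightarrow> nat. if \<delta> = \<gamma> then 1 else (0 :: 'a)"]] .

lemma mcoeff_monom: "mcoeff \<gamma> (monom_fun \<delta>) = (if \<delta> = \<gamma> then 1 else 0)"
  using mcoeff_props by blast

lemmas mcoeff_linear = Vector_Spaces.linear_iff[THEN iffD1, OF conjunct1[OF mcoeff_props]]

lemma mcoeff_add: "mcoeff \<gamma> (f + g) = mcoeff \<gamma> f + mcoeff \<gamma> g"
  using mcoeff_linear by blast

lemma mcoeff_scale: "mcoeff \<gamma> (pscale a f) = a * mcoeff \<gamma> f"
  using mcoeff_linear by blast

lemma mcoeff_0 [simp]: "mcoeff \<gamma> 0 = 0"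
  using mcoeff_scale[of \<gamma> 0 0] by simp

lemma mcoeff_sum: "mcoeff \<gamma> (\<Sum>x\<in>A. f x) = (\<Sum>x\<in>A. mcoeff \<gamma> (f x))"
proof (induction A rule: infinite_finite_induct)
  case (insert x F)
  then show ?case by (simp add: mcoeff_add)
qed simp_all

lemma Pol_subspace: "pf.subspace (Pol S)"
  by (simp add: Pol_def)

lemma monom_Pol: "\<gamma> \<in> S \<Longrightarrow> monom_fun \<gamma> \<in> Pol S"
  unfolding Pol_def by (rule pf.span_base) simp

lemma Pol_add: "f \<in> Pol S \<Longrightarrow> g \<in> Pol S \<Longrightarrow> f + g \<in> Pol S"
  unfolding Pol_def by (rule pf.span_add)

lemma Pol_scale: "f \<in> Pol S \<Longrightarrow> pscale a f \<in> Pol S"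
  unfolding Pol_def by (rule pf.span_scale)

lemma Pol_0: "0 \<in> Pol S"
  unfolding Pol_def by (rule pf.span_zero)

lemma Pol_mono: "S \<subseteq> T \<Longrightarrow> Pol S \<subseteq> Pol T"
  unfolding Pol_def by (rule pf.span_mono) auto

lemma Pol_induct [consumes 1, case_names zero add scale monom]:
  assumes "f \<in> Pol S" "P 0" "\<And>f g. P f \<Longrightarrow> P g \<Longrightarrow> P (f + g)" "\<And>a f. P f \<Longrightarrow> P (pscale a f)"
    and "\<And>\<gamma>. \<gamma> \<in> S \<Longrightarrow> P (monom_fun \<gamma>)"
  shows "P f"
  using assms(1) unfolding Pol_def
proof (induction rule: pf.span_induct)
  case base
  show ?case using assms by (auto simp: pf.subspace_def)
next
  case (step x)
  then show ?case using assms(5) by auto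
qed

lemma Pol_sum: "(\<And>x. x \<in> A \<Longrightarrow> f x \<in> Pol S) \<Longrightarrow> (\<Sum>x\<in>A. f x) \<in> Pol S"
  unfolding Pol_def by (rule pf.span_sum)

lemma mcoeff_Pol: "f \<in> Pol S \<Longrightarrow> \<gamma> \<notin> S \<Longrightarrow> mcoeff \<gamma> f = 0"
  by (induction rule: Pol_induct) (auto simp: mcoeff_add mcoeff_scale mcoeff_monom)

lemma Pol_expand:
  assumes "f \<in> Pol S"
  obtains T where "finite T" "T \<subseteq> S" "f = (\<Sum>\<gamma>\<in>T. pscale (mcoeff \<gamma> f) (monom_fun \<gamma>))"
proof -
  obtain V r where V: "finite V" "V \<subseteq> monom_fun ` S" "f = (\<Sum>v\<in>V. pscale (r v) v)"
    using assms unfolding Pol_def pf.span_explicit by auto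
  obtain T where T: "finite T" "T \<subseteq> S" "V = monom_fun ` T"
    using finite_subset_image[OF V(1,2)] by blast
  have inj: "inj_on (monom_fun :: _ \<Rightarrow> ('a \<Rightarrow> 'b poly) \<Rightarrow> 'b poly) T"
    using inj_monom_fun by (rule inj_on_subset) simp
  have f: "f = (\<Sum>\<gamma>\<in>T. pscale (r (monom_fun \<gamma>)) (monom_fun \<gamma>))"
    using V(3) inj unfolding T(3) by (simp add: sum.reindex)
  have "mcoeff \<delta> f = r (monom_fun \<delta>)" if "\<delta> \<in> T" for \<delta>
    using that T(1) unfolding f by (simp add: mcoeff_sum mcoeff_scale mcoeff_monom if_distrib sum.delta cong: if_cong)
  then have "f = (\<Sum>\<gamma>\<in>T. pscale (mcoeff \<gamma> f) (monom_fun \<gamma>))"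
    using f by (metis (no_types, lifting) sum.cong)
  with T that show ?thesis by blast
qed

lemma Pol_restrict:
  assumes "f \<in> Pol S" and "\<And>\<gamma>. \<gamma> \<in> S \<Longrightarrow> \<gamma> \<notin> T \<Longrightarrow> mcoeff \<gamma> f = 0"
  shows "f \<in> Pol T"
proof -
  obtain R where R: "finite R" "R \<subseteq> S" "f = (\<Sum>\<gamma>\<in>R. pscale (mcoeff \<gamma> f) (monom_fun \<gamma>))"
    using Pol_expand[OF assms(1)] .
  have "(\<Sum>\<gamma>\<in>R. pscale (mcoeff \<gamma> f) (monom_fun \<gamma>)) \<in> Pol T"
  proof (rule Pol_sum)
    fix \<gamma> assume "\<gamma> \<in> R"
    then show "pscale (mcoeff \<gamma> f) (monom_fun \<gamma>) \<in> Pol T"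
      using assms(2)[of \<gamma>] R(2) Pol_0[of T]
      by (cases "\<gamma> \<in> T") (auto intro: Pol_scale monom_Pol)
  qed
  then show ?thesis using R(3) by simp
qed

lemma Pol_empty: "Pol {} = {0}"
  by (simp add: Pol_def)

lemma Pol_eq_0: "f \<in> Pol S \<Longrightarrow> (\<And>\<gamma>. \<gamma> \<in> S \<Longrightarrow> mcoeff \<gamma> f = 0) \<Longrightarrow> f = 0"
  using Pol_restrict[of f S "{}"] by (auto simp: Pol_empty)

lemma monom_mult: "monom_fun \<gamma> * monom_fun \<delta> = monom_fun (\<lambda>j. \<gamma> j + \<delta> j)"
  by (auto simp: monom_fun_def fun_eq_iff power_add prod.distrib times_fun_def)

lemma pscale_mult_left: "pscale a f * g = pscale a (f * g)"
  by (auto simp: pscale_def fun_eq_iff times_fun_def)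

lemma pscale_mult_right: "f * pscale a g = pscale a (f * g)"
  by (auto simp: pscale_def fun_eq_iff times_fun_def)

lemma Pol_mult:
  assumes f: "f \<in> Pol S" and g: "g \<in> Pol T"
    and R: "\<And>\<gamma> \<delta>. \<gamma> \<in> S \<Longrightarrow> \<delta> \<in> T \<Longrightarrow> (\<lambda>j. \<gamma> j + \<delta> j) \<in> R"
  shows "f * g \<in> Pol R"
  using f
proof (induction rule: Pol_induct)
  case (monom \<gamma>)
  from g show ?case
  proof (induction rule: Pol_induct)
    case (monom \<delta>)
    then show ?case using R[OF \<open>\<gamma> \<in> S\<close>] by (auto simp: monom_mult intro: monom_Pol)
  qed (auto simp: Pol_0 pscale_mult_right distrib_left intro: Pol_add Pol_scale)
qed (auto simp: Pol_0 pscale_mult_left distrib_right intro: Pol_add Pol_scale)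

abbreviation deg_le :: "nat \<Rightarrow> ('d::finite \<Rightarrow> nat) set" where
  "deg_le n \<equiv> {\<gamma>. total_degree \<gamma> \<le> n}"

abbreviation deg_ge :: "nat \<Rightarrow> ('d::finite \<Rightarrow> nat) set" where
  "deg_ge n \<equiv> {\<gamma>. n \<le> total_degree \<gamma>}"

definition unit_exp :: "'d::finite \<Rightarrow> 'd \<Rightarrow> nat" where
  "unit_exp j = (\<lambda>i. if i = j then 1 else 0)"

lemma monom_unit: "monom_fun (unit_exp j) = (\<lambda>y. y j)"
  by (auto simp: monom_fun_def unit_exp_def fun_eq_iff prod.If_cases if_distrib cong: if_cong)

lemma monom_zero: "monom_fun (\<lambda>_. 0) = (\<lambda>y. 1)"
  by (auto simp: monom_fun_def fun_eq_iff)

lemma total_degree_unit: "total_degree (unit_exp j) = 1"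
  by (simp add: total_degree_def unit_exp_def)

lemma total_degree_zero: "total_degree (\<lambda>_. 0) = 0"
  by (simp add: total_degree_def)

lemma Pol_const: "(\<lambda>_. 0) \<in> S \<Longrightarrow> (\<lambda>y. [:a:]) \<in> Pol S"
proof -
  assume "(\<lambda>_. 0) \<in> S"
  then have "pscale a (monom_fun (\<lambda>_. 0)) \<in> Pol S" by (intro Pol_scale monom_Pol)
  then show ?thesis by (simp add: pscale_def monom_zero)
qed

text \<open>\<open>G\<close> is any family of exponent sets compatible with products. Degree bounds
  from above, from below, and constant families of exponents with restricted support are all
  instances, so one induction serves every substitution.\<close>

lemma monom_comp_Pol:
  assumes \<sigma>: "\<And>j. \<gamma> j \<noteq> 0 \<Longrightarrow> (\<lambda>y. \<sigma> y j) \<in> Pol (G 1)"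
    and G0: "(\<lambda>_. 0) \<in> G 0"
    and G: "\<And>a b \<gamma> \<delta>. \<gamma> \<in> G a \<Longrightarrow> \<delta> \<in> G b \<Longrightarrow> (\<lambda>j. \<gamma> j + \<delta> j) \<in> G (a + b)"
  shows "monom_fun \<gamma> \<circ> \<sigma> \<in> Pol (G (total_degree \<gamma>))"
proof -
  have pow: "(\<lambda>y. \<sigma> y j ^ m) \<in> Pol (G m)" if "\<gamma> j \<noteq> 0" for j m
  proof (induction m)
    case 0
    then show ?case using Pol_const[OF G0, of 1] by (simp add: one_pCons)
  next
    case (Suc m)
    have "(\<lambda>y. \<sigma> y j) * (\<lambda>y. \<sigma> y j ^ m) \<in> Pol (G (1 + m))"
      by (rule Pol_mult[OF \<sigma>[OF that] Suc G])
    then show ?case by (simp add: times_fun_def)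
  qed
  have pow': "(\<lambda>y. \<sigma> y j ^ \<gamma> j) \<in> Pol (G (\<gamma> j))" for j
    using pow[of j "\<gamma> j"] Pol_const[OF G0, of 1] by (cases "\<gamma> j = 0") (simp_all add: one_pCons)
  have "(\<lambda>y. \<Prod>j\<in>A. \<sigma> y j ^ \<gamma> j) \<in> Pol (G (\<Sum>j\<in>A. \<gamma> j))" for A
  proof (induction A rule: infinite_finite_induct)
    case (insert x F)
    have "(\<lambda>y. \<sigma> y x ^ \<gamma> x) * (\<lambda>y. \<Prod>j\<in>F. \<sigma> y j ^ \<gamma> j) \<in> Pol (G (\<gamma> x + (\<Sum>j\<in>F. \<gamma> j)))"
      by (rule Pol_mult[OF pow' insert(3) G])
    then show ?case using insert by (simp add: times_fun_def)
  qed (use Pol_const[OF G0, of 1] in \<open>simp_all add: one_pCons\<close>)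
  from this[of UNIV] show ?thesis by (simp add: monom_fun_def comp_def total_degree_def)
qed

lemma comp_plus: "(f + g) \<circ> \<sigma> = (f \<circ> \<sigma>) + (g \<circ> \<sigma>)"
  by (auto simp: fun_eq_iff plus_fun_def)

lemma comp_times: "(f * g) \<circ> \<sigma> = (f \<circ> \<sigma>) * (g \<circ> \<sigma>)"
  by (auto simp: fun_eq_iff times_fun_def)

lemma comp_pscale: "pscale a f \<circ> \<sigma> = pscale a (f \<circ> \<sigma>)"
  by (auto simp: fun_eq_iff pscale_def)

lemma Pol_comp:
  fixes f :: "('b::finite \<Rightarrow> 'c::field poly) \<Rightarrow> 'c poly"
  assumes "f \<in> Pol S" "\<And>\<gamma>. \<gamma> \<in> S \<Longrightarrow> monom_fun \<gamma> \<circ> \<sigma> \<in> Pol R"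
  shows "f \<circ> \<sigma> \<in> Pol R"
  using assms(1)
proof (induction rule: Pol_induct)
  case zero
  have "(0 :: ('b \<Rightarrow> 'c poly) \<Rightarrow> 'c poly) \<circ> \<sigma> = 0" by (simp add: comp_def zero_fun_def)
  then show ?case using Pol_0[of R] by simp
next
  case (add f g)
  show ?case unfolding comp_plus using add by (rule Pol_add)
next
  case (scale a f)
  show ?case unfolding comp_pscale using scale by (rule Pol_scale)
next
  case (monom \<gamma>)
  then show ?case by (rule assms(2))
qed

section \<open>Affine substitutions\<close>

definition aff :: "'a::field ^ 'd \<Rightarrow> 'a ^ 'd ^ 'd \<Rightarrow> ('d::finite \<Rightarrow> 'a poly) \<Rightarrow> 'd \<Rightarrow> 'a poly" where
  "aff q B y = (\<lambda>i. [:q $ i:] + (\<Sum>j\<in>UNIV. smult (B $ i $ j) (y j)))"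

lemma aff_comp: "aff q B \<circ> aff z C = aff (q + B *v z) (B ** C)"
proof (intro ext)
  fix y i
  have c: "[:\<Sum>j\<in>A. f j:] = (\<Sum>j\<in>A. [:f j:])" for A and f :: "'a \<Rightarrow> 'b"
  proof (induction A rule: infinite_finite_induct)
    case (insert x F)
    have "[:f x + sum f F:] = [:f x:] + [:sum f F:]" by simp
    with insert show ?case by simp
  qed simp_all
  have s1: "smult a (\<Sum>j\<in>A. f j) = (\<Sum>j\<in>A. smult a (f j))" for A a and f :: "'a \<Rightarrow> 'b poly"
    by (induction A rule: infinite_finite_induct) (simp_all add: smult_add_right)
  have s2: "smult (\<Sum>j\<in>A. f j) x = (\<Sum>j\<in>A. smult (f j) x)" for A x and f :: "'a \<Rightarrow> 'b"
    by (induction A rule: infinite_finite_induct) (simp_all add: smult_add_left)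
  have "(\<Sum>j\<in>UNIV. smult (B $ i $ j) (\<Sum>k\<in>UNIV. smult (C $ j $ k) (y k))) =
    (\<Sum>k\<in>UNIV. smult (\<Sum>j\<in>UNIV. B $ i $ j * C $ j $ k) (y k))"
    unfolding s1 s2 smult_smult by (rule sum.swap)
  moreover have "[:q $ i + (\<Sum>j\<in>UNIV. B $ i $ j * z $ j):] =
      [:q $ i:] + (\<Sum>j\<in>UNIV. [:B $ i $ j * z $ j:])"
    unfolding c[symmetric] by simp
  ultimately show "(aff q B \<circ> aff z C) y i = aff (q + B *v z) (B ** C) y i"
    by (simp add: aff_def smult_add_right sum.distrib matrix_vector_mult_def
        matrix_matrix_mult_def add.assoc)
qed

lemma aff_id: "aff 0 (mat 1) = id"
  by (auto simp: aff_def fun_eq_iff mat_def if_distrib [of "\<lambda>a. smult a _"] cong: if_cong)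

lemma Pol_linear_form:
  assumes "\<And>j. a j \<noteq> 0 \<Longrightarrow> unit_exp j \<in> S"
  shows "(\<lambda>y. \<Sum>j\<in>UNIV. smult (a j) (y j)) \<in> Pol S"
proof -
  have "(\<Sum>j\<in>UNIV. pscale (a j) (monom_fun (unit_exp j))) \<in> Pol S"
  proof (rule Pol_sum)
    fix j show "pscale (a j) (monom_fun (unit_exp j)) \<in> Pol S"
      using assms[of j] by (cases "a j = 0") (auto intro: Pol_0 Pol_scale monom_Pol)
  qed
  moreover have "(\<Sum>j\<in>A. pscale (a j) (monom_fun (unit_exp j))) = (\<lambda>y. \<Sum>j\<in>A. smult (a j) (y j))" for A
    by (induction A rule: infinite_finite_induct) (auto simp: fun_eq_iff pscale_def monom_unit plus_fun_def zero_fun_def)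
  ultimately show ?thesis by simp
qed

lemma aff_coord_Pol:
  assumes "q $ i \<noteq> 0 \<Longrightarrow> (\<lambda>_. 0) \<in> S" "\<And>j. B $ i $ j \<noteq> 0 \<Longrightarrow> unit_exp j \<in> S"
  shows "(\<lambda>y. aff q B y i) \<in> Pol S"
proof -
  have "(\<lambda>y. [:q $ i:]) \<in> Pol S"
    using Pol_const[OF assms(1)] Pol_0[of S] by (cases "q $ i = 0") (auto simp: zero_fun_def)
  from Pol_add[OF this Pol_linear_form[OF assms(2)]] show ?thesis
    by (simp add: aff_def plus_fun_def)
qed

lemma aff_deg_le: "f \<in> Pol (deg_le n) \<Longrightarrow> f \<circ> aff q B \<in> Pol (deg_le n)"
proof (erule Pol_comp)
  fix \<gamma> :: "'a \<Rightarrow> nat" assume "\<gamma> \<in> deg_le n"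
  moreover have "monom_fun \<gamma> \<circ> aff q B \<in> Pol (deg_le (total_degree \<gamma>))"
    by (rule monom_comp_Pol) (auto simp: total_degree_unit total_degree_zero total_degree_add intro!: aff_coord_Pol)
  moreover have "deg_le (total_degree \<gamma>) \<subseteq> deg_le n" using calculation by auto
  ultimately show "monom_fun \<gamma> \<circ> aff q B \<in> Pol (deg_le n)"
    using Pol_mono by blast
qed

lemma aff_Pol: "f \<in> Pol UNIV \<Longrightarrow> f \<circ> aff q B \<in> Pol UNIV"
  by (erule Pol_comp) (rule monom_comp_Pol[where G = "\<lambda>_. UNIV"], auto intro!: aff_coord_Pol)

text \<open>A homogeneous linear substitution cannot lower degrees; a translation would create terms
  of lower degree, which is why the base point is 0.\<close>

lemma aff_deg_ge: "f \<in> Pol (deg_ge n) \<Longrightarrow> f \<circ> aff 0 B \<in> Pol (deg_ge n)"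
proof (erule Pol_comp)
  fix \<gamma> :: "'a \<Rightarrow> nat" assume "\<gamma> \<in> deg_ge n"
  moreover have "monom_fun \<gamma> \<circ> aff 0 B \<in> Pol (deg_ge (total_degree \<gamma>))"
    by (rule monom_comp_Pol) (auto simp: total_degree_unit total_degree_zero total_degree_add intro!: aff_coord_Pol)
  moreover have "deg_ge (total_degree \<gamma>) \<subseteq> deg_ge n" using calculation by auto
  ultimately show "monom_fun \<gamma> \<circ> aff 0 B \<in> Pol (deg_ge n)"
    using Pol_mono by blast
qed

section \<open>Vanishing conditions and leading exponents\<close>

text \<open>The restriction of a polynomial to \<^term>\<open>F\<close> vanishes to order \<^term>\<open>m\<close> at \<^term>\<open>q\<close>.
  Quantifying over all affine maps into \<^term>\<open>F\<close> makes this independent of coordinates; for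
  \<^term>\<open>q \<notin> F\<close> it holds trivially.\<close>

definition vanish :: "('a::field ^ 'd::finite) set \<Rightarrow> 'a ^ 'd \<Rightarrow> nat \<Rightarrow> (('d \<Rightarrow> 'a poly) \<Rightarrow> 'a poly) set" where
  "vanish F q m = {f. \<forall>B. (\<forall>v. q + B *v v \<in> F) \<longrightarrow> f \<circ> aff q B \<in> Pol (deg_ge m)}"

lemma zero_comp: "(0 :: ('d \<Rightarrow> 'a::field poly) \<Rightarrow> 'a poly) \<circ> \<sigma> = 0"
  by (simp add: fun_eq_iff zero_fun_def)

lemma vanish_subspace: "pf.subspace (vanish F q m)"
  unfolding pf.subspace_def vanish_def mem_Collect_eq comp_plus comp_pscale zero_comp
  by (blast intro: Pol_0 Pol_add Pol_scale)

lemma deg_ge_mono: "m \<le> m' \<Longrightarrow> Pol (deg_ge m') \<subseteq> Pol (deg_ge m)"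
  by (rule Pol_mono) auto

lemma vanish_antimono: "m \<le> m' \<Longrightarrow> f \<in> vanish F q m' \<Longrightarrow> f \<in> vanish F q m"
  using deg_ge_mono unfolding vanish_def by blast

lemma vanish_0: "f \<in> Pol UNIV \<Longrightarrow> f \<in> vanish F q 0"
  unfolding vanish_def by (simp add: aff_Pol)

lemma vanish_mult:
  fixes F :: "('a::field ^ 'd::finite) set"
  assumes "f \<in> vanish F q a" "g \<in> vanish F q b"
  shows "f * g \<in> vanish F q (a + b)"
  unfolding vanish_def mem_Collect_eq comp_times
proof (intro allI impI)
  fix B :: "'a ^ 'd ^ 'd" assume B: "\<forall>v. q + B *v v \<in> F"
  show "(f \<circ> aff q B) * (g \<circ> aff q B) \<in> Pol (deg_ge (a + b))"
  proof (rule Pol_mult)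
    show "f \<circ> aff q B \<in> Pol (deg_ge a)" "g \<circ> aff q B \<in> Pol (deg_ge b)"
      using assms B by (auto simp: vanish_def)
  qed (auto simp: total_degree_add)
qed

lemma matrix_factor:
  fixes B B0 :: "'a::field ^ 'd ^ 'd"
  assumes "\<And>v. \<exists>u. B *v v = B0 *v u"
  shows "\<exists>C. B = B0 ** C"
proof -
  obtain u where u: "\<And>v. B *v v = B0 *v u v" using assms by metis
  \<comment> \<open>The choice \<open>u\<close> need not be linear: only its values on the unit
    vectors are used, as the columns of \<open>C\<close>.\<close>
  define C :: "'a ^ 'd ^ 'd" where "C = (\<chi> i j. u (axis j 1) $ i)"
  have "B = B0 ** C"
  proof (rule vec_eq_iff[THEN iffD2, rule_format], rule vec_eq_iff[THEN iffD2, rule_format])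
    fix i j
    have "B $ i $ j = (B *v axis j 1) $ i"
      by (simp add: matrix_vector_mult_def axis_def if_distrib cong: if_cong)
    also have "\<dots> = (B0 ** C) $ i $ j"
      unfolding u by (simp add: matrix_vector_mult_def matrix_matrix_mult_def C_def)
    finally show "B $ i $ j = (B0 ** C) $ i $ j" .
  qed
  then show ?thesis by blast
qed

text \<open>Every matrix that maps into the direction space of \<open>F\<close> factors through
  \<open>B0\<close>, and a linear substitution does not lower orders; hence one parametrisation
  decides. \<open>B0\<close> is square and may be singular.\<close>

lemma vanish_iff:
  fixes F :: "('a::field ^ 'd::finite) set"
  assumes F: "F = range (\<lambda>v. p + B0 *v v)" and q: "q \<in> F"
  shows "f \<in> vanish F q m \<longleftrightarrow> f \<circ> aff q B0 \<in> Pol (deg_ge m)"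
proof
  obtain u where u: "q = p + B0 *v u" using F q by auto
  have "q + B0 *v v \<in> F" for v
    unfolding F u by (rule image_eqI[of _ _ "u + v"]) (simp_all add: matrix_vector_right_distrib add.assoc)
  then show "f \<circ> aff q B0 \<in> Pol (deg_ge m)" if "f \<in> vanish F q m"
    using that by (auto simp: vanish_def)
  assume f: "f \<circ> aff q B0 \<in> Pol (deg_ge m)"
  show "f \<in> vanish F q m" unfolding vanish_def mem_Collect_eq
  proof (intro allI impI)
    fix B :: "'a ^ 'd ^ 'd" assume B: "\<forall>v. q + B *v v \<in> F"
    have "\<exists>w. B *v v = B0 *v w" for v
    proof -
      obtain u' where "q + B *v v = p + B0 *v u'" using B F by auto
      then have "B *v v = B0 *v (u' - u)"
        using u by (simp add: matrix_vector_mult_diff_distrib algebra_simps)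
      then show ?thesis by blast
    qed
    then obtain C where C: "B = B0 ** C" using matrix_factor[of B B0] by blast
    have "f \<circ> aff q B = (f \<circ> aff q B0) \<circ> aff 0 C"
      unfolding comp_assoc aff_comp C by simp
    then show "f \<circ> aff q B \<in> Pol (deg_ge m)" using aff_deg_ge[OF f] by simp
  qed
qed

lemma deg_le_ge_0: "f \<in> Pol (deg_le n) \<Longrightarrow> f \<in> Pol (deg_ge (Suc n)) \<Longrightarrow> f = 0"
  by (erule Pol_eq_0) (rule mcoeff_Pol, auto)

text \<open>Restricted to the flat, \<open>f\<close> has degree at most \<open>n\<close> but no term
  of degree at most \<open>n\<close>, so it is zero there, whichever base point is used.\<close>

lemma vanish_all:
  assumes F: "F = range (\<lambda>v. p + B0 *v v)" and q: "q \<in> F" and r: "r \<in> F"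
    and f: "f \<in> Pol (deg_le n)" "f \<in> vanish F q (Suc n)"
  shows "f \<circ> aff r B0 = 0" "f \<in> vanish F r m"
proof -
  have "f \<circ> aff q B0 \<in> Pol (deg_ge (Suc n))" using f(2) vanish_iff[OF F q] by simp
  then have 0: "f \<circ> aff q B0 = 0" using aff_deg_le[OF f(1)] deg_le_ge_0 by blast
  obtain u v where uv: "q = p + B0 *v u" "r = p + B0 *v v" using F q r by auto
  have "r = q + B0 *v (v - u)" unfolding uv by (simp add: matrix_vector_mult_diff_distrib)
  then have "f \<circ> aff r B0 = (f \<circ> aff q B0) \<circ> aff (v - u) (mat 1)"
    unfolding comp_assoc aff_comp by simp
  then show 1: "f \<circ> aff r B0 = 0" by (simp only: 0 zero_comp)
  show "f \<in> vanish F r m" unfolding vanish_iff[OF F r] 1 by (rule Pol_0)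
qed

text \<open>These are the initial exponents of the parts of degree \<open>m\<close>, where
  \<open>\<phi>\<close> is the monomial order and the smallest exponent counts as initial.\<close>

definition leading_exponents :: "(('d::finite \<Rightarrow> nat) \<Rightarrow> nat) \<Rightarrow> (('d \<Rightarrow> 'a::field poly) \<Rightarrow> 'a poly) set \<Rightarrow> nat \<Rightarrow> ('d \<Rightarrow> nat) set" where
  "leading_exponents \<phi> W m = {\<gamma>. total_degree \<gamma> = m \<and>
     (\<exists>g\<in>W. mcoeff \<gamma> g \<noteq> 0 \<and> (\<forall>\<delta>. total_degree \<delta> = m \<longrightarrow> \<phi> \<delta> < \<phi> \<gamma> \<longrightarrow> mcoeff \<delta> g = 0))}"

lemma leading_exponents_mono: "W \<subseteq> W' \<Longrightarrow> leading_exponents \<phi> W m \<subseteq> leading_exponents \<phi> W' m"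
  unfolding leading_exponents_def by blast

lemma finite_monoms: "finite (monom_fun ` deg_le n :: (('d::finite \<Rightarrow> 'a::field poly) \<Rightarrow> 'a poly) set)"
  by (intro finite_imageI finite_total_degree)

lemma Pol_dim_mono:
  "pf.subspace V \<Longrightarrow> pf.subspace W \<Longrightarrow> V \<subseteq> W \<Longrightarrow> W \<subseteq> Pol (deg_le n) \<Longrightarrow> pf.dim V \<le> pf.dim W"
  by (rule pf.dim_mono_span[OF _ _ _ _ finite_monoms]) (auto simp: Pol_def)

text \<open>The functionals are the coefficients of degree \<open>m\<close> in the monomial order:
  \<open>dim_joint_kernel\<close> counts the initial exponents, and the joint kernel consists of
  what vanishes to order \<open>Suc m\<close>. The bound \<open>m < B\<close> makes the order
  injective on degree \<open>m\<close>.\<close>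

lemma card_leads:
  fixes K :: "(('d::finite \<Rightarrow> 'a::field poly) \<Rightarrow> 'a poly) set"
  assumes K: "pf.subspace K" "K \<subseteq> Pol (deg_le n)"
    and m: "\<And>f. f \<in> K \<Longrightarrow> f \<circ> aff p B0 \<in> Pol (deg_ge m)" and B: "m < B"
  shows "card (leading_exponents (kronecker_weight B) ((\<lambda>f. f \<circ> aff p B0) ` K) m) =
    pf.dim K - pf.dim {f \<in> K. f \<circ> aff p B0 \<in> Pol (deg_ge (Suc m))}"
proof -
  let ?X = "{\<gamma> :: 'd \<Rightarrow> nat. total_degree \<gamma> = m}"
  let ?l = "\<lambda>\<gamma> f. mcoeff \<gamma> (f \<circ> aff p B0)"
  have fin: "finite ?X" by (rule finite_subset[OF _ finite_total_degree[of m]]) auto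
  have inj: "inj_on (kronecker_weight B) ?X"
  proof (rule inj_onI)
    fix \<gamma> \<delta> :: "'d \<Rightarrow> nat" assume a: "\<gamma> \<in> ?X" "\<delta> \<in> ?X" "kronecker_weight B \<gamma> = kronecker_weight B \<delta>"
    have lt: "\<eta> j < B" if "\<eta> \<in> ?X" for \<eta> j
      using that le_total_degree[of \<eta> j] B by auto
    show "\<gamma> = \<delta>"
      by (rule kronecker_weight_inj[where B = B]) (rule lt[OF a(1)], rule lt[OF a(2)], rule a(3))
  qed
  have D: "K \<subseteq> pf.span (monom_fun ` deg_le n)" using K(2) by (simp add: Pol_def)
  have d: "pf.dim K = pf.dim {f \<in> K. \<forall>\<gamma>\<in>?X. ?l \<gamma> f = 0} +
     card {\<gamma> \<in> ?X. \<exists>f\<in>K. ?l \<gamma> f \<noteq> 0 \<and> (\<forall>\<delta>\<in>?X. kronecker_weight B \<delta> < kronecker_weight B \<gamma> \<longrightarrow> ?l \<delta> f = 0)}"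
    by (rule pf.dim_joint_kernel[OF fin inj K(1) D finite_monoms])
      (simp_all only: comp_plus comp_pscale mcoeff_add mcoeff_scale)
  have "{\<gamma> \<in> ?X. \<exists>f\<in>K. ?l \<gamma> f \<noteq> 0 \<and> (\<forall>\<delta>\<in>?X. kronecker_weight B \<delta> < kronecker_weight B \<gamma> \<longrightarrow> ?l \<delta> f = 0)} =
      leading_exponents (kronecker_weight B) ((\<lambda>f. f \<circ> aff p B0) ` K) m"
    by (auto simp: leading_exponents_def)
  moreover have "(\<forall>\<gamma>\<in>?X. ?l \<gamma> f = 0) \<longleftrightarrow> f \<circ> aff p B0 \<in> Pol (deg_ge (Suc m))" if "f \<in> K" for f
  proof
    assume a: "\<forall>\<gamma>\<in>?X. ?l \<gamma> f = 0"
    show "f \<circ> aff p B0 \<in> Pol (deg_ge (Suc m))"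
      by (rule Pol_restrict[OF m[OF that]]) (use a in auto)
  qed (auto intro: mcoeff_Pol)
  ultimately show ?thesis using d by (simp cong: conj_cong)
qed

section \<open>Handicaps\<close>

text \<open>Order \<open>m'\<close> at \<open>q\<close> is imposed before order \<open>m\<close> at \<open>p\<close> if \<open>m' - \<alpha> q < m - \<alpha> p\<close>, with ties broken by
  \<open>idx\<close>. When it is the turn of order \<open>m\<close> at \<open>p\<close>, all orders below \<^term>\<open>required_order idx \<alpha> p m q\<close>
  have been imposed at \<open>q\<close>; the truncation of the subtraction is intended.\<close>

definition required_order :: "('p \<Rightarrow> nat) \<Rightarrow> ('p \<Rightarrow> nat) \<Rightarrow> 'p \<Rightarrow> nat \<Rightarrow> 'p \<Rightarrow> nat" where
  "required_order idx \<alpha> p m q = m + \<alpha> q + (if idx q < idx p then 1 else 0) - \<alpha> p"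

text \<open>Points of \<open>J\<close> off the flat impose nothing. At \<open>p\<close> itself, if
  it lies in \<open>J \<inter> F\<close>, the requirement is order \<open>m\<close>, the one reached
  just before its turn.\<close>

definition prior_space :: "('a::field ^ 'd::finite \<Rightarrow> nat) \<Rightarrow> nat \<Rightarrow> ('a ^ 'd) set \<Rightarrow> ('a ^ 'd) set \<Rightarrow>
    ('a ^ 'd \<Rightarrow> nat) \<Rightarrow> 'a ^ 'd \<Rightarrow> nat \<Rightarrow> (('d \<Rightarrow> 'a poly) \<Rightarrow> 'a poly) set" where
  "prior_space idx n J F \<alpha> p m =
     {f \<in> Pol (deg_le n). \<forall>q\<in>J \<inter> F. f \<in> vanish F q (required_order idx \<alpha> p m q)}"

text \<open>This is \<open>b(p, F)\<close> of the overview. Stopping at \<open>m = n\<close> loses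
  nothing: a restriction of degree at most \<open>n\<close> that vanishes to order
  \<open>n + 1\<close> is zero.\<close>

definition contribution :: "('a::field ^ 'd::finite \<Rightarrow> nat) \<Rightarrow> nat \<Rightarrow> ('a ^ 'd) set \<Rightarrow> ('a ^ 'd) set \<Rightarrow>
    ('a ^ 'd \<Rightarrow> nat) \<Rightarrow> 'a ^ 'd \<Rightarrow> nat" where
  "contribution idx n J F \<alpha> p = (\<Sum>m\<le>n. pf.dim (prior_space idx n J F \<alpha> p m) -
     pf.dim (prior_space idx n J F \<alpha> p m \<inter> vanish F p (Suc m)))"

lemma required_order_self [simp]: "required_order idx \<alpha> p m p = m"
  by (simp add: required_order_def)

lemma prior_space_subspace: "pf.subspace (prior_space idx n J F \<alpha> p m)"
proof -
  have "prior_space idx n J F \<alpha> p m = Pol (deg_le n) \<inter> (\<Inter>q\<in>J \<inter> F. vanish F q (required_order idx \<alpha> p m q))"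
    by (auto simp: prior_space_def)
  moreover have "pf.subspace (\<Inter>q\<in>J \<inter> F. vanish F q (required_order idx \<alpha> p m q))"
    by (rule pf.subspace_Inter) (auto simp: vanish_subspace)
  ultimately show ?thesis using pf.subspace_inter[OF Pol_subspace] by simp
qed

text \<open>Realises \<open>contribution\<close> by actual exponents, so that counts in the space
  and in its flats can be compared by inclusion and coordinate projection.\<close>

definition lead_set :: "nat \<Rightarrow> ('a::field ^ 'd::finite \<Rightarrow> nat) \<Rightarrow> nat \<Rightarrow> ('a ^ 'd) set \<Rightarrow> ('a ^ 'd) set \<Rightarrow>
    ('a ^ 'd \<Rightarrow> nat) \<Rightarrow> 'a ^ 'd \<Rightarrow> 'a ^ 'd ^ 'd \<Rightarrow> ('d \<Rightarrow> nat) set" where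
  "lead_set B idx n J F \<alpha> p B0 = (\<Union>m\<le>n. leading_exponents (kronecker_weight B) ((\<lambda>f. f \<circ> aff p B0) ` prior_space idx n J F \<alpha> p m) m)"

lemma lead_set_degree: "lead_set B idx n J F \<alpha> p B0 \<subseteq> deg_le n"
  by (auto simp: lead_set_def leading_exponents_def)

lemma finite_lead_set: "finite (lead_set B idx n J F \<alpha> p B0)"
  by (rule finite_subset[OF lead_set_degree finite_total_degree])

text \<open>Different degrees give disjoint exponents, and each degree is an instance of
  \<open>card_leads\<close>. Any \<open>B > n\<close> is allowed, which lets different degree bounds
  be compared under one monomial order.\<close>

lemma contribution_eq_card:
  assumes F: "F = range (\<lambda>v. p0 + B0 *v v)" and p: "p \<in> J" "p \<in> F" and B: "n < B"
  shows "contribution idx n J F \<alpha> p = card (lead_set B idx n J F \<alpha> p B0)"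
proof -
  have "card (lead_set B idx n J F \<alpha> p B0) =
     (\<Sum>m\<le>n. card (leading_exponents (kronecker_weight B) ((\<lambda>f. f \<circ> aff p B0) ` prior_space idx n J F \<alpha> p m) m))"
    unfolding lead_set_def
  proof (rule card_UN_disjoint)
    show "\<forall>m\<in>{..n}. finite (leading_exponents (kronecker_weight B) ((\<lambda>f. f \<circ> aff p B0) ` prior_space idx n J F \<alpha> p m) m)"
      by (auto intro!: finite_subset[OF _ finite_total_degree[of n]] simp: leading_exponents_def)
  qed (auto simp: leading_exponents_def)
  also have "\<dots> = contribution idx n J F \<alpha> p" unfolding contribution_def
  proof (rule sum.cong)
    fix m assume m: "m \<in> {..n}"
    have 1: "f \<circ> aff p B0 \<in> Pol (deg_ge m)" if "f \<in> prior_space idx n J F \<alpha> p m" for f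
    proof -
      have "f \<in> vanish F p (required_order idx \<alpha> p m p)" using that p unfolding prior_space_def by blast
      then show ?thesis by (simp add: vanish_iff[OF F p(2)])
    qed
    have 2: "prior_space idx n J F \<alpha> p m \<subseteq> Pol (deg_le n)" by (auto simp: prior_space_def)
    have 3: "{f \<in> prior_space idx n J F \<alpha> p m. f \<circ> aff p B0 \<in> Pol (deg_ge (Suc m))} =
        prior_space idx n J F \<alpha> p m \<inter> vanish F p (Suc m)"
      by (auto simp: vanish_iff[OF F p(2)])
    show "card (leading_exponents (kronecker_weight B) ((\<lambda>f. f \<circ> aff p B0) ` prior_space idx n J F \<alpha> p m) m) =
      pf.dim (prior_space idx n J F \<alpha> p m) - pf.dim (prior_space idx n J F \<alpha> p m \<inter> vanish F p (Suc m))"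
      unfolding 3[symmetric] by (rule card_leads[OF prior_space_subspace 2 1]) (use m B in auto)
  qed simp
  finally show ?thesis by simp
qed

lemma lead_set_mono:
  assumes "\<And>m q. m \<le> n \<Longrightarrow> q \<in> J \<inter> F \<Longrightarrow> required_order idx \<alpha> p m q \<le> required_order idx \<alpha>' p m q"
  shows "lead_set B idx n J F \<alpha>' p B0 \<subseteq> lead_set B idx n J F \<alpha> p B0"
proof -
  have "prior_space idx n J F \<alpha>' p m \<subseteq> prior_space idx n J F \<alpha> p m" if "m \<le> n" for m
    using assms[OF that] vanish_antimono unfolding prior_space_def by blast
  then show ?thesis
    unfolding lead_set_def by (intro UN_mono leading_exponents_mono image_mono) auto
qed

text \<open>Larger handicaps of the other points let more of their conditions precede those of
  \<open>p\<close>; the prior spaces shrink, and with them the sets of leading exponents.\<close>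

lemma contribution_antimono:
  fixes F :: "('a::field ^ 'd::finite) set" and B0 :: "'a ^ 'd ^ 'd"
  assumes F: "F = range (\<lambda>v. p0 + B0 *v v)" and p: "p \<in> J" "p \<in> F"
    and \<alpha>: "\<And>q. \<alpha> q \<le> \<alpha>' q" "\<alpha>' p = \<alpha> p"
  shows "contribution idx n J F \<alpha>' p \<le> contribution idx n J F \<alpha> p"
proof -
  have "lead_set (Suc n) idx n J F \<alpha>' p B0 \<subseteq> lead_set (Suc n) idx n J F \<alpha> p B0"
    by (rule lead_set_mono) (use \<alpha> in \<open>auto simp: required_order_def intro!: diff_le_mono\<close>)
  then show ?thesis
    unfolding contribution_eq_card[OF F p lessI] by (rule card_mono[OF finite_lead_set])
qed

text \<open>The product of one linear form \<open>y i - q $ i\<close> for each \<open>q\<close>,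
  with \<open>i\<close> a coordinate that distinguishes \<open>p\<close> from \<open>q\<close>. Its
  constant term \<open>c\<close> at \<open>p\<close> is the same in every chart
  \<open>B0\<close>.\<close>

lemma separating_poly:
  fixes p :: "'a::field ^ 'd::finite"
  assumes "finite Q" "p \<notin> Q"
  shows "\<exists>L c. L \<in> Pol (deg_le (card Q)) \<and> c \<noteq> 0 \<and> (\<forall>q\<in>Q. L \<in> vanish F q 1) \<and>
    (\<forall>B0 :: 'a ^ 'd ^ 'd. \<exists>h\<in>Pol (deg_ge 1). L \<circ> aff p B0 = (\<lambda>_. [:c:]) + h)"
  using assms
proof (induction Q rule: finite_induct)
  case empty
  have "(\<lambda>_. [:1:]) \<in> Pol (deg_le 0)" by (rule Pol_const) (simp add: total_degree_zero)
  moreover have "(\<lambda>_. [:1:]) \<circ> aff p B0 = (\<lambda>_. [:1:]) + 0" for B0 by (simp add: comp_def)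
  ultimately show ?case
    by (intro exI[of _ "\<lambda>_. [:1:]"] exI[of _ 1]) (auto intro: Pol_0)
next
  case (insert q Q)
  then obtain L c where L: "L \<in> Pol (deg_le (card Q))" "c \<noteq> 0" "\<forall>q\<in>Q. L \<in> vanish F q 1"
    "\<forall>B0 :: 'a ^ 'd ^ 'd. \<exists>h\<in>Pol (deg_ge 1). L \<circ> aff p B0 = (\<lambda>_. [:c:]) + h"
    using insert.IH insert.prems by blast
  obtain i where i: "p $ i \<noteq> q $ i" using insert.prems by (auto simp: vec_eq_iff)
  define l :: "('d \<Rightarrow> 'a poly) \<Rightarrow> 'a poly" where "l = (\<lambda>_. [:- q $ i:]) + (\<lambda>y. y i)"
  have y1: "(\<lambda>y. y i) \<in> Pol (deg_le 1)"
    unfolding monom_unit[symmetric] by (rule monom_Pol) (simp add: total_degree_unit)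
  have l1: "l \<in> Pol (deg_le 1)"
    unfolding l_def by (rule Pol_add[OF Pol_const y1]) (simp add: total_degree_zero)
  have "(\<lambda>y. \<Sum>j\<in>UNIV. smult (B $ i $ j) (y j)) \<in> Pol (deg_ge 1)" for B :: "'a ^ 'd ^ 'd"
    by (rule Pol_linear_form) (simp add: total_degree_unit)
  moreover have "l \<circ> aff r B = (\<lambda>_. [:r $ i - q $ i:]) + (\<lambda>y. \<Sum>j\<in>UNIV. smult (B $ i $ j) (y j))"
    for r and B :: "'a ^ 'd ^ 'd"
    by (simp add: l_def fun_eq_iff aff_def plus_fun_def)
  ultimately have l2: "\<exists>h\<in>Pol (deg_ge 1). l \<circ> aff r B = (\<lambda>_. [:r $ i - q $ i:]) + h"
    for r and B :: "'a ^ 'd ^ 'd" by blast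
  have z: "(\<lambda>_ :: 'd \<Rightarrow> 'a poly. 0 :: 'a poly) = 0" by (simp add: zero_fun_def)
  have l3: "l \<in> vanish F q 1"
    unfolding vanish_def using l2[of q] by (auto simp: z)
  have all: "f \<in> Pol (deg_le k) \<Longrightarrow> f \<in> vanish F r 0" for f k r
    using Pol_mono[of "deg_le k" UNIV] by (intro vanish_0) auto
  have "L * l \<in> Pol (deg_le (card (insert q Q)))"
    by (rule Pol_mult[OF L(1) l1]) (use insert.hyps in \<open>auto simp: total_degree_add\<close>)
  moreover have "c * (p $ i - q $ i) \<noteq> 0" using L(2) i by simp
  moreover have "L * l \<in> vanish F r 1" if "r \<in> insert q Q" for r
  proof (cases "r = q")
    case True
    then show ?thesis using vanish_mult[OF all[OF L(1)] l3] by simp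
  next
    case False
    then have "L \<in> vanish F r 1" using that L(3) by auto
    from vanish_mult[OF this all[OF l1]] show ?thesis by simp
  qed
  moreover have "\<exists>h\<in>Pol (deg_ge 1). (L * l) \<circ> aff p B0 = (\<lambda>_. [:c * (p $ i - q $ i):]) + h" for B0
  proof -
    obtain h where h: "h \<in> Pol (deg_ge 1)" "L \<circ> aff p B0 = (\<lambda>_. [:c:]) + h" using L(4) by blast
    obtain h' where h': "h' \<in> Pol (deg_ge 1)" "l \<circ> aff p B0 = (\<lambda>_. [:p $ i - q $ i:]) + h'"
      using l2 by blast
    have "(L * l) \<circ> aff p B0 = (\<lambda>_. [:c * (p $ i - q $ i):]) +
        (pscale (p $ i - q $ i) h + pscale c h' + h * h')"
      unfolding comp_times h(2) h'(2)
      by (auto simp: fun_eq_iff plus_fun_def times_fun_def pscale_def algebra_simps smult_add_right)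
    moreover have "h * h' \<in> Pol (deg_ge 1)"
      by (rule Pol_mult[OF h(1) h'(1)]) (auto simp: total_degree_add)
    ultimately show ?thesis using h(1) h'(1) by (blast intro: Pol_add Pol_scale)
  qed
  ultimately show ?case by blast
qed

text \<open>Raising the handicap at \<^term>\<open>p\<close> by one can be undone by multiplying with linear forms that
  vanish at the other points; this costs only \<^term>\<open>card J\<close> in the degree.\<close>

lemma contribution_raise:
  fixes F :: "('a::field ^ 'd::finite) set" and B0 :: "'a ^ 'd ^ 'd"
  assumes F: "F = range (\<lambda>v. p0 + B0 *v v)" and p: "p \<in> J" "p \<in> F" and J: "finite J"
  shows "contribution idx n J F (\<alpha>(p := Suc (\<alpha> p))) p \<le> contribution idx (n + card J) J F \<alpha> p"
proof -
  let ?\<alpha> = "\<alpha>(p := Suc (\<alpha> p))" and ?n = "n + card J"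
  obtain L c where L: "L \<in> Pol (deg_le (card (J - {p})))" "c \<noteq> 0" "\<forall>q\<in>J - {p}. L \<in> vanish F q 1"
    "\<forall>B0 :: 'a ^ 'd ^ 'd. \<exists>h\<in>Pol (deg_ge 1). L \<circ> aff p B0 = (\<lambda>_. [:c:]) + h"
    using separating_poly[of "J - {p}" p F] J by blast
  obtain h where h: "h \<in> Pol (deg_ge 1)" "L \<circ> aff p B0 = (\<lambda>_. [:c:]) + h" using L(4) by blast
  have L0: "L \<in> vanish F p 0" using L(1) Pol_mono[of "deg_le (card (J - {p}))" UNIV] by (intro vanish_0) auto
  have "lead_set (Suc ?n) idx n J F ?\<alpha> p B0 \<subseteq> lead_set (Suc ?n) idx ?n J F \<alpha> p B0"
  proof
    fix \<gamma> assume "\<gamma> \<in> lead_set (Suc ?n) idx n J F ?\<alpha> p B0"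
    then obtain m f where m: "m \<le> n" "total_degree \<gamma> = m" and f: "f \<in> prior_space idx n J F ?\<alpha> p m"
      and mcoeff: "mcoeff \<gamma> (f \<circ> aff p B0) \<noteq> 0"
      "\<And>\<delta>. total_degree \<delta> = m \<Longrightarrow> kronecker_weight (Suc ?n) \<delta> < kronecker_weight (Suc ?n) \<gamma> \<Longrightarrow> mcoeff \<delta> (f \<circ> aff p B0) = 0"
      unfolding lead_set_def leading_exponents_def by auto
    have fm: "f \<circ> aff p B0 \<in> Pol (deg_ge m)"
    proof -
      have "f \<in> vanish F p (required_order idx ?\<alpha> p m p)" using f p unfolding prior_space_def by blast
      then show ?thesis by (simp add: vanish_iff[OF F p(2)])
    qed
    \<comment> \<open>Passing from the raised handicap back to \<open>\<alpha>\<close> asks for at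
      most one more order at each other point, which the factor \<open>L\<close> supplies.\<close>
    have "f * L \<in> prior_space idx ?n J F \<alpha> p m"
      unfolding prior_space_def mem_Collect_eq
    proof (intro conjI ballI)
      have "card (J - {p}) \<le> card J" using J by (intro card_mono) auto
      then show "f * L \<in> Pol (deg_le ?n)"
        using f by (intro Pol_mult[OF _ L(1)]) (auto simp: prior_space_def total_degree_add intro: add_mono)
    next
      fix q assume q: "q \<in> J \<inter> F"
      then have fq: "f \<in> vanish F q (required_order idx ?\<alpha> p m q)" using f by (auto simp: prior_space_def)
      show "f * L \<in> vanish F q (required_order idx \<alpha> p m q)"
      proof (cases "q = p")
        case True
        then show ?thesis using vanish_mult[OF fq] L0 by fastforce
      next
        case False
        then have "L \<in> vanish F q 1" using L(3) q by auto
        from vanish_mult[OF fq this] show ?thesis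
          by (rule vanish_antimono[rotated]) (use False in \<open>auto simp: required_order_def\<close>)
      qed
    qed
    \<comment> \<open>\<open>f\<close> already has order \<open>m\<close> at \<open>p\<close>, so in
      degree \<open>m\<close> only the constant term of \<open>L\<close> is felt and the leading
      exponent stays the same.\<close>
    moreover have "mcoeff \<delta> ((f * L) \<circ> aff p B0) = c * mcoeff \<delta> (f \<circ> aff p B0)" if "total_degree \<delta> = m" for \<delta>
    proof -
      have "(f * L) \<circ> aff p B0 = pscale c (f \<circ> aff p B0) + (f \<circ> aff p B0) * h"
        unfolding comp_times h(2)
        by (auto simp: fun_eq_iff plus_fun_def times_fun_def pscale_def algebra_simps)
      moreover have "(f \<circ> aff p B0) * h \<in> Pol (deg_ge (Suc m))"
        by (rule Pol_mult[OF fm h(1)]) (auto simp: total_degree_add)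
      then have "mcoeff \<delta> ((f \<circ> aff p B0) * h) = 0" by (rule mcoeff_Pol) (use that in auto)
      ultimately show ?thesis by (simp add: mcoeff_add mcoeff_scale)
    qed
    ultimately have "\<gamma> \<in> leading_exponents (kronecker_weight (Suc ?n)) ((\<lambda>f. f \<circ> aff p B0) ` prior_space idx ?n J F \<alpha> p m) m"
      unfolding leading_exponents_def using mcoeff m(2) L(2) by (auto intro!: bexI[of _ "f * L"])
    then show "\<gamma> \<in> lead_set (Suc ?n) idx ?n J F \<alpha> p B0"
      unfolding lead_set_def using m(1) by (intro UN_I[of m]) auto
  qed
  then have "card (lead_set (Suc ?n) idx n J F ?\<alpha> p B0) \<le> card (lead_set (Suc ?n) idx ?n J F \<alpha> p B0)"
    by (rule card_mono[OF finite_lead_set])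
  moreover have "contribution idx n J F ?\<alpha> p = card (lead_set (Suc ?n) idx n J F ?\<alpha> p B0)"
    by (rule contribution_eq_card[OF F p]) simp
  moreover have "contribution idx ?n J F \<alpha> p = card (lead_set (Suc ?n) idx ?n J F \<alpha> p B0)"
    by (rule contribution_eq_card[OF F p]) simp
  ultimately show ?thesis by simp
qed

text \<open>All conditions are listed by rounds \<open>u\<close> and, within a round, by index;
  \<open>W u i\<close> is the space left before index \<open>i\<close> of round \<open>u\<close>.
  Each nonzero drop in dimension is one summand of one \<open>contribution\<close>, and the drops
  telescope.\<close>

lemma contribution_telescope:
  fixes F :: "('a::field ^ 'd::finite) set" and B0 :: "'a ^ 'd ^ 'd"
  assumes F: "F = range (\<lambda>v. p0 + B0 *v v)" and J: "finite J" and idx: "inj_on idx J"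
  shows "(\<Sum>p\<in>J \<inter> F. contribution idx n J F \<alpha> p) +
    pf.dim {f \<in> Pol (deg_le n). \<forall>q\<in>J \<inter> F. f \<in> vanish F q (Suc n)} =
    pf.dim (Pol (deg_le n) :: (('d \<Rightarrow> 'a poly) \<Rightarrow> 'a poly) set)"
proof -
  obtain M where M: "\<And>q. q \<in> J \<Longrightarrow> \<alpha> q \<le> M"
    using J finite_nat_set_iff_bounded_le[of "\<alpha> ` J"] by auto
  obtain N where N: "\<And>q. q \<in> J \<Longrightarrow> idx q < N"
    using J finite_nat_set_iff_bounded[of "idx ` J"] by auto
  \<comment> \<open>The shift by the bound \<open>M\<close> of the handicaps makes every requirement
    0 at the start; after round \<open>n + M\<close> each point has reached at least order
    \<open>n + 1\<close>.\<close>
  define T where "T u i q = u + \<alpha> q + (if idx q < i then 1 else 0) - M" for u i q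
  define W where "W u i = {f \<in> Pol (deg_le n). \<forall>q\<in>J \<inter> F. f \<in> vanish F q (T u i q)}" for u i
  define D where "D u i = int (pf.dim (W u i)) - int (pf.dim (W u (Suc i)))" for u i
  let ?E = "\<lambda>p m. int (pf.dim (prior_space idx n J F \<alpha> p m)) -
    int (pf.dim (prior_space idx n J F \<alpha> p m \<inter> vanish F p (Suc m)))"
  \<comment> \<open>A completed round is the beginning of the next one: the tie-break has then added
    1 at every point.\<close>
  have W_Suc: "W u N = W (Suc u) 0" for u
    unfolding W_def T_def using N by auto
  have D0: "D u i = 0" if "i \<notin> idx ` (J \<inter> F)" for u i
  proof -
    have "T u i q = T u (Suc i) q" if "q \<in> J \<inter> F" for q
      unfolding T_def using \<open>i \<notin> _\<close> that by (auto simp: less_Suc_eq)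
    then have "W u i = W u (Suc i)" unfolding W_def by auto
    then show ?thesis by (simp add: D_def)
  qed
  have Tne: "T u i q = T u (Suc i) q" if "q \<in> J \<inter> F" "p \<in> J \<inter> F" "q \<noteq> p" "i = idx p" for u i p q
    unfolding T_def using that idx by (auto simp: less_Suc_eq inj_on_def)
  have D1: "D u (idx p) = (if u + \<alpha> p < M then 0 else ?E p (u + \<alpha> p - M))" if p: "p \<in> J \<inter> F" for u p
  proof (cases "u + \<alpha> p < M")
    case True
    then have "T u (idx p) q = T u (Suc (idx p)) q" if "q \<in> J \<inter> F" for q
      using Tne[OF that p _ refl] by (cases "q = p") (auto simp: T_def)
    then have "W u (idx p) = W u (Suc (idx p))" unfolding W_def by auto
    with True show ?thesis by (simp add: D_def)
  next
    case False
    define m where "m = u + \<alpha> p - M"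
    have th: "T u (idx p) q = required_order idx \<alpha> p m q" for q
      using False by (auto simp: T_def required_order_def m_def)
    have 1: "W u (idx p) = prior_space idx n J F \<alpha> p m" by (simp add: W_def prior_space_def th)
    have "T u (Suc (idx p)) p = Suc m" using False by (simp add: T_def m_def Suc_diff_le)
    moreover have "T u (idx p) p = m" by (simp add: th)
    ultimately have "(\<forall>q\<in>J \<inter> F. f \<in> vanish F q (T u (Suc (idx p)) q)) \<longleftrightarrow>
        (\<forall>q\<in>J \<inter> F. f \<in> vanish F q (T u (idx p) q)) \<and> f \<in> vanish F p (Suc m)" for f
      using Tne[OF _ p _ refl] p vanish_antimono[of m "Suc m" f F p] by (metis le_SucI order_refl)
    then have 2: "W u (Suc (idx p)) = prior_space idx n J F \<alpha> p m \<inter> vanish F p (Suc m)"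
      unfolding 1[symmetric] W_def by blast
    show ?thesis using False unfolding D_def 1 2 m_def by simp
  qed
  \<comment> \<open>Orders beyond \<open>n\<close> cost nothing, so the extra rounds agree with the
    cut at \<open>n\<close> in \<open>contribution\<close>.\<close>
  have E0: "?E p m = 0" if "p \<in> J \<inter> F" "n < m" for p m
  proof -
    have "f \<in> vanish F p (Suc m)" if f: "f \<in> prior_space idx n J F \<alpha> p m" for f
    proof (rule vanish_all(2)[OF F])
      show "p \<in> F" "p \<in> F" using \<open>p \<in> J \<inter> F\<close> by auto
      show "f \<in> Pol (deg_le n)" using f by (simp add: prior_space_def)
      have "f \<in> vanish F p (required_order idx \<alpha> p m p)" using f \<open>p \<in> J \<inter> F\<close> unfolding prior_space_def by blast
      then show "f \<in> vanish F p (Suc n)" using \<open>n < m\<close> vanish_antimono[of "Suc n" m] by simp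
    qed
    then have "prior_space idx n J F \<alpha> p m \<inter> vanish F p (Suc m) = prior_space idx n J F \<alpha> p m" by blast
    then show ?thesis by simp
  qed
  have Esum: "(\<Sum>u\<le>n + M. D u (idx p)) = int (contribution idx n J F \<alpha> p)" if p: "p \<in> J \<inter> F" for p
  proof -
    have aM: "\<alpha> p \<le> M" using M p by auto
    have "(\<Sum>u\<le>n + M. D u (idx p)) = (\<Sum>u\<in>(\<lambda>m. m + (M - \<alpha> p)) ` {..n}. D u (idx p))"
    proof (rule sum.mono_neutral_right)
      show "\<forall>u\<in>{..n + M} - (\<lambda>m. m + (M - \<alpha> p)) ` {..n}. D u (idx p) = 0"
      proof
        fix u assume u: "u \<in> {..n + M} - (\<lambda>m. m + (M - \<alpha> p)) ` {..n}"
        show "D u (idx p) = 0"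
        proof (cases "u + \<alpha> p < M")
          case False
          then have "u = (u + \<alpha> p - M) + (M - \<alpha> p)" using aM by simp
          then have "\<not> u + \<alpha> p - M \<le> n" using u by blast
          then show ?thesis using D1[OF p, of u] E0[OF p] False by simp
        qed (simp add: D1[OF p])
      qed
    qed (use aM in auto)
    also have "\<dots> = (\<Sum>m\<le>n. ?E p m)"
      by (subst sum.reindex) (use aM in \<open>auto simp: D1[OF p] inj_on_def\<close>)
    also have "\<dots> = int (contribution idx n J F \<alpha> p)"
      unfolding contribution_def of_nat_sum
    proof (rule sum.cong)
      fix m
      have "pf.dim (prior_space idx n J F \<alpha> p m \<inter> vanish F p (Suc m)) \<le> pf.dim (prior_space idx n J F \<alpha> p m)"
        by (rule Pol_dim_mono[OF pf.subspace_inter[OF prior_space_subspace vanish_subspace] prior_space_subspace])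
          (auto simp: prior_space_def)
      then show "?E p m = int (pf.dim (prior_space idx n J F \<alpha> p m) -
          pf.dim (prior_space idx n J F \<alpha> p m \<inter> vanish F p (Suc m)))" by simp
    qed simp
    finally show ?thesis .
  qed
  have "int (pf.dim (W 0 0)) - int (pf.dim (W (Suc (n + M)) 0)) =
      (\<Sum>u\<le>n + M. int (pf.dim (W u 0)) - int (pf.dim (W (Suc u) 0)))"
    by (subst sum_telescope) simp
  also have "\<dots> = (\<Sum>u\<le>n + M. \<Sum>i<N. D u i)"
  proof (rule sum.cong)
    fix u
    show "int (pf.dim (W u 0)) - int (pf.dim (W (Suc u) 0)) = (\<Sum>i<N. D u i)"
      unfolding D_def W_Suc[symmetric] by (rule sum_lessThan_telescope'[symmetric])
  qed simp
  also have "\<dots> = (\<Sum>u\<le>n + M. \<Sum>p\<in>J \<inter> F. D u (idx p))"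
  proof (rule sum.cong)
    fix u
    have "(\<Sum>i<N. D u i) = (\<Sum>i\<in>idx ` (J \<inter> F). D u i)"
      by (rule sum.mono_neutral_right) (use N D0 in auto)
    also have "\<dots> = (\<Sum>p\<in>J \<inter> F. D u (idx p))"
      using idx by (subst sum.reindex) (auto simp: inj_on_def)
    finally show "(\<Sum>i<N. D u i) = (\<Sum>p\<in>J \<inter> F. D u (idx p))" .
  qed simp
  also have "\<dots> = (\<Sum>p\<in>J \<inter> F. int (contribution idx n J F \<alpha> p))"
    by (subst sum.swap) (simp add: Esum)
  finally have main: "int (pf.dim (W 0 0)) - int (pf.dim (W (Suc (n + M)) 0)) =
     (\<Sum>p\<in>J \<inter> F. int (contribution idx n J F \<alpha> p))" .
  have v0: "f \<in> vanish F q 0" if "f \<in> Pol (deg_le n)" for f q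
    using that Pol_mono[of "deg_le n" UNIV] by (intro vanish_0) auto
  have "W 0 0 = Pol (deg_le n)"
    using M v0 by (auto simp: W_def T_def)
  moreover have "W (Suc (n + M)) 0 = {f \<in> Pol (deg_le n). \<forall>q\<in>J \<inter> F. f \<in> vanish F q (Suc n)}"
    unfolding W_def
  proof (intro Collect_cong conj_cong refl ball_cong)
    fix f :: "('d \<Rightarrow> 'a poly) \<Rightarrow> 'a poly" and q assume f: "f \<in> Pol (deg_le n)" and q: "q \<in> J \<inter> F"
    have "Suc n \<le> T (Suc (n + M)) 0 q" by (simp add: T_def)
    then show "f \<in> vanish F q (T (Suc (n + M)) 0 q) \<longleftrightarrow> f \<in> vanish F q (Suc n)"
      using vanish_antimono vanish_all(2)[OF F _ _ f, of q q] q by blast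
  qed
  ultimately have "int (pf.dim (Pol (deg_le n) :: (('d \<Rightarrow> 'a poly) \<Rightarrow> 'a poly) set)) -
     int (pf.dim {f \<in> Pol (deg_le n). \<forall>q\<in>J \<inter> F. f \<in> vanish F q (Suc n)}) =
     int (\<Sum>p\<in>J \<inter> F. contribution idx n J F \<alpha> p)"
    using main by simp
  then show ?thesis by linarith
qed

section \<open>Counting conditions\<close>

text \<open>Stars and bars by induction on \<open>D\<close>: the value \<open>n - k\<close> at the
  new coordinate leaves the bound \<open>k\<close> for the others, and the counts add up by
  \<open>sum_choose_lower\<close>.\<close>

lemma card_exponents:
  assumes "finite D"
  shows "card {\<gamma> :: 'd \<Rightarrow> nat. (\<forall>j. j \<notin> D \<longrightarrow> \<gamma> j = 0) \<and> (\<Sum>j\<in>D. \<gamma> j) \<le> n} = (n + card D) choose card D \<and>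
    finite {\<gamma> :: 'd \<Rightarrow> nat. (\<forall>j. j \<notin> D \<longrightarrow> \<gamma> j = 0) \<and> (\<Sum>j\<in>D. \<gamma> j) \<le> n}"
  using assms
proof (induction D arbitrary: n rule: finite_induct)
  case empty
  have "{\<gamma> :: 'd \<Rightarrow> nat. \<forall>j. \<gamma> j = 0} = {\<lambda>_. 0}" by auto
  then show ?case by simp
next
  case (insert x D)
  let ?X = "\<lambda>n. {\<gamma> :: 'd \<Rightarrow> nat. (\<forall>j. j \<notin> D \<longrightarrow> \<gamma> j = 0) \<and> (\<Sum>j\<in>D. \<gamma> j) \<le> n}"
  let ?Y = "{\<gamma> :: 'd \<Rightarrow> nat. (\<forall>j. j \<notin> insert x D \<longrightarrow> \<gamma> j = 0) \<and> (\<Sum>j\<in>insert x D. \<gamma> j) \<le> n}"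
  have sum_upd: "(\<Sum>j\<in>D. (\<gamma>(x := i)) j) = (\<Sum>j\<in>D. \<gamma> j)" for \<gamma> :: "'d \<Rightarrow> nat" and i
    using insert.hyps by (intro sum.cong) auto
  have Y: "?Y = (\<Union>k\<le>n. (\<lambda>\<gamma>. \<gamma>(x := n - k)) ` ?X k)"
  proof (intro set_eqI iffI)
    fix \<gamma> assume g: "\<gamma> \<in> ?Y"
    then have le: "\<gamma> x + (\<Sum>j\<in>D. \<gamma> j) \<le> n" using insert.hyps by simp
    have mem: "\<gamma>(x := 0) \<in> ?X (n - \<gamma> x)" using g le by (auto simp: sum_upd simp del: fun_upd_apply) auto
    have eq: "\<gamma> = (\<gamma>(x := 0))(x := n - (n - \<gamma> x))" using le by auto
    have "\<gamma> \<in> (\<lambda>\<gamma>'. \<gamma>'(x := n - (n - \<gamma> x))) ` ?X (n - \<gamma> x)"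
      by (rule image_eqI[where x = "\<gamma>(x := 0)"]) (rule eq, rule mem)
    then show "\<gamma> \<in> (\<Union>k\<le>n. (\<lambda>\<gamma>. \<gamma>(x := n - k)) ` ?X k)"
      by (intro UN_I[of "n - \<gamma> x"]) auto
  next
    fix \<gamma> assume "\<gamma> \<in> (\<Union>k\<le>n. (\<lambda>\<gamma>. \<gamma>(x := n - k)) ` ?X k)"
    then obtain k \<delta> where k: "k \<le> n" "\<delta> \<in> ?X k" "\<gamma> = \<delta>(x := n - k)" by auto
    have "(\<Sum>j\<in>insert x D. \<gamma> j) = (n - k) + (\<Sum>j\<in>D. \<delta> j)"
      using insert.hyps sum_upd[of \<delta> "n - k"] by (simp add: k(3))
    then show "\<gamma> \<in> ?Y" using k by auto
  qed
  have inj: "inj_on (\<lambda>\<gamma>. \<gamma>(x := n - k)) (?X k)" for k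
  proof (rule inj_onI)
    fix \<gamma> \<delta> assume a: "\<gamma> \<in> ?X k" "\<delta> \<in> ?X k" "\<gamma>(x := n - k) = \<delta>(x := n - k)"
    have "\<gamma> x = 0" "\<delta> x = 0" using a insert.hyps by auto
    show "\<gamma> = \<delta>"
    proof
      fix j show "\<gamma> j = \<delta> j" using \<open>\<gamma> x = 0\<close> \<open>\<delta> x = 0\<close> fun_cong[OF a(3), of j] by (cases "j = x") auto
    qed
  qed
  have "card ?Y = (\<Sum>k\<le>n. card ((\<lambda>\<gamma>. \<gamma>(x := n - k)) ` ?X k))"
    unfolding Y
  proof (rule card_UN_disjoint)
    show "\<forall>k\<in>{..n}. finite ((\<lambda>\<gamma>. \<gamma>(x := n - k)) ` ?X k)"
      using insert.IH by (intro ballI finite_imageI) blast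
    show "\<forall>k\<in>{..n}. \<forall>l\<in>{..n}. k \<noteq> l \<longrightarrow> (\<lambda>\<gamma>. \<gamma>(x := n - k)) ` ?X k \<inter> (\<lambda>\<gamma>. \<gamma>(x := n - l)) ` ?X l = {}"
    proof (intro ballI impI equals0I)
      fix k l and \<gamma> :: "'d \<Rightarrow> nat" assume a: "k \<in> {..n}" "l \<in> {..n}" "k \<noteq> l"
        "\<gamma> \<in> (\<lambda>\<gamma>. \<gamma>(x := n - k)) ` ?X k \<inter> (\<lambda>\<gamma>. \<gamma>(x := n - l)) ` ?X l"
      obtain \<gamma>1 \<gamma>2 where "\<gamma> = \<gamma>1(x := n - k)" "\<gamma> = \<gamma>2(x := n - l)" using a(4) by blast
      then have "\<gamma> x = n - k" "\<gamma> x = n - l" by (metis fun_upd_same)+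
      with a(1-3) show False by auto
    qed
  qed auto
  also have "\<dots> = (\<Sum>k\<le>n. (card D + k) choose k)"
  proof (rule sum.cong)
    fix k
    have "card ((\<lambda>\<gamma>. \<gamma>(x := n - k)) ` ?X k) = (k + card D) choose card D"
      using card_image[OF inj] insert.IH[of k] by simp
    also have "\<dots> = (card D + k) choose k"
      using binomial_symmetric[of "card D" "k + card D"] by (simp add: add.commute)
    finally show "card ((\<lambda>\<gamma>. \<gamma>(x := n - k)) ` ?X k) = (card D + k) choose k" .
  qed simp
  also have "\<dots> = Suc (card D + n) choose n" by (rule sum_choose_lower)
  also have "\<dots> = (n + card (insert x D)) choose card (insert x D)"
    using insert.hyps binomial_symmetric[of n "Suc (card D + n)"] by (simp add: add.commute)
  moreover have "finite ?Y" unfolding Y using insert.IH by (intro finite_UN_I finite_imageI) auto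
  ultimately show ?case by simp
qed

lemma card_deg_le: "card (deg_le n :: ('d::finite \<Rightarrow> nat) set) = (n + CARD('d)) choose CARD('d)"
  using card_exponents[of "UNIV :: 'd set" n] by (simp add: total_degree_def)

lemma dim_Pol:
  "pf.dim (Pol (deg_le n) :: (('d::finite \<Rightarrow> 'a::field poly) \<Rightarrow> 'a poly) set) = (n + CARD('d)) choose CARD('d)"
proof -
  have ind: "pf.independent (monom_fun ` deg_le n :: (('d \<Rightarrow> 'a poly) \<Rightarrow> 'a poly) set)"
    by (rule pf.independent_mono[OF independent_monom_fun]) auto
  have inj: "inj_on (monom_fun :: _ \<Rightarrow> ('d \<Rightarrow> 'a poly) \<Rightarrow> 'a poly) (deg_le n)"
    using inj_monom_fun by (rule inj_on_subset) simp
  show ?thesis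
    unfolding Pol_def pf.dim_span_eq_card_independent[OF ind] card_image[OF inj] card_deg_le ..
qed

text \<open>The columns of \<open>B0\<close> off \<open>D\<close> vanish, so a restriction to
  \<open>F\<close> is a polynomial in \<open>card D\<close> variables. Killing its coefficients at
  one point of \<open>J \<inter> F\<close> makes it vanish on all of \<open>F\<close>, so no more
  conditions than coefficients are independent.\<close>

lemma contribution_sum_le:
  fixes F :: "('a::field ^ 'd::finite) set" and B0 :: "'a ^ 'd ^ 'd"
  assumes F: "F = range (\<lambda>v. p0 + B0 *v v)" and J: "finite J" and idx: "inj_on idx J"
    and D: "\<And>i j. j \<notin> D \<Longrightarrow> B0 $ i $ j = 0"
  shows "(\<Sum>p\<in>J \<inter> F. contribution idx n J F \<alpha> p) \<le> (n + card D) choose card D"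
proof (cases "J \<inter> F = {}")
  case False
  then obtain q where q: "q \<in> J" "q \<in> F" by blast
  let ?X = "{\<gamma> :: 'd \<Rightarrow> nat. (\<forall>j. j \<notin> D \<longrightarrow> \<gamma> j = 0) \<and> total_degree \<gamma> \<le> n}"
  let ?V = "Pol (deg_le n) :: (('d \<Rightarrow> 'a poly) \<Rightarrow> 'a poly) set"
  let ?K = "{f \<in> ?V. \<forall>\<gamma>\<in>?X. mcoeff \<gamma> (f \<circ> aff q B0) = 0}"
  let ?L = "{f \<in> ?V. \<forall>q\<in>J \<inter> F. f \<in> vanish F q (Suc n)}"
  have td: "total_degree \<gamma> = (\<Sum>j\<in>D. \<gamma> j)" if "\<forall>j. j \<notin> D \<longrightarrow> \<gamma> j = 0" for \<gamma> :: "'d \<Rightarrow> nat"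
    unfolding total_degree_def by (rule sum.mono_neutral_right) (use that in auto)
  have X: "?X = {\<gamma>. (\<forall>j. j \<notin> D \<longrightarrow> \<gamma> j = 0) \<and> (\<Sum>j\<in>D. \<gamma> j) \<le> n}"
    using td by auto
  have cX: "card ?X = (n + card D) choose card D" and fX: "finite ?X"
    unfolding X using card_exponents[of D n] by auto
  have injX: "inj_on (kronecker_weight (Suc n)) ?X"
  proof (rule inj_onI)
    fix \<gamma> \<delta> assume a: "\<gamma> \<in> ?X" "\<delta> \<in> ?X" "kronecker_weight (Suc n) \<gamma> = kronecker_weight (Suc n) \<delta>"
    have lt: "\<eta> j < Suc n" if "\<eta> \<in> ?X" for \<eta> j
      using that le_total_degree[of \<eta> j] by auto
    show "\<gamma> = \<delta>" by (rule kronecker_weight_inj) (rule lt[OF a(1)], rule lt[OF a(2)], rule a(3))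
  qed
  let ?C = "{\<gamma> \<in> ?X. \<exists>f\<in>?V. mcoeff \<gamma> (f \<circ> aff q B0) \<noteq> 0 \<and>
      (\<forall>\<delta>\<in>?X. kronecker_weight (Suc n) \<delta> < kronecker_weight (Suc n) \<gamma> \<longrightarrow> mcoeff \<delta> (f \<circ> aff q B0) = 0)}"
  have a: "pf.dim ?V = pf.dim ?K + card ?C"
    by (rule pf.dim_joint_kernel[OF fX injX Pol_subspace _ finite_monoms[of n]])
      (simp_all only: comp_plus comp_pscale mcoeff_add mcoeff_scale Pol_def order_refl)
  have b: "card ?C \<le> card ?X"
    by (rule card_mono[OF fX]) auto
  have 1: "pf.dim ?V \<le> pf.dim ?K + ((n + card D) choose card D)"
    unfolding a cX[symmetric] using b by (rule add_left_mono)
  have KL: "?K \<subseteq> ?L"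
  proof
    fix f assume f: "f \<in> ?K"
    then have fV: "f \<in> ?V" by simp
    have S: "f \<circ> aff q B0 \<in> Pol {\<gamma>. \<forall>j. j \<notin> D \<longrightarrow> \<gamma> j = 0}"
    proof (rule Pol_comp[OF fV])
      fix \<gamma> :: "'d \<Rightarrow> nat"
      show "monom_fun \<gamma> \<circ> aff q B0 \<in> Pol {\<gamma>. \<forall>j. j \<notin> D \<longrightarrow> \<gamma> j = 0}"
        by (rule monom_comp_Pol[where G = "\<lambda>_. {\<gamma>. \<forall>j. j \<notin> D \<longrightarrow> \<gamma> j = 0}"])
          (use D in \<open>auto intro!: aff_coord_Pol simp: unit_exp_def\<close>)
    qed
    have "f \<circ> aff q B0 = 0"
    proof (rule Pol_eq_0[OF S])
      fix \<gamma> :: "'d \<Rightarrow> nat" assume "\<gamma> \<in> {\<gamma>. \<forall>j. j \<notin> D \<longrightarrow> \<gamma> j = 0}"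
      then show "mcoeff \<gamma> (f \<circ> aff q B0) = 0"
        using f mcoeff_Pol[OF aff_deg_le[OF fV]] by (cases "total_degree \<gamma> \<le> n") auto
    qed
    then have "f \<in> vanish F q (Suc n)" unfolding vanish_iff[OF F q(2)] by (simp add: Pol_0)
    then show "f \<in> ?L" using vanish_all(2)[OF F q(2) _ fV] fV by blast
  qed
  have K: "pf.subspace ?K"
    using Pol_subspace[of "deg_le n"]
    by (auto simp: pf.subspace_def comp_plus comp_pscale zero_comp mcoeff_add mcoeff_scale simp del: comp_apply)
  have L: "pf.subspace ?L"
  proof -
    have "?L = ?V \<inter> (\<Inter>q\<in>J \<inter> F. vanish F q (Suc n))" by auto
    moreover have "pf.subspace (\<Inter>q\<in>J \<inter> F. vanish F q (Suc n))"
      by (rule pf.subspace_Inter) (auto simp: vanish_subspace)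
    ultimately show ?thesis using pf.subspace_inter[OF Pol_subspace] by simp
  qed
  have "pf.dim ?K \<le> pf.dim ?L" by (rule Pol_dim_mono[OF K L KL]) auto
  with 1 contribution_telescope[OF F J idx, of n \<alpha>] show ?thesis by linarith
qed simp

lemma aff_inverse:
  fixes M M' :: "'a::field ^ 'd::finite ^ 'd"
  assumes "M ** M' = mat 1"
  shows "aff p M \<circ> aff (- (M' *v p)) M' = id"
proof -
  have "M *v (- (M' *v p)) = - p"
  proof -
    have "M *v (- x) = - (M *v x)" for x
      by (simp add: vec_eq_iff matrix_vector_mult_def sum_negf)
    then show ?thesis using assms by (simp add: matrix_vector_mul_assoc)
  qed
  then show ?thesis unfolding aff_comp assms by (simp add: aff_id)
qed

text \<open>The gap puts all conditions outside \<open>A\<close> behind the orders up to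
  \<open>n\<close> in \<open>A\<close>, so the points of \<open>A\<close> behave as if they were
  alone. Order \<open>n + 1\<close> at a single point already forces a polynomial of degree at most
  \<open>n\<close> to be 0, so the telescoped sum is the full dimension.\<close>

lemma contribution_sum_UNIV:
  fixes J :: "('a::field ^ 'd::finite) set"
  assumes J: "finite J" and idx: "inj_on idx J" and A: "A \<subseteq> J" "A \<noteq> {}"
    and gap: "\<And>p q. p \<in> A \<Longrightarrow> q \<in> J - A \<Longrightarrow> \<alpha> q + n + 1 \<le> \<alpha> p"
  shows "(\<Sum>p\<in>A. contribution idx n J UNIV \<alpha> p) = (n + CARD('d)) choose CARD('d)"
proof -
  let ?V = "Pol (deg_le n) :: (('d \<Rightarrow> 'a poly) \<Rightarrow> 'a poly) set"
  have U: "UNIV = range (\<lambda>v. (0::'a ^ 'd) + mat 1 *v v)" by simp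
  have K: "prior_space idx n J UNIV \<alpha> p m = prior_space idx n A UNIV \<alpha> p m" if "p \<in> A" "m \<le> n" for p m
  proof -
    have "f \<in> vanish UNIV q (required_order idx \<alpha> p m q)" if f: "f \<in> ?V" and q: "q \<in> J - A" for f q
    proof -
      \<comment> \<open>The gap \<open>n + 1\<close> absorbs \<open>m \<le> n\<close> together with
        the 1 of the tie-break.\<close>
      have "required_order idx \<alpha> p m q = 0" using gap[OF \<open>p \<in> A\<close> q] \<open>m \<le> n\<close> by (simp add: required_order_def)
      then show ?thesis using f Pol_mono[of "deg_le n" UNIV] by (auto intro: vanish_0)
    qed
    then show ?thesis using A(1) unfolding prior_space_def by blast
  qed
  have "(\<Sum>p\<in>A. contribution idx n J UNIV \<alpha> p) = (\<Sum>p\<in>A \<inter> UNIV. contribution idx n A UNIV \<alpha> p)"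
    by (rule sum.cong) (auto simp: contribution_def K)
  moreover have "{f \<in> ?V. \<forall>q\<in>A \<inter> UNIV. f \<in> vanish UNIV q (Suc n)} = {0}"
  proof (intro set_eqI iffI)
    fix f assume f: "f \<in> {f \<in> ?V. \<forall>q\<in>A \<inter> UNIV. f \<in> vanish UNIV q (Suc n)}"
    obtain q where "q \<in> A" using A by blast
    then have "f \<in> vanish UNIV q (Suc n)" "f \<in> ?V" using f by auto
    then have "f \<circ> aff q (mat 1) = 0" using vanish_all(1)[OF U] by blast
    then have "f \<circ> (aff q (mat 1) \<circ> aff (- (mat 1 *v q)) (mat 1)) = 0"
      by (simp only: comp_assoc[symmetric] zero_comp)
    then show "f \<in> {0}" by (subst (asm) aff_inverse) auto
  next
    fix f :: "('d \<Rightarrow> 'a poly) \<Rightarrow> 'a poly" assume "f \<in> {0}"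
    then show "f \<in> {f \<in> ?V. \<forall>q\<in>A \<inter> UNIV. f \<in> vanish UNIV q (Suc n)}"
      using Pol_0 pf.subspace_0[OF vanish_subspace] by auto
  qed
  moreover have "pf.dim {0 :: ('d \<Rightarrow> 'a poly) \<Rightarrow> 'a poly} = 0"
    using pf.dim_unique[of "{}" "{0}" 0] by (simp add: pf.independent_empty)
  ultimately show ?thesis
    using contribution_telescope[OF U finite_subset[OF A(1) J] inj_on_subset[OF idx A(1)], of n \<alpha>]
    by (simp add: dim_Pol)
qed

section \<open>Projection of leading exponents onto the flats of a joint\<close>

definition restr :: "'d set \<Rightarrow> ('d \<Rightarrow> nat) \<Rightarrow> 'd \<Rightarrow> nat" where
  "restr e \<gamma> = (\<lambda>j. if j \<in> e then 0 else \<gamma> j)"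

text \<open>\<open>e\<close> is the vertex set of an edge; its flat is spanned by the axes outside
  \<open>e\<close>, so the coordinates in \<open>e\<close> are the ones set to 0.\<close>

definition proj_off :: "'d set \<Rightarrow> 'a::field ^ 'd::finite ^ 'd" where
  "proj_off e = (\<chi> i j. if i = j \<and> i \<notin> e then 1 else 0)"

lemma proj_off_vec: "(proj_off e *v v) $ i = (if i \<in> e then 0 else v $ i)"
  by (simp add: proj_off_def matrix_vector_mult_def if_distrib [of "\<lambda>x. x * _"] cong: if_cong)

lemma aff_proj_off: "aff z (proj_off e) y i = (if i \<in> e then [:z $ i:] else [:z $ i:] + y i)"
  by (simp add: aff_def proj_off_def if_distrib [of "\<lambda>x. smult x _"] cong: if_cong)

lemma total_degree_restr: "total_degree \<gamma> = total_degree (restr e \<gamma>) + (\<Sum>j\<in>e. \<gamma> j)"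
  for \<gamma> :: "'d::finite \<Rightarrow> nat"
proof -
  have "(\<Sum>j\<in>UNIV. \<gamma> j) = (\<Sum>j\<in>UNIV. restr e \<gamma> j + (if j \<in> e then \<gamma> j else 0))"
    by (rule sum.cong) (auto simp: restr_def)
  then show ?thesis by (simp add: total_degree_def sum.distrib sum.If_cases)
qed

text \<open>\<^term>\<open>X\<close> extracts the coefficient of a fixed monomial in the variables indexed by \<^term>\<open>e\<close>.\<close>

lemma coefficient_extraction:
  fixes \<gamma> :: "'d::finite \<Rightarrow> nat"
  obtains X :: "(('d \<Rightarrow> 'a::field poly) \<Rightarrow> 'a poly) \<Rightarrow> (('d \<Rightarrow> 'a poly) \<Rightarrow> 'a poly)" where
    "\<And>f S R. f \<in> Pol S \<Longrightarrow> (\<And>\<delta>. \<delta> \<in> S \<Longrightarrow> \<forall>j\<in>e. \<delta> j = \<gamma> j \<Longrightarrow> restr e \<delta> \<in> R) \<Longrightarrow> X f \<in> Pol R"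
    "\<And>f \<eta>. f \<in> Pol UNIV \<Longrightarrow> \<forall>j\<in>e. \<eta> j = 0 \<Longrightarrow> mcoeff \<eta> (X f) = mcoeff (\<lambda>j. if j \<in> e then \<gamma> j else \<eta> j) f"
    "\<And>f z. f \<in> Pol UNIV \<Longrightarrow> \<forall>j\<in>e. z $ j = 0 \<Longrightarrow> X f \<circ> aff z (proj_off e) = X (f \<circ> aff z (mat 1))"
proof -
  let ?h = "\<lambda>\<delta>. if \<forall>j\<in>e. \<delta> j = \<gamma> j then monom_fun (restr e \<delta>) else (0 :: ('d \<Rightarrow> 'a poly) \<Rightarrow> 'a poly)"
  obtain X :: "(('d \<Rightarrow> 'a poly) \<Rightarrow> 'a poly) \<Rightarrow> (('d \<Rightarrow> 'a poly) \<Rightarrow> 'a poly)"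
    where lin: "Vector_Spaces.linear pscale pscale X" and X: "\<And>\<delta>. X (monom_fun \<delta>) = ?h \<delta>"
    using monom_fun_extend[OF pf.vector_space_axioms, of ?h] by blast
  have Xadd: "X (f + g) = X f + X g" and Xscale: "X (pscale a f) = pscale a (X f)" for f g a
    using lin by (auto simp: Vector_Spaces.linear_iff)
  have X0: "X 0 = 0" using Xscale[of 0 0] by simp
  note Xs = Xadd Xscale X0
  show thesis
  proof (rule that)
    fix f :: "('d \<Rightarrow> 'a poly) \<Rightarrow> 'a poly" and S R
    assume f: "f \<in> Pol S" and R: "\<And>\<delta>. \<delta> \<in> S \<Longrightarrow> \<forall>j\<in>e. \<delta> j = \<gamma> j \<Longrightarrow> restr e \<delta> \<in> R"
    from f show "X f \<in> Pol R"
    proof (induction rule: Pol_induct)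
      case (monom \<delta>)
      show ?case
      proof (cases "\<forall>j\<in>e. \<delta> j = \<gamma> j")
        case True
        then have "X (monom_fun \<delta>) = monom_fun (restr e \<delta>)" unfolding X by (rule if_P)
        then show ?thesis using monom_Pol[OF R[OF monom True]] by (simp only:)
      next
        case False
        then have "X (monom_fun \<delta>) = 0" unfolding X by (rule if_not_P)
        then show ?thesis using Pol_0 by (simp only:)
      qed
    qed (simp_all only: Xs Pol_0 Pol_add Pol_scale)
  next
    fix f :: "('d \<Rightarrow> 'a poly) \<Rightarrow> 'a poly" and \<eta> :: "'d \<Rightarrow> nat"
    assume f: "f \<in> Pol UNIV" and \<eta>: "\<forall>j\<in>e. \<eta> j = 0"
    from f show "mcoeff \<eta> (X f) = mcoeff (\<lambda>j. if j \<in> e then \<gamma> j else \<eta> j) f"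
    proof (induction rule: Pol_induct)
      case (monom \<delta>)
      have "(restr e \<delta> = \<eta> \<and> (\<forall>j\<in>e. \<delta> j = \<gamma> j)) \<longleftrightarrow> \<delta> = (\<lambda>j. if j \<in> e then \<gamma> j else \<eta> j)"
        using \<eta> by (auto simp: restr_def fun_eq_iff split: if_splits)
      then show ?case unfolding X by (auto simp: mcoeff_monom)
    qed (simp_all only: Xs mcoeff_add mcoeff_scale mcoeff_0)
  next
    fix f :: "('d \<Rightarrow> 'a poly) \<Rightarrow> 'a poly" and z :: "'a ^ 'd"
    assume f: "f \<in> Pol UNIV" and z: "\<forall>j\<in>e. z $ j = 0"
    from f show "X f \<circ> aff z (proj_off e) = X (f \<circ> aff z (mat 1))"
    proof (induction rule: Pol_induct)
      case (monom \<delta>)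
      define \<delta>e where "\<delta>e = (\<lambda>j. if j \<in> e then \<delta> j else 0)"
      let ?u = "monom_fun (restr e \<delta>) \<circ> aff z (proj_off e)"
      let ?N = "{\<eta> :: 'd \<Rightarrow> nat. \<forall>j\<in>e. \<eta> j = 0}"
      have id: "aff z (mat 1) y i = [:z $ i:] + y i" for y i
        by (simp add: aff_def mat_def if_distrib [of "\<lambda>x. smult x _"] cong: if_cong)
      \<comment> \<open>\<open>z\<close> is 0 on \<open>e\<close>, so the translation leaves the
        variables of \<open>e\<close> alone and their monomial splits off as a factor.\<close>
      have split: "monom_fun \<delta> \<circ> aff z (mat 1) = monom_fun \<delta>e * ?u"
      proof
        fix y
        have "(\<Prod>j\<in>UNIV. aff z (mat 1) y j ^ \<delta> j) =
          (\<Prod>j\<in>UNIV. y j ^ \<delta>e j * aff z (proj_off e) y j ^ restr e \<delta> j)"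
          by (rule prod.cong) (use z in \<open>auto simp: id aff_proj_off restr_def \<delta>e_def\<close>)
        then show "(monom_fun \<delta> \<circ> aff z (mat 1)) y = (monom_fun \<delta>e * ?u) y"
          by (simp add: monom_fun_def times_fun_def prod.distrib)
      qed
      have u: "?u \<in> Pol ?N"
        by (rule monom_comp_Pol[where G = "\<lambda>_. ?N"])
          (auto intro!: aff_coord_Pol simp: proj_off_def unit_exp_def restr_def split: if_splits)
      define P where "P \<longleftrightarrow> (\<forall>j\<in>e. \<delta> j = \<gamma> j)"
      have X_split: "X (monom_fun \<delta>e * v) = (if P then v else 0)" if "v \<in> Pol ?N" for v
        using that
      proof (induction rule: Pol_induct)
        case zero
        show ?case by (simp only: mult_zero_right X0 if_cancel)
      next
        case (add f g)
        then show ?case unfolding distrib_left Xadd by (cases P) (simp_all only: if_True if_False add_0_left)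
      next
        case (scale a f)
        then show ?case unfolding pscale_mult_right Xscale
          by (cases P) (simp_all only: if_True if_False pf.scale_zero_right)
      next
        case (monom \<eta>)
        have "restr e (\<lambda>j. \<delta>e j + \<eta> j) = \<eta>" using monom by (auto simp: restr_def \<delta>e_def)
        moreover have "(\<forall>j\<in>e. \<delta>e j + \<eta> j = \<gamma> j) \<longleftrightarrow> P" using monom by (auto simp: \<delta>e_def P_def)
        ultimately show ?case by (simp only: monom_mult X)
      qed
      show ?case unfolding split X_split[OF u] X P_def[symmetric]
        by (cases P) (simp_all only: if_True if_False zero_comp)
    qed (simp_all only: Xs comp_plus comp_pscale zero_comp)
  qed
qed

text \<open>Extracting the coefficient of a monomial of degree \<open>s\<close> in the variables outside the flat lowers
  the vanishing orders at all points of the flat by \<open>s\<close>, and the order in which conditions are imposed is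
  invariant under such a common shift.\<close>

lemma lead_set_proj:
  fixes M :: "'a::field ^ 'd::finite ^ 'd"
  assumes M: "invertible M" and p: "p \<in> J" and \<gamma>: "\<gamma> \<in> lead_set B idx n J UNIV \<alpha> p M"
  shows "restr e \<gamma> \<in> lead_set B idx n J (range (\<lambda>v. p + (M ** proj_off e) *v v)) \<alpha> p (M ** proj_off e)"
proof -
  let ?F = "range (\<lambda>v. p + (M ** proj_off e) *v v)" and ?Me = "M ** proj_off e"
  obtain M' where M': "M ** M' = mat 1" "M' ** M = mat 1" using M by (auto simp: invertible_def)
  have U: "(UNIV :: ('a ^ 'd) set) = range (\<lambda>v. p + M *v v)"
  proof (intro set_eqI iffI)
    fix x
    have "x = p + M *v (M' *v (x - p))" using M' by (simp add: matrix_vector_mul_assoc)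
    then show "x \<in> range (\<lambda>v. p + M *v v)" by blast
  qed simp
  obtain m f where m: "m \<le> n" "total_degree \<gamma> = m" and f: "f \<in> prior_space idx n J UNIV \<alpha> p m"
    and lead: "mcoeff \<gamma> (f \<circ> aff p M) \<noteq> 0"
      "\<And>\<delta>. total_degree \<delta> = m \<Longrightarrow> kronecker_weight B \<delta> < kronecker_weight B \<gamma> \<Longrightarrow> mcoeff \<delta> (f \<circ> aff p M) = 0"
    using \<gamma> unfolding lead_set_def leading_exponents_def by auto
  define g where "g = f \<circ> aff p M"
  define s where "s = (\<Sum>j\<in>e. \<gamma> j)"
  define m' where "m' = m - s"
  have ms: "total_degree (restr e \<gamma>) = m'" "m = m' + s"
    using total_degree_restr[of \<gamma> e] m(2) by (auto simp: m'_def s_def)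
  obtain X :: "(('d \<Rightarrow> 'a poly) \<Rightarrow> 'a poly) \<Rightarrow> (('d \<Rightarrow> 'a poly) \<Rightarrow> 'a poly)" where
    X1: "\<And>f S R. f \<in> Pol S \<Longrightarrow> (\<And>\<delta>. \<delta> \<in> S \<Longrightarrow> \<forall>j\<in>e. \<delta> j = \<gamma> j \<Longrightarrow> restr e \<delta> \<in> R) \<Longrightarrow> X f \<in> Pol R"
    and X2: "\<And>f \<eta>. f \<in> Pol UNIV \<Longrightarrow> \<forall>j\<in>e. \<eta> j = 0 \<Longrightarrow> mcoeff \<eta> (X f) = mcoeff (\<lambda>j. if j \<in> e then \<gamma> j else \<eta> j) f"
    and X3: "\<And>f z. f \<in> Pol UNIV \<Longrightarrow> \<forall>j\<in>e. z $ j = 0 \<Longrightarrow> X f \<circ> aff z (proj_off e) = X (f \<circ> aff z (mat 1))"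
    using coefficient_extraction[of e \<gamma>] by blast
  have fV: "f \<in> Pol (deg_le n)" using f by (simp add: prior_space_def)
  have gV: "g \<in> Pol (deg_le n)" unfolding g_def by (rule aff_deg_le[OF fV])
  have gU: "g \<in> Pol UNIV" using gV Pol_mono[of "deg_le n" UNIV] by blast
  have hV: "X g \<in> Pol (deg_le n)"
    by (rule X1[OF gV]) (use total_degree_restr[of _ e] le_add1 in \<open>metis mem_Collect_eq order_trans\<close>)
  \<comment> \<open>\<open>X g\<close> is written in the chart \<open>M\<close>; the inverse chart
    carries it back to the original coordinates.\<close>
  define f' where "f' = X g \<circ> aff (- (M' *v p)) M'"
  have f'V: "f' \<in> Pol (deg_le n)" unfolding f'_def by (rule aff_deg_le[OF hV])
  \<comment> \<open>In the chart, points of the flat differ from \<open>p\<close> by vectors that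
    are 0 on \<open>e\<close>, and such translations commute with the extraction.\<close>
  have f'q: "f' \<circ> aff (p + ?Me *v w) ?Me = X (g \<circ> aff (proj_off e *v w) (mat 1))" for w
  proof -
    have "f' \<circ> aff (p + ?Me *v w) ?Me = X g \<circ> aff (proj_off e *v w) (proj_off e)"
      unfolding f'_def comp_assoc aff_comp
      by (simp add: matrix_vector_right_distrib matrix_vector_mul_assoc matrix_mul_assoc M')
    then show ?thesis by (simp add: X3[OF gU] proj_off_vec)
  qed
  have f'p: "f' \<circ> aff p ?Me = X g"
    using f'q[of 0] by (simp add: aff_id)
  have "f' \<in> prior_space idx n J ?F \<alpha> p m'"
    unfolding prior_space_def mem_Collect_eq
  proof (intro conjI ballI f'V)
    fix q assume q: "q \<in> J \<inter> ?F"
    then obtain w where w: "q = p + ?Me *v w" by blast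
    let ?t = "required_order idx \<alpha> p m q"
    have qM: "q = p + M *v (proj_off e *v w)" by (simp add: w matrix_vector_mul_assoc)
    have "f \<in> vanish UNIV q ?t" using f q by (auto simp: prior_space_def)
    then have "f \<circ> aff q M \<in> Pol (deg_ge ?t)" by (simp add: vanish_iff[OF U])
    moreover have "f \<circ> aff q M = g \<circ> aff (proj_off e *v w) (mat 1)"
      unfolding g_def comp_assoc aff_comp qM by simp
    ultimately have "g \<circ> aff (proj_off e *v w) (mat 1) \<in> Pol (deg_ge ?t)" by simp
    then have "X (g \<circ> aff (proj_off e *v w) (mat 1)) \<in> Pol (deg_ge (?t - s))"
    proof (rule X1)
      fix \<delta> :: "'d \<Rightarrow> nat" assume \<delta>: "\<delta> \<in> deg_ge ?t" "\<forall>j\<in>e. \<delta> j = \<gamma> j"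
      then have "(\<Sum>j\<in>e. \<delta> j) = s" unfolding s_def by (intro sum.cong) auto
      then show "restr e \<delta> \<in> deg_ge (?t - s)" using \<delta>(1) total_degree_restr[of \<delta> e] by auto
    qed
    then have "f' \<circ> aff q ?Me \<in> Pol (deg_ge (?t - s))" using f'q[of w] w by simp
    moreover have "?t - s = required_order idx \<alpha> p m' q" using ms(2) by (simp add: required_order_def)
    moreover have "q \<in> ?F" using q by simp
    ultimately show "f' \<in> vanish ?F q (required_order idx \<alpha> p m' q)"
      by (simp only: vanish_iff[OF refl])
  qed
  moreover have "restr e \<gamma> \<in> leading_exponents (kronecker_weight B) {X g} m'"
    unfolding leading_exponents_def
  proof (simp only: mem_Collect_eq ms(1) bex_simps simp_thms, intro conjI allI impI bexI[of _ "X g"])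
    have "(\<lambda>j. if j \<in> e then \<gamma> j else restr e \<gamma> j) = \<gamma>" by (auto simp: restr_def)
    then have "mcoeff (restr e \<gamma>) (X g) = mcoeff \<gamma> g" using X2[OF gU, of "restr e \<gamma>"] by (simp add: restr_def)
    then show "mcoeff (restr e \<gamma>) (X g) \<noteq> 0" using lead(1) by (simp add: g_def)
  next
    fix \<delta> :: "'d \<Rightarrow> nat" assume \<delta>: "total_degree \<delta> = m'" "kronecker_weight B \<delta> < kronecker_weight B (restr e \<gamma>)"
    show "mcoeff \<delta> (X g) = 0"
    proof (cases "\<forall>j\<in>e. \<delta> j = 0")
      case True
      let ?\<gamma>e = "\<lambda>j. if j \<in> e then \<gamma> j else 0" and ?\<delta> = "\<lambda>j. if j \<in> e then \<gamma> j else \<delta> j"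
      \<comment> \<open>The monomial order is additive, so adding the common part
        \<open>?\<gamma>e\<close> preserves the strict inequality.\<close>
      have 1: "?\<delta> = (\<lambda>j. \<delta> j + ?\<gamma>e j)" "\<gamma> = (\<lambda>j. restr e \<gamma> j + ?\<gamma>e j)" using True by (auto simp: restr_def)
      have "kronecker_weight B ?\<delta> = kronecker_weight B \<delta> + kronecker_weight B ?\<gamma>e" "kronecker_weight B \<gamma> = kronecker_weight B (restr e \<gamma>) + kronecker_weight B ?\<gamma>e"
        by (subst 1, rule kronecker_weight_add)+
      then have lt: "kronecker_weight B ?\<delta> < kronecker_weight B \<gamma>" using \<delta>(2) by simp
      have "restr e ?\<delta> = \<delta>" using True by (auto simp: restr_def)
      then have "total_degree ?\<delta> = m" using total_degree_restr[of ?\<delta> e] \<delta>(1) ms(2) by (simp add: s_def)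
      then have "mcoeff ?\<delta> g = 0" unfolding g_def using lt by (rule lead(2))
      then show ?thesis using X2[OF gU True] by simp
    next
      case False
      have "X g \<in> Pol {\<eta>. \<forall>j\<in>e. \<eta> j = 0}" by (rule X1[OF gU]) (simp add: restr_def)
      then show ?thesis by (rule mcoeff_Pol) (use False in simp)
    qed
  qed simp
  then have "restr e \<gamma> \<in> leading_exponents (kronecker_weight B) {f' \<circ> aff p ?Me} m'" by (simp only: f'p)
  ultimately have "restr e \<gamma> \<in> leading_exponents (kronecker_weight B) ((\<lambda>f. f \<circ> aff p ?Me) ` prior_space idx n J ?F \<alpha> p m') m'"
    using leading_exponents_mono[of "{f' \<circ> aff p ?Me}" "(\<lambda>f. f \<circ> aff p ?Me) ` prior_space idx n J ?F \<alpha> p m'"] by blast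
  moreover have "m' \<le> n" using m(1) ms(2) by simp
  ultimately show ?thesis unfolding lead_set_def by blast
qed

section \<open>Shearer's inequality, the choice of handicaps, and Gibbs' inequality\<close>

text \<open>For a uniformly random element of \<open>S\<close>,
  \<open>class_size S D x / card S\<close> is the probability of agreeing with \<open>x\<close> on
  \<open>D\<close>; the mean of minus its logarithm is the entropy of the marginal on
  \<open>D\<close>.\<close>

definition class_size :: "('d \<Rightarrow> 'v) set \<Rightarrow> 'd set \<Rightarrow> ('d \<Rightarrow> 'v) \<Rightarrow> real" where
  "class_size S D x = (\<Sum>y\<in>S. of_bool (\<forall>j\<in>D. x j = y j))"

lemma class_size_pos:
  assumes "finite S" "x \<in> S" shows "class_size S D x \<ge> 1"
proof -
  have "of_bool (\<forall>j\<in>D. x j = x j) \<le> class_size S D x"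
    unfolding class_size_def by (rule member_le_sum) (use assms in auto)
  then show ?thesis by simp
qed

lemma class_size_cong: "\<forall>j\<in>D. x j = y j \<Longrightarrow> class_size S D x = class_size S D y"
  unfolding class_size_def by (intro sum.cong) auto

text \<open>Submodularity of the marginal entropies, which are \<open>ln (card S)\<close> minus the
  mean of \<open>ln (class_size S D x)\<close>. By \<open>ln_le_minus_one\<close> it is enough that
  the ratios \<open>?r\<close> add up to at most \<open>card S\<close>.\<close>

lemma class_size_submodular:
  assumes S: "finite S" and D: "D \<subseteq> A"
  shows "(\<Sum>x\<in>S. ln (class_size S A x) + ln (class_size S (insert j D) x)) \<le>
    (\<Sum>x\<in>S. ln (class_size S (insert j A) x) + ln (class_size S D x))"
proof -
  let ?N = "class_size S"
  let ?r = "\<lambda>x. ?N A x * ?N (insert j D) x / (?N (insert j A) x * ?N D x)"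
  have pos: "?N X x > 0" if "x \<in> S" for X x
    using class_size_pos[OF S that, of X] by simp
  have inner: "(\<Sum>x\<in>S. of_bool (\<forall>i\<in>A. x i = y i) * (?N (insert j D) x / ?N (insert j A) x)) \<le> ?N D y"
    if y: "y \<in> S" for y
  proof -
    \<comment> \<open>The elements with a nonzero summand form, if there are any, one class for
      \<open>insert j A\<close>, so the weights add up to at most 1; there are none unless
      \<open>y\<close> and \<open>z\<close> agree on \<open>D\<close>.\<close>
    have one: "(\<Sum>x\<in>S. of_bool (\<forall>i\<in>A. x i = y i) * of_bool (\<forall>i\<in>insert j D. x i = z i) / ?N (insert j A) x)
        \<le> of_bool (\<forall>i\<in>D. y i = z i)" (is "(\<Sum>x\<in>S. ?t x) \<le> _") for z
    proof (cases "\<exists>x0\<in>S. (\<forall>i\<in>A. x0 i = y i) \<and> (\<forall>i\<in>insert j D. x0 i = z i)")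
      case False
      then have "?t x = 0" if "x \<in> S" for x using that by auto
      then have "(\<Sum>x\<in>S. ?t x) = 0" by (intro sum.neutral) blast
      then show ?thesis by simp
    next
      case True
      then obtain x0 where x0: "x0 \<in> S" "\<forall>i\<in>A. x0 i = y i" "\<forall>i\<in>insert j D. x0 i = z i" by blast
      then have yz: "\<forall>i\<in>D. y i = z i" using D by (metis insertCI subsetD)
      have "?t x \<le> of_bool (\<forall>i\<in>insert j A. x0 i = x i) / ?N (insert j A) x0" if "x \<in> S" for x
      proof (cases "(\<forall>i\<in>A. x i = y i) \<and> (\<forall>i\<in>insert j D. x i = z i)")
        case True
        then have "\<forall>i\<in>insert j A. x0 i = x i" using x0 by auto
        then show ?thesis using class_size_cong[of "insert j A" x0 x S] True by simp
      next
        case False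
        then have t0: "?t x = 0" by auto
        show ?thesis unfolding t0 using pos[OF x0(1), of "insert j A"] by (intro divide_nonneg_pos) auto
      qed
      then have "(\<Sum>x\<in>S. ?t x) \<le> (\<Sum>x\<in>S. of_bool (\<forall>i\<in>insert j A. x0 i = x i) / ?N (insert j A) x0)"
        by (rule sum_mono)
      also have "\<dots> = ?N (insert j A) x0 / ?N (insert j A) x0"
        by (simp only: class_size_def sum_divide_distrib)
      also have "\<dots> = 1" using pos[OF x0(1), of "insert j A"] by simp
      finally show ?thesis using yz by simp
    qed
    have "(\<Sum>x\<in>S. of_bool (\<forall>i\<in>A. x i = y i) * (?N (insert j D) x / ?N (insert j A) x)) =
      (\<Sum>x\<in>S. \<Sum>z\<in>S. of_bool (\<forall>i\<in>A. x i = y i) * of_bool (\<forall>i\<in>insert j D. x i = z i) / ?N (insert j A) x)"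
      by (subst (1) class_size_def) (simp add: sum_distrib_left sum_divide_distrib)
    also have "\<dots> = (\<Sum>z\<in>S. \<Sum>x\<in>S. of_bool (\<forall>i\<in>A. x i = y i) * of_bool (\<forall>i\<in>insert j D. x i = z i) / ?N (insert j A) x)"
      by (rule sum.swap)
    also have "\<dots> \<le> (\<Sum>z\<in>S. of_bool (\<forall>i\<in>D. y i = z i))" by (rule sum_mono) (rule one)
    finally show ?thesis by (simp add: class_size_def)
  qed
  have "(\<Sum>x\<in>S. ?r x) = (\<Sum>x\<in>S. \<Sum>y\<in>S. of_bool (\<forall>i\<in>A. x i = y i) * (?N (insert j D) x / ?N (insert j A) x) / ?N D y)"
  proof (rule sum.cong)
    fix x assume "x \<in> S"
    have "?r x = (\<Sum>y\<in>S. of_bool (\<forall>i\<in>A. x i = y i) * (?N (insert j D) x / ?N (insert j A) x / ?N D x))"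
      by (subst (1) class_size_def) (simp add: sum_distrib_right sum_divide_distrib)
    also have "\<dots> = (\<Sum>y\<in>S. of_bool (\<forall>i\<in>A. x i = y i) * (?N (insert j D) x / ?N (insert j A) x) / ?N D y)"
    proof (rule sum.cong)
      fix y
      show "of_bool (\<forall>i\<in>A. x i = y i) * (?N (insert j D) x / ?N (insert j A) x / ?N D x) =
        of_bool (\<forall>i\<in>A. x i = y i) * (?N (insert j D) x / ?N (insert j A) x) / ?N D y"
        using class_size_cong[of D x y S] D by (cases "\<forall>i\<in>A. x i = y i") auto
    qed simp
    finally show "?r x = (\<Sum>y\<in>S. of_bool (\<forall>i\<in>A. x i = y i) * (?N (insert j D) x / ?N (insert j A) x) / ?N D y)" .
  qed simp
  also have "\<dots> = (\<Sum>y\<in>S. \<Sum>x\<in>S. of_bool (\<forall>i\<in>A. x i = y i) * (?N (insert j D) x / ?N (insert j A) x) / ?N D y)"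
    by (rule sum.swap)
  also have "\<dots> = (\<Sum>y\<in>S. (\<Sum>x\<in>S. of_bool (\<forall>i\<in>A. x i = y i) * (?N (insert j D) x / ?N (insert j A) x)) / ?N D y)"
    by (simp only: sum_divide_distrib)
  also have "\<dots> \<le> (\<Sum>y\<in>S. 1)"
    by (rule sum_mono) (use inner pos in \<open>simp add: divide_le_eq\<close>)
  finally have r: "(\<Sum>x\<in>S. ?r x) \<le> (\<Sum>x\<in>S. 1)" .
  have "(\<Sum>x\<in>S. ln (?N A x) + ln (?N (insert j D) x) - (ln (?N (insert j A) x) + ln (?N D x))) \<le> (\<Sum>x\<in>S. ?r x - 1)"
  proof (rule sum_mono)
    fix x assume x: "x \<in> S"
    note p = pos[OF x]
    have "ln (?r x) \<le> ?r x - 1" by (rule ln_le_minus_one) (use p in simp)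
    moreover have "ln (?r x) = ln (?N A x) + ln (?N (insert j D) x) - (ln (?N (insert j A) x) + ln (?N D x))"
      using p by (simp add: ln_div ln_mult less_imp_neq[symmetric])
    ultimately show "ln (?N A x) + ln (?N (insert j D) x) - (ln (?N (insert j A) x) + ln (?N D x)) \<le> ?r x - 1" by simp
  qed
  also have "\<dots> \<le> 0" using r by (simp add: sum_subtractf)
  finally show ?thesis by (simp add: sum_subtractf)
qed

text \<open>The increments \<^term>\<open>g\<close> are the conditional entropies in the chain rule for a uniformly random
  element of \<^term>\<open>S\<close>.\<close>

lemma entropy_increments:
  fixes S :: "('d::finite \<Rightarrow> 'v) set" and \<pi> :: "'d set \<Rightarrow> ('d \<Rightarrow> 'v) \<Rightarrow> 'c"
  assumes S: "finite S" "S \<noteq> {}"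
    and \<pi>: "\<And>D x y. \<pi> D x = \<pi> D y \<longleftrightarrow> (\<forall>j\<in>D. x j = y j)"
  obtains g :: "'d \<Rightarrow> real" where "\<And>j. 0 \<le> g j" "(\<Sum>j\<in>UNIV. g j) = ln (card S)"
    "\<And>D. (\<Sum>j\<in>D. g j) \<le> ln (card (\<pi> D ` S))"
proof -
  let ?N = "class_size S"
  let ?c = "real (card S)"
  have c: "?c > 0" using S by (simp add: card_gt_0_iff)
  \<comment> \<open>\<open>h D\<close> is the entropy of the marginal on \<open>D\<close>, in
    nats.\<close>
  define h where "h D = ln ?c - (\<Sum>x\<in>S. ln (?N D x)) / ?c" for D
  have pos: "?N X x > 0" if "x \<in> S" for X x
    using class_size_pos[OF S(1) that, of X] by simp
  have sub: "h (insert j A) - h A \<le> h (insert j D) - h D" if "D \<subseteq> A" for j A D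
    using class_size_submodular[OF S(1) that, of j] c
    unfolding h_def sum.distrib by (simp add: diff_divide_distrib[symmetric] add_divide_distrib[symmetric] divide_right_mono)
  have mono: "h A \<le> h (insert j A)" for j A
  proof -
    have "ln (?N (insert j A) x) \<le> ln (?N A x)" if "x \<in> S" for x
    proof -
      have "?N (insert j A) x \<le> ?N A x" unfolding class_size_def by (rule sum_mono) auto
      then show ?thesis using pos[OF that, of "insert j A"] by simp
    qed
    then have "(\<Sum>x\<in>S. ln (?N (insert j A) x)) \<le> (\<Sum>x\<in>S. ln (?N A x))" by (rule sum_mono)
    then show ?thesis unfolding h_def using c by (simp add: divide_right_mono)
  qed
  have h0: "h {} = 0" using c by (simp add: h_def class_size_def)
  have hU: "h UNIV = ln ?c"
  proof -
    have "?N UNIV x = 1" if "x \<in> S" for x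
    proof -
      have "?N UNIV x = (\<Sum>y\<in>S. if y = x then 1 else 0)"
        unfolding class_size_def by (rule sum.cong) (auto simp: fun_eq_iff of_bool_def)
      then show ?thesis using that S(1) by simp
    qed
    then show ?thesis by (simp add: h_def)
  qed
  have upper: "h D \<le> ln (card (\<pi> D ` S))" for D
  proof -
    let ?k = "real (card (\<pi> D ` S))"
    have k: "?k > 0" using S by (simp add: card_gt_0_iff)
    have Nk: "?N D x = card {y \<in> S. \<pi> D y = \<pi> D x}" for x
    proof -
      have "{y \<in> S. \<pi> D y = \<pi> D x} = S \<inter> {y. \<forall>j\<in>D. x j = y j}" by (auto simp: \<pi>)
      then show ?thesis using S(1) by (simp only: class_size_def sum_of_bool_eq)
    qed
    have "(\<Sum>x\<in>S. 1 / ?N D x) = (\<Sum>v\<in>\<pi> D ` S. \<Sum>x\<in>{x \<in> S. \<pi> D x = v}. 1 / ?N D x)"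
      by (rule sum.image_gen[OF S(1)])
    also have "\<dots> = (\<Sum>v\<in>\<pi> D ` S. 1)"
    proof (rule sum.cong)
      fix v assume "v \<in> \<pi> D ` S"
      then obtain x0 where x0: "x0 \<in> S" "v = \<pi> D x0" by blast
      have "(\<Sum>x\<in>{x \<in> S. \<pi> D x = v}. 1 / ?N D x) = (\<Sum>x\<in>{x \<in> S. \<pi> D x = v}. 1 / ?N D x0)"
        by (rule sum.cong) (auto simp: Nk x0(2))
      also have "\<dots> = 1" using pos[OF x0(1), of D] by (simp add: Nk x0(2))
      finally show "(\<Sum>x\<in>{x \<in> S. \<pi> D x = v}. 1 / ?N D x) = 1" .
    qed simp
    finally have s: "(\<Sum>x\<in>S. 1 / ?N D x) = ?k" by simp
    have "(\<Sum>x\<in>S. ln ?c - ln ?k - ln (?N D x)) \<le> (\<Sum>x\<in>S. ?c / ?k * (1 / ?N D x) - 1)"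
    proof (rule sum_mono)
      fix x assume x: "x \<in> S"
      have "ln (?c / ?k * (1 / ?N D x)) \<le> ?c / ?k * (1 / ?N D x) - 1"
        by (rule ln_le_minus_one) (use c k pos[OF x] in simp)
      moreover have "ln (?c / ?k * (1 / ?N D x)) = ln ?c - ln ?k - ln (?N D x)"
        using c k pos[OF x, of D] by (simp add: ln_div ln_mult less_imp_neq[symmetric])
      ultimately show "ln ?c - ln ?k - ln (?N D x) \<le> ?c / ?k * (1 / ?N D x) - 1" by simp
    qed
    also have "\<dots> = ?c / ?k * (\<Sum>x\<in>S. 1 / ?N D x) - (\<Sum>x\<in>S. 1)"
      by (simp only: sum_subtractf sum_distrib_left)
    also have "\<dots> = 0" unfolding s using k by simp
    finally have "?c * (ln ?c - ln ?k) \<le> (\<Sum>x\<in>S. ln (?N D x))" by (simp add: sum_subtractf sum.distrib algebra_simps)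
    then have "ln ?c - ln ?k \<le> (\<Sum>x\<in>S. ln (?N D x)) / ?c" using c by (simp add: le_divide_eq mult.commute)
    then show ?thesis by (simp add: h_def)
  qed
  \<comment> \<open>The increments belong to one order of the coordinates. For a subset
    \<open>D\<close>, submodularity bounds each of them by the increment within \<open>D\<close>, so
    that they add up to at most \<open>h D\<close>.\<close>
  have "\<exists>g. (\<forall>j. 0 \<le> g j) \<and> (\<Sum>j\<in>A. g j) = h A \<and> (\<forall>D\<subseteq>A. (\<Sum>j\<in>D. g j) \<le> h D)" if "finite A" for A
    using that
  proof (induction A rule: finite_induct)
    case empty
    show ?case by (intro exI[of _ "\<lambda>_. 0"]) (simp add: h0)
  next
    case (insert j A)
    then obtain g where g: "\<forall>j. 0 \<le> g j" "(\<Sum>j\<in>A. g j) = h A" "\<forall>D\<subseteq>A. (\<Sum>j\<in>D. g j) \<le> h D" by blast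
    let ?g = "g(j := h (insert j A) - h A)"
    have same: "(\<Sum>i\<in>D. ?g i) = (\<Sum>i\<in>D. g i)" if "j \<notin> D" for D
      using that by (intro sum.cong) auto
    have "(\<Sum>i\<in>D. ?g i) \<le> h D" if D: "D \<subseteq> insert j A" for D
    proof (cases "j \<in> D")
      case False
      then have "D \<subseteq> A" using D by blast
      then show ?thesis using g(3) same[OF False] by simp
    next
      case True
      have D': "D - {j} \<subseteq> A" "finite D" using D insert.hyps(1) finite_subset[of D "insert j A"] by auto
      have "(\<Sum>i\<in>D. ?g i) = ?g j + (\<Sum>i\<in>D - {j}. ?g i)" using True D'(2) by (rule sum.remove[rotated])
      also have "\<dots> \<le> h (insert j A) - h A + h (D - {j})"
        using same[of "D - {j}"] g(3) D' by simp
      also have "\<dots> \<le> h (insert j (D - {j}))" using sub[OF D'(1), of j] by simp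
      finally show ?thesis using True by (simp add: insert_absorb)
    qed
    moreover have "(\<Sum>i\<in>insert j A. ?g i) = h (insert j A)"
      using insert.hyps same[OF insert.hyps(2)] g(2) by simp
    moreover have "\<forall>i. 0 \<le> ?g i" using g(1) mono[of A j] by simp
    ultimately show ?case by blast
  qed
  from this[of UNIV] obtain g where g: "\<forall>j. 0 \<le> g j" "(\<Sum>j\<in>UNIV. g j) = h UNIV" "\<forall>D. (\<Sum>j\<in>D. g j) \<le> h D"
    by auto
  show thesis
  proof (rule that[of g])
    show "(\<Sum>j\<in>D. g j) \<le> ln (card (\<pi> D ` S))" for D
      using g(3) upper[of D] order_trans by blast
  qed (use g hU in auto)
qed

text \<open>Take a handicap with maximal sum among those under which no point with a positive handicap
  exceeds its target; a gap in the handicaps bounds such handicaps, since the points above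
  the gap would be too rich.\<close>

lemma balanced_handicap:
  fixes s s' :: "('p \<Rightarrow> nat) \<Rightarrow> 'p \<Rightarrow> real"
  assumes J: "finite J"
    and raise: "\<And>\<alpha> p. p \<in> J \<Longrightarrow> s' (\<alpha>(p := Suc (\<alpha> p))) p \<le> s \<alpha> p"
    and anti: "\<And>\<alpha> p q. p \<in> J \<Longrightarrow> q \<in> J \<Longrightarrow> p \<noteq> q \<Longrightarrow> s' (\<alpha>(p := Suc (\<alpha> p))) q \<le> s' \<alpha> q"
    and gap: "\<And>\<alpha> A. A \<subseteq> J \<Longrightarrow> A \<noteq> {} \<Longrightarrow> (\<And>p q. p \<in> A \<Longrightarrow> q \<in> J - A \<Longrightarrow> \<alpha> q + G \<le> \<alpha> p) \<Longrightarrow> C \<le> (\<Sum>p\<in>A. s' \<alpha> p)"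
    and \<tau>: "\<And>p. p \<in> J \<Longrightarrow> 0 \<le> \<tau> p" "(\<Sum>p\<in>J. \<tau> p) \<le> C"
  obtains \<alpha> where "\<And>p. p \<in> J \<Longrightarrow> \<tau> p \<le> s \<alpha> p"
proof -
  define Z where "Z = {\<alpha>. (\<forall>p. p \<notin> J \<longrightarrow> \<alpha> p = 0) \<and> (\<forall>p\<in>J. 0 < \<alpha> p \<longrightarrow> s' \<alpha> p < \<tau> p)}"
  have bound: "\<alpha> p \<le> card J * G" if \<alpha>: "\<alpha> \<in> Z" and p: "p \<in> J" for \<alpha> p
  proof (rule ccontr)
    assume big: "\<not> \<alpha> p \<le> card J * G"
    \<comment> \<open>The nested superlevel sets at the heights \<open>j * G\<close> cannot shrink
      strictly \<open>card J\<close> times and still contain \<open>p\<close>; so two consecutive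
      ones agree, which is a gap of size \<open>G\<close>.\<close>
    define A where "A j = {q \<in> J. j * G < \<alpha> q}" for j
    have "\<exists>j<card J. A (Suc j) = A j"
    proof (rule ccontr)
      assume ne: "\<not> (\<exists>j<card J. A (Suc j) = A j)"
      have "card (A j) + j \<le> card J" if "j \<le> card J" for j
        using that
      proof (induction j)
        case 0
        then show ?case using J by (simp add: A_def card_mono)
      next
        case (Suc j)
        have "A (Suc j) \<subset> A j"
          using ne Suc.prems by (auto simp: A_def psubset_eq)
        then have "card (A (Suc j)) < card (A j)" using J by (intro psubset_card_mono) (auto simp: A_def)
        then show ?case using Suc by simp
      qed
      from this[of "card J"] have "card (A (card J)) = 0" by simp
      moreover have "p \<in> A (card J)" "finite (A (card J))" using big p J by (auto simp: A_def)
      ultimately show False by auto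
    qed
    then obtain j where j: "j < card J" "A (Suc j) = A j" by blast
    have sub: "A j \<subseteq> J" by (auto simp: A_def)
    have "j * G \<le> card J * G" using j(1) by simp
    then have "j * G < \<alpha> p" using big by linarith
    then have ne: "A j \<noteq> {}" using p by (auto simp: A_def)
    have gp: "\<alpha> q' + G \<le> \<alpha> q" if "q \<in> A j" "q' \<in> J - A j" for q q'
    proof -
      have "q \<in> A (Suc j)" using that j by simp
      then show ?thesis using that by (auto simp: A_def)
    qed
    have "C \<le> (\<Sum>q\<in>A j. s' \<alpha> q)" by (rule gap[OF sub ne gp])
    also have "\<dots> < (\<Sum>q\<in>A j. \<tau> q)"
      by (rule sum_strict_mono) (use \<alpha> J ne in \<open>auto simp: Z_def A_def\<close>)
    also have "\<dots> \<le> (\<Sum>q\<in>J. \<tau> q)" by (rule sum_mono2) (use J sub \<tau>(1) in auto)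
    finally show False using \<tau>(2) by simp
  qed
  have Z0: "(\<lambda>_. 0) \<in> Z" by (simp add: Z_def)
  have "(\<Sum>p\<in>J. \<alpha> p) \<le> card J * (card J * G)" if "\<alpha> \<in> Z" for \<alpha>
    using sum_bounded_above[of J \<alpha> "card J * G"] bound[OF that] by simp
  then have "\<exists>\<alpha>. \<alpha> \<in> Z \<and> (\<forall>\<beta>. \<beta> \<in> Z \<longrightarrow> (\<Sum>p\<in>J. \<beta> p) \<le> (\<Sum>p\<in>J. \<alpha> p))"
    by (intro ex_has_greatest_nat[where P = "\<lambda>\<alpha>. \<alpha> \<in> Z" and k = "\<lambda>_. 0" and b = "Suc (card J * (card J * G))"] Z0)
      (simp add: less_Suc_eq_le)
  then obtain \<alpha> where \<alpha>: "\<alpha> \<in> Z" "\<And>\<beta>. \<beta> \<in> Z \<Longrightarrow> (\<Sum>p\<in>J. \<beta> p) \<le> (\<Sum>p\<in>J. \<alpha> p)"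
    by blast
  \<comment> \<open>If \<open>p\<close> missed its target under \<open>s\<close>, one more unit
    would leave it below the target under \<open>s'\<close> by \<open>raise\<close> and could only
    lower the others by \<open>anti\<close>, against the maximality of the sum.\<close>
  have "\<tau> p \<le> s \<alpha> p" if p: "p \<in> J" for p
  proof (rule ccontr)
    assume lt: "\<not> \<tau> p \<le> s \<alpha> p"
    let ?\<alpha> = "\<alpha>(p := Suc (\<alpha> p))"
    have "?\<alpha> \<in> Z" unfolding Z_def
    proof (intro CollectI conjI allI ballI impI)
      fix q assume "q \<notin> J" then show "?\<alpha> q = 0" using \<alpha>(1) p by (auto simp: Z_def)
    next
      fix q assume q: "q \<in> J" "0 < ?\<alpha> q"
      show "s' ?\<alpha> q < \<tau> q"
      proof (cases "q = p")
        case True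
        then show ?thesis using raise[OF p, of \<alpha>] lt by simp
      next
        case False
        then have "s' \<alpha> q < \<tau> q" using \<alpha>(1) q by (auto simp: Z_def)
        then show ?thesis using anti[OF p q(1), of \<alpha>] False by simp
      qed
    qed
    moreover have "(\<Sum>q\<in>J. ?\<alpha> q) = (\<Sum>q\<in>J. \<alpha> q) + 1"
      using J p by (simp add: sum.remove[of J p])
    ultimately show False using \<alpha>(2)[of ?\<alpha>] by simp
  qed
  then show thesis using that by blast
qed

text \<open>For each \<open>x\<close> the weights \<open>\<beta> x y / C\<close> form a
  subprobability on \<open>B\<close>, which is compared with the conditional law
  \<open>P x y / q x\<close> by \<open>ln u \<le> u - 1\<close>.\<close>

lemma gibbs:
  fixes P \<beta> :: "'x \<Rightarrow> 'y \<Rightarrow> real"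
  assumes P: "\<And>x y. 0 \<le> P x y" and \<beta>: "\<And>x y. 0 \<le> \<beta> x y"
    and pos: "\<And>x y. x \<in> A \<Longrightarrow> y \<in> B \<Longrightarrow> 0 < P x y \<Longrightarrow> 0 < \<beta> x y"
    and C: "0 < C" "\<And>x. x \<in> A \<Longrightarrow> (\<Sum>y\<in>B. \<beta> x y) \<le> C"
    and q: "\<And>x. x \<in> A \<Longrightarrow> q x = (\<Sum>y\<in>B. P x y)" and B: "finite B"
  shows "(\<Sum>x\<in>A. q x * ln (q x)) - (\<Sum>x\<in>A. \<Sum>y\<in>B. P x y * ln (P x y)) \<le>
    (\<Sum>x\<in>A. \<Sum>y\<in>B. P x y * (ln C - ln (\<beta> x y)))"
proof -
  have "(\<Sum>x\<in>A. \<Sum>y\<in>B. P x y * (ln (q x) - ln (P x y) - (ln C - ln (\<beta> x y)))) \<le>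
    (\<Sum>x\<in>A. \<Sum>y\<in>B. \<beta> x y * q x / C - P x y)"
  proof (intro sum_mono)
    fix x y assume xy: "x \<in> A" "y \<in> B"
    have q0: "0 \<le> q x" using q[OF xy(1)] P by (simp add: sum_nonneg)
    show "P x y * (ln (q x) - ln (P x y) - (ln C - ln (\<beta> x y))) \<le> \<beta> x y * q x / C - P x y"
    proof (cases "P x y = 0")
      case True
      then show ?thesis using q0 \<beta>[of x y] C(1) by simp
    next
      case False
      then have p: "0 < P x y" using P[of x y] by simp
      have "P x y \<le> q x" unfolding q[OF xy(1)] by (rule member_le_sum) (use xy P B in auto)
      then have qp: "0 < q x" using p by simp
      have b: "0 < \<beta> x y" using pos xy p by blast
      let ?u = "\<beta> x y * q x / (C * P x y)"
      have "ln ?u \<le> ?u - 1" by (rule ln_le_minus_one) (use p qp b C(1) in simp)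
      moreover have "ln ?u = ln (q x) - ln (P x y) - (ln C - ln (\<beta> x y))"
        using p qp b C(1) by (simp add: ln_div ln_mult less_imp_neq[symmetric])
      ultimately have "P x y * (ln (q x) - ln (P x y) - (ln C - ln (\<beta> x y))) \<le> P x y * (?u - 1)"
        using p by (simp add: mult_left_mono)
      also have "\<dots> = \<beta> x y * q x / C - P x y" using p C(1) by (simp add: field_simps)
      finally show ?thesis .
    qed
  qed
  also have "\<dots> = (\<Sum>x\<in>A. q x / C * (\<Sum>y\<in>B. \<beta> x y) - q x)"
  proof (rule sum.cong)
    fix x assume x: "x \<in> A"
    have "(\<Sum>y\<in>B. \<beta> x y * q x / C - P x y) = (\<Sum>y\<in>B. q x / C * \<beta> x y) - (\<Sum>y\<in>B. P x y)"
      by (simp add: sum_subtractf mult.commute)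
    then show "(\<Sum>y\<in>B. \<beta> x y * q x / C - P x y) = q x / C * (\<Sum>y\<in>B. \<beta> x y) - q x"
      by (simp only: q[OF x, symmetric] sum_distrib_left[symmetric])
  qed simp
  also have "\<dots> \<le> (\<Sum>x\<in>A. 0)"
  proof (rule sum_mono)
    fix x assume x: "x \<in> A"
    have "0 \<le> q x" using q[OF x] P by (simp add: sum_nonneg)
    then have "q x / C * (\<Sum>y\<in>B. \<beta> x y) \<le> q x / C * C" using C x by (intro mult_left_mono) auto
    then show "q x / C * (\<Sum>y\<in>B. \<beta> x y) - q x \<le> 0" using C(1) by simp
  qed
  finally have "(\<Sum>x\<in>A. \<Sum>y\<in>B. P x y * ln (q x)) - (\<Sum>x\<in>A. \<Sum>y\<in>B. P x y * ln (P x y)) \<le>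
    (\<Sum>x\<in>A. \<Sum>y\<in>B. P x y * (ln C - ln (\<beta> x y)))"
    by (simp add: right_diff_distrib sum_subtractf)
  moreover have "(\<Sum>x\<in>A. \<Sum>y\<in>B. P x y * ln (q x)) = (\<Sum>x\<in>A. q x * ln (q x))"
    by (rule sum.cong) (auto simp: q sum_distrib_right)
  ultimately show ?thesis by simp
qed

text \<open>The fixed shift \<open>K\<close> stands for the loss of degree caused by the handicaps
  and disappears in the limit.\<close>

lemma ln_binomial_asymp:
  "(\<lambda>n. ln (real ((n + K + k) choose k)) - real k * ln (real n)) \<longlonglongrightarrow> - ln (fact k)"
proof -
  have "(\<lambda>n. (\<Prod>i<k. (real n + real K + 1 + real i) / real n) / fact k) \<longlonglongrightarrow> (\<Prod>i<k. 1) / fact k"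
  proof (intro tendsto_divide tendsto_prod tendsto_const)
    fix i
    have "(\<lambda>n. (real K + 1 + real i) / real n) \<longlonglongrightarrow> 0"
      by (intro tendsto_divide_0[OF tendsto_const] filterlim_at_top_imp_at_infinity
          filterlim_real_sequentially)
    then have "(\<lambda>n. 1 + (real K + 1 + real i) / real n) \<longlonglongrightarrow> 1"
      using tendsto_add[OF tendsto_const[of 1]] by fastforce
    moreover have "eventually (\<lambda>n. 1 + (real K + 1 + real i) / real n =
        (real n + real K + 1 + real i) / real n) sequentially"
      using eventually_gt_at_top[of 0] by eventually_elim (simp add: field_simps)
    ultimately show "(\<lambda>n. (real n + real K + 1 + real i) / real n) \<longlonglongrightarrow> 1"
      by (rule Lim_transform_eventually)
  qed simp
  then have "(\<lambda>n. ln ((\<Prod>i<k. (real n + real K + 1 + real i) / real n) / fact k)) \<longlonglongrightarrow> ln (1 / fact k)"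
    by (intro tendsto_ln) auto
  moreover have "eventually (\<lambda>n. ln ((\<Prod>i<k. (real n + real K + 1 + real i) / real n) / fact k) =
      ln (real ((n + K + k) choose k)) - real k * ln (real n)) sequentially"
    using eventually_gt_at_top[of 0]
  proof eventually_elim
    case (elim n)
    have "real ((n + K + k) choose k) = (\<Prod>i<k. real n + real K + 1 + real i) / fact k"
      by (simp add: binomial_gbinomial gbinomial_pochhammer' pochhammer_prod atLeast0LessThan add_ac)
    then have "(\<Prod>i<k. (real n + real K + 1 + real i) / real n) / fact k = real ((n + K + k) choose k) / real n ^ k"
      by (simp add: prod_dividef)
    moreover have "0 < real ((n + K + k) choose k)" by simp
    ultimately show ?case using elim by (simp add: ln_div ln_realpow)
  qed
  ultimately have "(\<lambda>n. ln (real ((n + K + k) choose k)) - real k * ln (real n)) \<longlonglongrightarrow> ln (1 / fact k)"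
    by (rule Lim_transform_eventually)
  then show ?thesis by (simp add: ln_div)
qed

section \<open>Joints\<close>

lemma coordinate_flat:
  assumes "invertible_affine A" "A 0 = p"
  obtains M :: "'a::field ^ 'd::finite ^ 'd" where "invertible M"
    "\<And>e. A ` vec.span {axis j 1 |j. j \<notin> e} = range (\<lambda>v. p + (M ** proj_off e) *v v)"
proof -
  obtain L q where L: "Vector_Spaces.linear (*s) (*s) L" "A = (\<lambda>x. L x + q)" and bij: "bij A"
    using assms(1) by (auto simp: invertible_affine_def)
  define N where "N = matrix L"
  have LM: "L x = N *v x" for x using matrix_works[OF L(1)] by (simp add: N_def)
  have q: "q = p" using assms(2) unfolding L(2) LM by simp
  have A: "A x = p + N *v x" for x by (simp add: L(2) LM q add.commute)
  have inj: "inj ((*v) (N))"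
  proof (rule injI)
    fix x y assume "N *v x = N *v y"
    then have "A x = A y" by (simp add: A)
    then show "x = y" using bij by (simp add: bij_def inj_eq)
  qed
  show thesis
  proof (rule that[of N])
    show "invertible N"
      unfolding invertible_left_inverse matrix_left_invertible_injective using inj by (simp add: inj_def)
    fix e :: "'d set"
    have "vec.span {axis j 1 |j. j \<notin> e} = range (\<lambda>v :: 'a ^ 'd. proj_off e *v v)"
    proof
      have "vec.subspace (range (\<lambda>v :: 'a ^ 'd. proj_off e *v v))"
        unfolding vec.subspace_def
      proof (intro conjI ballI allI)
        show "0 \<in> range (\<lambda>v :: 'a ^ 'd. proj_off e *v v)" by (rule image_eqI[of _ _ 0]) simp_all
        fix x y c assume x: "x \<in> range (\<lambda>v :: 'a ^ 'd. proj_off e *v v)"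
        then obtain u where u: "x = proj_off e *v u" by blast
        show "c *s x \<in> range (\<lambda>v :: 'a ^ 'd. proj_off e *v v)"
          by (rule image_eqI[of _ _ "c *s u"]) (simp_all add: u vector_scalar_commute)
        assume "y \<in> range (\<lambda>v :: 'a ^ 'd. proj_off e *v v)"
        then obtain v where v: "y = proj_off e *v v" by blast
        show "x + y \<in> range (\<lambda>v :: 'a ^ 'd. proj_off e *v v)"
          by (rule image_eqI[of _ _ "u + v"]) (simp_all add: u v matrix_vector_right_distrib)
      qed
      moreover have "axis j 1 = proj_off e *v (axis j 1 :: 'a ^ 'd)" if "j \<notin> e" for j
        using that by (auto simp: vec_eq_iff proj_off_vec axis_def)
      ultimately show "vec.span {axis j 1 |j. j \<notin> e} \<subseteq> range (\<lambda>v :: 'a ^ 'd. proj_off e *v v)"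
        by (intro vec.span_minimal) blast+
      show "range (\<lambda>v :: 'a ^ 'd. proj_off e *v v) \<subseteq> vec.span {axis j 1 |j. j \<notin> e}"
      proof
        fix x assume "x \<in> range (\<lambda>v :: 'a ^ 'd. proj_off e *v v)"
        then obtain v where v: "x = proj_off e *v v" by blast
        have "x = (\<Sum>j\<in>- e. v $ j *s axis j 1)"
          by (auto simp: vec_eq_iff v proj_off_vec axis_def if_distrib sum.delta cong: if_cong)
        also have "\<dots> \<in> vec.span {axis j 1 |j. j \<notin> e}"
          by (intro vec.span_sum vec.span_scale vec.span_base) auto
        finally show "x \<in> vec.span {axis j 1 |j. j \<notin> e}" .
      qed
    qed
    then show "A ` vec.span {axis j 1 |j. j \<notin> e} = range (\<lambda>v. p + (N ** proj_off e) *v v)"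
      by (simp add: A image_image matrix_vector_mul_assoc)
  qed
qed

text \<open>One matrix serves all edges at once, and the copy numbers of the flats are gone; the
  polynomial method sees a joint only in this form.\<close>

definition joint_chart :: "'e set \<Rightarrow> ('e \<Rightarrow> 'd::finite set) \<Rightarrow> 'a::field ^ 'd \<Rightarrow> ('e \<Rightarrow> ('a ^ 'd) set) \<Rightarrow> bool" where
  "joint_chart E ends p t \<longleftrightarrow> (\<exists>M. invertible M \<and>
     (\<forall>e\<in>E. t e = range (\<lambda>v. p + (M ** proj_off (ends e)) *v v)))"

lemma joint_tuples_chart:
  assumes "T \<in> joint_tuples E ends c \<F> p"
  shows "joint_chart E ends p (\<lambda>e. fst (T e))"
proof -
  obtain A where A: "invertible_affine A" "A 0 = p"
    "\<And>e. e \<in> E \<Longrightarrow> fst (T e) = A ` vec.span {axis j 1 |j. j \<notin> ends e}"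
    using assms by (auto simp: joint_tuples_def)
  obtain M where "invertible M"
    "\<And>e. A ` vec.span {axis j 1 |j. j \<notin> e} = range (\<lambda>v. p + (M ** proj_off e) *v v)"
    using coordinate_flat[OF A(1,2)] by blast
  with A(3) show ?thesis unfolding joint_chart_def by blast
qed

lemma joint_chart_mem: "joint_chart E ends p t \<Longrightarrow> e \<in> E \<Longrightarrow> p \<in> t e"
  unfolding joint_chart_def by (auto intro!: image_eqI[of _ _ 0])

text \<open>In the chart of \<open>p\<close>, the flat of an edge that contains \<open>j\<close> has
  \<open>j\<close>-th coordinate 0, and every \<open>j\<close> lies in some edge; so the flats meet
  only in \<open>p\<close>. Hence a tuple determines its joint.\<close>

lemma joint_chart_unique:
  assumes "joint_chart E ends p t" "joint_chart E ends p' t" "(\<Union>e\<in>E. ends e) = UNIV"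
  shows "p = p'"
proof -
  obtain M where M: "invertible M" "\<And>e. e \<in> E \<Longrightarrow> t e = range (\<lambda>v. p + (M ** proj_off (ends e)) *v v)"
    using assms(1) by (auto simp: joint_chart_def)
  obtain M' where M': "M' ** M = mat 1" using M(1) by (auto simp: invertible_def)
  have "(M' *v (p' - p)) $ j = 0" for j
  proof -
    obtain e where e: "e \<in> E" "j \<in> ends e" using assms(3) by blast
    have "p' \<in> t e" using joint_chart_mem[OF assms(2) e(1)] .
    then obtain v where "p' = p + (M ** proj_off (ends e)) *v v" using M(2)[OF e(1)] by auto
    then have "M' *v (p' - p) = (M' ** M) *v (proj_off (ends e) *v v)"
      by (simp add: matrix_vector_mul_assoc matrix_mul_assoc)
    then show ?thesis using e(2) by (simp add: M' proj_off_vec)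
  qed
  then have "M' *v (p' - p) = 0" by (simp add: vec_eq_iff)
  then have "M *v (M' *v (p' - p)) = 0" by simp
  moreover have "M ** M' = mat 1" using M' matrix_left_right_inverse by blast
  ultimately show ?thesis by (simp add: matrix_vector_mul_assoc)
qed

locale weighted_cover =
  fixes E :: "'e set" and ends :: "'e \<Rightarrow> 'd::finite set" and w :: "'e \<Rightarrow> real"
  assumes fin: "finite E" and w_nonneg: "\<And>e. e \<in> E \<Longrightarrow> 0 \<le> w e"
    and w_covers: "covers E ends w" and proper: "\<And>e. e \<in> E \<Longrightarrow> ends e \<noteq> UNIV"
begin

definition W :: real where "W = (\<Sum>e\<in>E. w e) - 1"

definition cov :: "'d \<Rightarrow> real" where "cov j = (\<Sum>e\<in>{e\<in>E. j \<in> ends e}. w e)"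

definition excess :: real where "excess = (\<Sum>j\<in>UNIV. cov j - 1)"

lemma cov_ge_1: "1 \<le> cov j"
  using w_covers by (simp add: covers_def cov_def)

lemma excess_nonneg: "0 \<le> excess"
  unfolding excess_def using cov_ge_1 by (simp add: sum_nonneg)

lemma Union_ends: "(\<Union>e\<in>E. ends e) = UNIV"
proof -
  have "\<exists>e\<in>E. j \<in> ends e" for j
  proof (rule ccontr)
    assume "\<not> (\<exists>e\<in>E. j \<in> ends e)"
    then have e: "{e\<in>E. j \<in> ends e} = {}" by blast
    show False using cov_ge_1[of j] unfolding cov_def e by simp
  qed
  then show ?thesis by blast
qed

text \<open>Double counting: the edges that miss \<open>j\<close> have total weight
  \<open>W + 1 - cov j\<close>.\<close>

lemma sum_swap: "(\<Sum>e\<in>E. w e * (\<Sum>j\<in>- ends e. g j)) = (\<Sum>j\<in>UNIV. (W + 1 - cov j) * g j)"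
proof -
  have "(\<Sum>e\<in>E. w e * (\<Sum>j\<in>- ends e. g j)) = (\<Sum>e\<in>E. \<Sum>j\<in>UNIV. if j \<in> ends e then 0 else w e * g j)"
    by (rule sum.cong) (auto simp: sum_distrib_left sum.If_cases Compl_eq)
  also have "\<dots> = (\<Sum>j\<in>UNIV. \<Sum>e\<in>E. if j \<in> ends e then 0 else w e * g j)" by (rule sum.swap)
  also have "\<dots> = (\<Sum>j\<in>UNIV. (W + 1 - cov j) * g j)"
  proof (rule sum.cong)
    fix j
    have "(\<Sum>e\<in>E. w e) = cov j + (\<Sum>e\<in>{e\<in>E. j \<notin> ends e}. w e)"
    proof -
      have "E = {e\<in>E. j \<in> ends e} \<union> {e\<in>E. j \<notin> ends e}" by blast
      then show ?thesis unfolding cov_def using fin by (metis (no_types, lifting) sum.union_disjoint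
            finite_Un disjoint_iff mem_Collect_eq)
    qed
    moreover have "(\<Sum>e\<in>E. if j \<in> ends e then 0 else w e * g j) = (\<Sum>e\<in>{e\<in>E. j \<notin> ends e}. w e) * g j"
      by (simp add: sum.If_cases fin sum_distrib_right Collect_neg_eq[symmetric] Int_def)
    ultimately show "(\<Sum>e\<in>E. if j \<in> ends e then 0 else w e * g j) = (W + 1 - cov j) * g j"
      by (simp add: W_def)
  qed simp
  finally show ?thesis .
qed

text \<open>An edge of positive weight misses some vertex, and the edges at that vertex add weight
  at least 1. Positivity permits the division by \<open>W\<close> in the choice of the
  handicaps.\<close>

lemma W_pos: "0 < W"
proof -
  obtain e0 where e0: "e0 \<in> E" "0 < w e0"
  proof -
    have "\<exists>e\<in>E. 0 < w e"
    proof (rule ccontr)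
      assume "\<not> (\<exists>e\<in>E. 0 < w e)"
      then have "w e \<le> 0" if "e \<in> E" for e using that by force
      then have "cov undefined \<le> 0" unfolding cov_def by (intro sum_nonpos) auto
      then show False using cov_ge_1[of undefined] by simp
    qed
    then show thesis using that by blast
  qed
  obtain j where j: "j \<notin> ends e0" using proper[OF e0(1)] by blast
  have "w e0 \<le> (\<Sum>e\<in>{e\<in>E. j \<notin> ends e}. w e)"
    by (rule member_le_sum) (use e0 j fin w_nonneg in auto)
  moreover have "(\<Sum>e\<in>E. w e) = cov j + (\<Sum>e\<in>{e\<in>E. j \<notin> ends e}. w e)"
  proof -
    have "E = {e\<in>E. j \<in> ends e} \<union> {e\<in>E. j \<notin> ends e}" by blast
    then show ?thesis unfolding cov_def using fin by (metis (no_types, lifting) sum.union_disjoint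
          finite_Un disjoint_iff mem_Collect_eq)
  qed
  ultimately show ?thesis using cov_ge_1[of j] e0(2) by (simp add: W_def)
qed

text \<open>In the weighted sum over the flats the increment of coordinate \<open>j\<close> occurs
  with factor \<open>W + 1 - cov j\<close>, short of \<open>W\<close> by \<open>cov j - 1\<close>.
  The missing part is paid by \<open>ln (n + 1)\<close>, since an exponent takes at most
  \<open>n + 1\<close> values.\<close>

lemma shearer_contribution:
  assumes t: "joint_chart E ends p t" and p: "p \<in> J" and pos: "0 < contribution idx n J UNIV \<alpha> p"
  shows "e \<in> E \<Longrightarrow> 0 < contribution idx n J (t e) \<alpha> p"
    and "W * ln (contribution idx n J UNIV \<alpha> p) \<le>
      (\<Sum>e\<in>E. w e * ln (contribution idx n J (t e) \<alpha> p)) + excess * ln (real n + 1)"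
proof -
  obtain M where M: "invertible M" "\<And>e. e \<in> E \<Longrightarrow> t e = range (\<lambda>v. p + (M ** proj_off (ends e)) *v v)"
    using t by (auto simp: joint_chart_def)
  let ?S = "lead_set (Suc n) idx n J UNIV \<alpha> p M"
  let ?Se = "\<lambda>e. lead_set (Suc n) idx n J (t e) \<alpha> p (M ** proj_off (ends e))"
  obtain M' where M': "M ** M' = mat 1" using M(1) by (auto simp: invertible_def)
  have "x \<in> range (\<lambda>v. p + M *v v)" for x
    by (rule image_eqI[of _ _ "M' *v (x - p)"]) (simp_all add: matrix_vector_mul_assoc M')
  then have U: "UNIV = range (\<lambda>v. p + M *v v)" by blast
  have bU: "contribution idx n J UNIV \<alpha> p = card ?S"
    by (rule contribution_eq_card[OF U p]) simp_all
  have be: "contribution idx n J (t e) \<alpha> p = card (?Se e)" if e: "e \<in> E" for e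
    by (rule contribution_eq_card[OF M(2)[OF e] p joint_chart_mem[OF t e]]) simp
  have S: "finite ?S" "?S \<noteq> {}" using finite_lead_set pos unfolding bU by auto
  have proj: "restr (ends e) ` ?S \<subseteq> ?Se e" if e: "e \<in> E" for e
    using lead_set_proj[OF M(1) p, of _ "Suc n" idx n \<alpha> "ends e"] unfolding M(2)[OF e] by blast
  show "0 < contribution idx n J (t e) \<alpha> p" if e: "e \<in> E" for e
    using proj[OF e] S(2) finite_lead_set unfolding be[OF e] card_gt_0_iff by blast
  have restr_eq: "restr (- D) x = restr (- D) y \<longleftrightarrow> (\<forall>j\<in>D. x j = y j)" for D and x y :: "'d \<Rightarrow> nat"
    by (auto simp: restr_def fun_eq_iff)
  obtain g where g: "\<And>j. 0 \<le> g j" "(\<Sum>j\<in>UNIV. g j) = ln (card ?S)"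
    "\<And>D. (\<Sum>j\<in>D. g j) \<le> ln (card ((\<lambda>\<gamma>. restr (- D) \<gamma>) ` ?S))"
    using entropy_increments[OF S, of "\<lambda>D. restr (- D)", OF restr_eq] by blast
  have ge: "(\<Sum>j\<in>- ends e. g j) \<le> ln (contribution idx n J (t e) \<alpha> p)" if e: "e \<in> E" for e
  proof -
    have "card (restr (ends e) ` ?S) \<le> card (?Se e)" by (rule card_mono[OF finite_lead_set proj[OF e]])
    moreover have "0 < card (restr (ends e) ` ?S)" using S by (simp add: card_gt_0_iff)
    ultimately have "ln (card (restr (ends e) ` ?S)) \<le> ln (card (?Se e))" by simp
    then show ?thesis using g(3)[of "- ends e"] by (simp add: be[OF e])
  qed
  have gj: "g j \<le> ln (real n + 1)" for j
  proof -
    have "restr (- {j}) ` ?S \<subseteq> (\<lambda>v i. if i = j then v else 0) ` {..n}"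
    proof
      fix \<gamma> assume "\<gamma> \<in> restr (- {j}) ` ?S"
      then obtain \<delta> where \<delta>: "\<delta> \<in> ?S" "\<gamma> = restr (- {j}) \<delta>" by blast
      have "\<delta> j \<le> n" using lead_set_degree \<delta>(1) le_total_degree[of \<delta> j] by fastforce
      then show "\<gamma> \<in> (\<lambda>v i. if i = j then v else 0) ` {..n}"
        by (intro image_eqI[of _ _ "\<delta> j"]) (auto simp: \<delta>(2) restr_def)
    qed
    then have "card (restr (- {j}) ` ?S) \<le> card {..n}" by (rule surj_card_le[rotated]) simp
    moreover have "0 < card (restr (- {j}) ` ?S)" using S by (simp add: card_gt_0_iff)
    ultimately have "ln (real (card (restr (- {j}) ` ?S))) \<le> ln (real n + 1)" by simp
    then show ?thesis using g(3)[of "{j}"] by simp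
  qed
  have "W * ln (contribution idx n J UNIV \<alpha> p) = (\<Sum>j\<in>UNIV. (W + 1 - cov j) * g j + (cov j - 1) * g j)"
    unfolding bU g(2)[symmetric] sum_distrib_left by (rule sum.cong) (auto simp: algebra_simps)
  also have "\<dots> = (\<Sum>e\<in>E. w e * (\<Sum>j\<in>- ends e. g j)) + (\<Sum>j\<in>UNIV. (cov j - 1) * g j)"
    by (simp add: sum.distrib sum_swap)
  also have "\<dots> \<le> (\<Sum>e\<in>E. w e * ln (contribution idx n J (t e) \<alpha> p)) + (\<Sum>j\<in>UNIV. (cov j - 1) * ln (real n + 1))"
    by (intro add_mono sum_mono mult_left_mono ge gj w_nonneg) (use cov_ge_1 in auto)
  also have "(\<Sum>j\<in>UNIV. (cov j - 1) * ln (real n + 1)) = excess * ln (real n + 1)"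
    unfolding excess_def by (simp add: sum_distrib_right)
  finally show "W * ln (contribution idx n J UNIV \<alpha> p) \<le>
      (\<Sum>e\<in>E. w e * ln (contribution idx n J (t e) \<alpha> p)) + excess * ln (real n + 1)" .
qed

lemma exists_handicap:
  fixes J :: "('a::field ^ 'd) set" and \<mu> :: "'a ^ 'd \<Rightarrow> real" and Ts :: "'a ^ 'd \<Rightarrow> ('e \<Rightarrow> ('a ^ 'd) set) set"
  assumes J: "finite J" and idx: "inj_on idx J"
    and \<mu>: "\<And>p. p \<in> J \<Longrightarrow> 0 < \<mu> p" "(\<Sum>p\<in>J. \<mu> p) \<le> 1"
    and Ts: "\<And>p. p \<in> J \<Longrightarrow> finite (Ts p)" "\<And>p. p \<in> J \<Longrightarrow> Ts p \<noteq> {}"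
      "\<And>p t. p \<in> J \<Longrightarrow> t \<in> Ts p \<Longrightarrow> joint_chart E ends p t"
  obtains \<alpha> where
    "\<And>p t e. p \<in> J \<Longrightarrow> t \<in> Ts p \<Longrightarrow> e \<in> E \<Longrightarrow> 0 < contribution idx (n + card J) J (t e) \<alpha> p"
    "\<And>p t. p \<in> J \<Longrightarrow> t \<in> Ts p \<Longrightarrow> W * (ln (\<mu> p) + ln ((n + CARD('d)) choose CARD('d))) \<le>
       (\<Sum>e\<in>E. w e * ln (contribution idx (n + card J) J (t e) \<alpha> p)) + excess * ln (real (n + card J) + 1)"
proof -
  let ?C = "real ((n + CARD('d)) choose CARD('d))" and ?n = "n + card J"
  \<comment> \<open>\<open>val\<close> is the \<open>W\<close>-th root of the right-hand side of
    Shearer's inequality at degree \<open>m\<close>. The value 0 for a vanishing contribution keeps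
    the default value of \<open>ln 0\<close> out.\<close>
  define val where "val m \<alpha> p t = (if \<forall>e\<in>E. 0 < contribution idx m J (t e) \<alpha> p
    then exp (((\<Sum>e\<in>E. w e * ln (contribution idx m J (t e) \<alpha> p)) + excess * ln (real m + 1)) / W) else 0)"
    for m \<alpha> p and t :: "'e \<Rightarrow> ('a ^ 'd) set"
  \<comment> \<open>The minimum makes one choice of handicaps serve every tuple in
    \<open>Ts p\<close>.\<close>
  define s where "s m \<alpha> p = Min (val m \<alpha> p ` Ts p)" for m \<alpha> p
  have val_mono: "val m \<alpha> p t \<le> val m' \<alpha>' p t"
    if le: "m \<le> m'" "\<And>e. e \<in> E \<Longrightarrow> contribution idx m J (t e) \<alpha> p \<le> contribution idx m' J (t e) \<alpha>' p" for m m' \<alpha> \<alpha>' p t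
  proof (cases "\<forall>e\<in>E. 0 < contribution idx m J (t e) \<alpha> p")
    case True
    then have pos': "\<forall>e\<in>E. 0 < contribution idx m' J (t e) \<alpha>' p" using le(2) by (meson less_le_trans)
    have "((\<Sum>e\<in>E. w e * ln (contribution idx m J (t e) \<alpha> p)) + excess * ln (real m + 1)) / W \<le>
      ((\<Sum>e\<in>E. w e * ln (contribution idx m' J (t e) \<alpha>' p)) + excess * ln (real m' + 1)) / W"
    proof (intro divide_right_mono add_mono sum_mono mult_left_mono)
      fix e assume e: "e \<in> E"
      show "ln (contribution idx m J (t e) \<alpha> p) \<le> ln (contribution idx m' J (t e) \<alpha>' p)"
        using le(2)[OF e] bspec[OF True e] by (intro ln_mono) simp_all
    qed (use le(1) W_pos excess_nonneg w_nonneg in auto)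
    then show ?thesis using True pos' by (simp add: val_def)
  qed (auto simp: val_def)
  have s_mono: "s m \<alpha> p \<le> s m' \<alpha>' p"
    if p: "p \<in> J" and le: "\<And>t. t \<in> Ts p \<Longrightarrow> val m \<alpha> p t \<le> val m' \<alpha>' p t" for m m' \<alpha> \<alpha>' p
  proof -
    obtain t where t: "t \<in> Ts p" "s m' \<alpha>' p = val m' \<alpha>' p t"
    proof -
      have "Min (val m' \<alpha>' p ` Ts p) \<in> val m' \<alpha>' p ` Ts p"
        by (rule Min_in) (use Ts(1,2)[OF p] in auto)
      then show thesis using that by (auto simp: s_def)
    qed
    have "s m \<alpha> p \<le> val m \<alpha> p t" unfolding s_def using Ts(1)[OF p] t(1) by (intro Min_le) auto
    then show ?thesis using le[OF t(1)] t(2) by simp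
  qed
  have chart1: "\<exists>B0 :: 'a ^ 'd ^ 'd. t e = range (\<lambda>v. p + B0 *v v)" if "p \<in> J" "t \<in> Ts p" "e \<in> E" for p t e
    using Ts(3)[OF that(1,2)] that(3) unfolding joint_chart_def by blast
  have chart2: "p \<in> t e" if "p \<in> J" "t \<in> Ts p" "e \<in> E" for p t e
    by (rule joint_chart_mem[OF Ts(3)[OF that(1,2)] that(3)])
  have raise: "s n (\<alpha>(p := Suc (\<alpha> p))) p \<le> s ?n \<alpha> p" if p: "p \<in> J" for \<alpha> p
  proof (rule s_mono[OF p], rule val_mono)
    fix t e assume te: "t \<in> Ts p" "e \<in> E"
    obtain B0 :: "'a ^ 'd ^ 'd" where "t e = range (\<lambda>v. p + B0 *v v)" using chart1[OF p te] by blast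
    then show "contribution idx n J (t e) (\<alpha>(p := Suc (\<alpha> p))) p \<le> contribution idx ?n J (t e) \<alpha> p"
      using contribution_raise[OF _ p chart2[OF p te] J] by blast
  qed simp
  have anti: "s n (\<alpha>(p := Suc (\<alpha> p))) q \<le> s n \<alpha> q" if pq: "p \<in> J" "q \<in> J" "p \<noteq> q" for \<alpha> p q
  proof (rule s_mono[OF pq(2)], rule val_mono)
    fix t e assume te: "t \<in> Ts q" "e \<in> E"
    obtain B0 :: "'a ^ 'd ^ 'd" where "t e = range (\<lambda>v. q + B0 *v v)" using chart1[OF pq(2) te] by blast
    then show "contribution idx n J (t e) (\<alpha>(p := Suc (\<alpha> p))) q \<le> contribution idx n J (t e) \<alpha> q"
      by (rule contribution_antimono[OF _ pq(2) chart2[OF pq(2) te]]) (use pq(3) in auto)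
  qed simp
  have gap: "?C \<le> (\<Sum>p\<in>A. s n \<alpha> p)"
    if A: "A \<subseteq> J" "A \<noteq> {}" "\<And>p q. p \<in> A \<Longrightarrow> q \<in> J - A \<Longrightarrow> \<alpha> q + (n + 1) \<le> \<alpha> p" for \<alpha> A
  proof -
    have "real (\<Sum>p\<in>A. contribution idx n J UNIV \<alpha> p) = ?C"
      using contribution_sum_UNIV[OF J idx A(1,2), where \<alpha> = \<alpha> and n = n] A(3) by (simp add: add.assoc)
    moreover have "real (contribution idx n J UNIV \<alpha> p) \<le> s n \<alpha> p" if "p \<in> A" for p
    proof -
      have p: "p \<in> J" using that A(1) by blast
      have "real (contribution idx n J UNIV \<alpha> p) \<le> val n \<alpha> p t" if t: "t \<in> Ts p" for t
      proof (cases "contribution idx n J UNIV \<alpha> p = 0")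
        case False
        then have pos: "0 < contribution idx n J UNIV \<alpha> p" by simp
        note sh = shearer_contribution[OF Ts(3)[OF p t] p pos]
        have "ln (contribution idx n J UNIV \<alpha> p) \<le>
          ((\<Sum>e\<in>E. w e * ln (contribution idx n J (t e) \<alpha> p)) + excess * ln (real n + 1)) / W"
          using sh(2) W_pos by (simp add: le_divide_eq mult.commute)
        then have "exp (ln (contribution idx n J UNIV \<alpha> p)) \<le>
          exp (((\<Sum>e\<in>E. w e * ln (contribution idx n J (t e) \<alpha> p)) + excess * ln (real n + 1)) / W)" by simp
        then show ?thesis using sh(1) pos by (simp add: val_def)
      qed (simp add: val_def)
      then show ?thesis unfolding s_def using Ts(1,2)[OF p] by (subst Min_ge_iff) auto
    qed
    ultimately show ?thesis by (metis (no_types, lifting) of_nat_sum sum_mono)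
  qed
  obtain \<alpha> where \<alpha>: "\<And>p. p \<in> J \<Longrightarrow> \<mu> p * ?C \<le> s ?n \<alpha> p"
  \<comment> \<open>The targets divide the dimension \<open>?C\<close> of the whole space in
    proportion to \<open>\<mu>\<close>; \<open>G = n + 1\<close> is the gap of
    \<open>contribution_sum_UNIV\<close>.\<close>
  proof (rule balanced_handicap[OF J, where s = "s ?n" and s' = "s n" and G = "n + 1" and C = ?C and \<tau> = "\<lambda>p. \<mu> p * ?C"])
    show "(\<Sum>p\<in>J. \<mu> p * ?C) \<le> ?C"
      unfolding sum_distrib_right[symmetric] using \<mu>(2) by (intro mult_left_le_one_le) (auto intro: sum_nonneg less_imp_le \<mu>(1))
    show "0 \<le> \<mu> p * ?C" if "p \<in> J" for p using \<mu>(1)[OF that] by simp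
  qed (use raise anti gap in auto)
  show thesis
  proof (rule that[of \<alpha>])
    fix p t assume pt: "p \<in> J" "t \<in> Ts p"
    have "0 < \<mu> p * ?C" using \<mu>(1)[OF pt(1)] by simp
    moreover have "s ?n \<alpha> p \<le> val ?n \<alpha> p t"
      unfolding s_def using Ts(1)[OF pt(1)] pt(2) by (intro Min_le) auto
    ultimately have v: "0 < val ?n \<alpha> p t" "\<mu> p * ?C \<le> val ?n \<alpha> p t"
      using \<alpha>[OF pt(1)] by linarith+
    \<comment> \<open>A positive target rules out the default 0 of \<open>val\<close>.\<close>
    then have all: "\<forall>e\<in>E. 0 < contribution idx ?n J (t e) \<alpha> p" by (auto simp: val_def split: if_splits)
    then show "0 < contribution idx ?n J (t e) \<alpha> p" if "e \<in> E" for e using that by blast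
    have "ln (\<mu> p) + ln ?C = ln (\<mu> p * ?C)" using \<mu>(1)[OF pt(1)] by (simp add: ln_mult)
    also have "\<dots> \<le> ln (val ?n \<alpha> p t)" using v \<open>0 < \<mu> p * ?C\<close> by simp
    also have "\<dots> = ((\<Sum>e\<in>E. w e * ln (contribution idx ?n J (t e) \<alpha> p)) + excess * ln (real ?n + 1)) / W"
      using all by (simp add: val_def)
    finally show "W * (ln (\<mu> p) + ln ?C) \<le>
       (\<Sum>e\<in>E. w e * ln (contribution idx ?n J (t e) \<alpha> p)) + excess * ln (real ?n + 1)"
      using W_pos by (simp add: le_divide_eq mult.commute)
  qed
qed

end

section \<open>Entropies of simple random variables\<close>

context prob_space
begin

definition pr :: "('a \<Rightarrow> 'b) \<Rightarrow> 'b \<Rightarrow> real" where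
  "pr Z z = prob (Z -` {z} \<inter> space M)"

lemma pr_nonneg: "0 \<le> pr Z z"
  by (simp add: pr_def)

lemma simple_function_event: "simple_function M Z \<Longrightarrow> Z -` {z} \<inter> space M \<in> events"
  by (cases "z \<in> Z ` space M") (auto simp: simple_function_def dest: sym intro: subst[of "{}"])

lemma pr_sum_expectation:
  assumes Z: "simple_function M Z" and Q: "finite Q" "Z ` space M \<subseteq> Q"
  shows "(\<Sum>z\<in>Q. pr Z z * g z) = expectation (\<lambda>\<omega>. g (Z \<omega>))"
proof -
  have "expectation (\<lambda>\<omega>. g (Z \<omega>)) = expectation (\<lambda>\<omega>. \<Sum>z\<in>Q. g z * indicator (Z -` {z} \<inter> space M) \<omega>)"
  proof (rule Bochner_Integration.integral_cong)
    fix \<omega> assume \<omega>: "\<omega> \<in> space M"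
    have "(\<Sum>z\<in>Q. g z * indicator (Z -` {z} \<inter> space M) \<omega>) = (\<Sum>z\<in>Q. if z = Z \<omega> then g z else 0)"
      using \<omega> by (intro sum.cong) (auto simp: indicator_def)
    then show "g (Z \<omega>) = (\<Sum>z\<in>Q. g z * indicator (Z -` {z} \<inter> space M) \<omega>)"
      using Q \<omega> by auto
  qed simp
  also have "\<dots> = (\<Sum>z\<in>Q. g z * prob (Z -` {z} \<inter> space M))"
    using simple_function_event[OF Z] by (subst Bochner_Integration.integral_sum) (auto simp: less_top[symmetric])
  finally show ?thesis by (simp add: pr_def mult.commute)
qed

lemma pr_sum_1:
  "simple_function M Z \<Longrightarrow> finite Q \<Longrightarrow> Z ` space M \<subseteq> Q \<Longrightarrow> (\<Sum>z\<in>Q. pr Z z) = 1"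
  using pr_sum_expectation[of Z Q "\<lambda>_. 1"] by (simp add: prob_space)

lemma pr_outside: "z \<notin> Z ` space M \<Longrightarrow> pr Z z = 0"
proof -
  assume "z \<notin> Z ` space M"
  then have "Z -` {z} \<inter> space M = {}" by auto
  then show ?thesis by (simp add: pr_def)
qed

lemma pr_pos_witness: "0 < pr Z z \<Longrightarrow> \<exists>\<omega>\<in>space M. Z \<omega> = z"
  using pr_outside[of z Z] by (cases "z \<in> Z ` space M") auto

lemma pr_marginal:
  assumes X: "simple_function M X" and Y: "simple_function M Y" and B: "finite B" "Y ` space M \<subseteq> B"
  shows "pr X x = (\<Sum>y\<in>B. pr (\<lambda>\<omega>. (Y \<omega>, X \<omega>)) (y, x))"
proof -
  let ?A = "insert x (X ` space M)"
  have A: "finite ?A" using X by (simp add: simple_function_def)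
  have "pr X x = (\<Sum>x'\<in>?A. pr X x' * of_bool (x' = x))"
    using A by (simp add: of_bool_def if_distrib sum.delta cong: if_cong)
  also have "\<dots> = expectation (\<lambda>\<omega>. of_bool (X \<omega> = x))"
    by (rule pr_sum_expectation[OF X A]) auto
  also have "\<dots> = (\<Sum>z\<in>B \<times> ?A. pr (\<lambda>\<omega>. (Y \<omega>, X \<omega>)) z * of_bool (snd z = x))"
    using pr_sum_expectation[OF simple_function_Pair[OF Y X], of "B \<times> ?A" "\<lambda>z. of_bool (snd z = x)"] A B
    by (simp add: image_subset_iff)
  also have "\<dots> = (\<Sum>y\<in>B. \<Sum>x'\<in>?A. pr (\<lambda>\<omega>. (Y \<omega>, X \<omega>)) (y, x') * of_bool (x' = x))"
    by (simp add: sum.cartesian_product split_beta)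
  also have "\<dots> = (\<Sum>y\<in>B. pr (\<lambda>\<omega>. (Y \<omega>, X \<omega>)) (y, x))"
    using A by (simp add: of_bool_def if_distrib sum.delta cong: if_cong)
  finally show ?thesis .
qed

lemma Ent_eq:
  assumes X: "simple_function M X" and Q: "finite Q" "X ` space M \<subseteq> Q"
  shows "Ent M X = - (\<Sum>x\<in>Q. pr X x * ln (pr X x)) / ln 2"
proof -
  interpret information_space M 2 by standard simp
  have "Ent M X = - (\<Sum>x\<in>X ` space M. pr X x * log 2 (pr X x))"
    unfolding Ent_def pr_def
    by (rule entropy_simple_distributed[OF simple_distributedI[OF X]]) auto
  also have "(\<Sum>x\<in>X ` space M. pr X x * log 2 (pr X x)) = (\<Sum>x\<in>Q. pr X x * log 2 (pr X x))"
    by (rule sum.mono_neutral_left) (use Q pr_outside in auto)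
  finally show ?thesis by (simp add: log_def sum_divide_distrib)
qed

lemma Cond_Ent_eq:
  assumes X: "simple_function M X" and Y: "simple_function M Y"
  shows "Cond_Ent M X Y = Ent M (\<lambda>\<omega>. (Y \<omega>, X \<omega>)) - Ent M Y"
proof -
  interpret information_space M 2 by standard simp
  show ?thesis using entropy_chain_rule[OF Y X] by (simp add: Cond_Ent_def Ent_def)
qed

text \<open>The left-hand side is \<open>H(Y | X)\<close> in nats. Positivity of
  \<open>\<beta>\<close> is asked only where \<open>Y\<close> has positive probability, because
  \<open>\<beta>\<close> will be 0 at null values.\<close>

lemma gibbs_entropy:
  assumes X: "simple_function M X" and Y: "simple_function M Y"
    and \<beta>: "\<And>x y. 0 \<le> \<beta> x y" "\<And>\<omega>. \<omega> \<in> space M \<Longrightarrow> 0 < pr Y (Y \<omega>) \<Longrightarrow> 0 < \<beta> (X \<omega>) (Y \<omega>)"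
    and C: "0 < C" "\<And>\<omega>. \<omega> \<in> space M \<Longrightarrow> (\<Sum>y\<in>Y ` space M. \<beta> (X \<omega>) y) \<le> C"
  shows "ln 2 * (Ent M (\<lambda>\<omega>. (Y \<omega>, X \<omega>)) - Ent M X) \<le>
    ln C - expectation (\<lambda>\<omega>. ln (\<beta> (X \<omega>) (Y \<omega>)))"
proof -
  let ?A = "X ` space M" and ?B = "Y ` space M" and ?Z = "\<lambda>\<omega>. (Y \<omega>, X \<omega>)"
  have fin: "finite ?A" "finite ?B" using X Y by (auto simp: simple_function_def)
  have Z: "simple_function M ?Z" by (rule simple_function_Pair[OF Y X])
  have ZQ: "?Z ` space M \<subseteq> ?B \<times> ?A" by auto
  have sw: "(\<Sum>z\<in>?B \<times> ?A. g z) = (\<Sum>x\<in>?A. \<Sum>y\<in>?B. g (y, x))" for g :: "_ \<Rightarrow> real"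
    by (subst sum.swap) (simp add: sum.cartesian_product)
  have "(\<Sum>x\<in>?A. pr X x * ln (pr X x)) - (\<Sum>x\<in>?A. \<Sum>y\<in>?B. pr ?Z (y, x) * ln (pr ?Z (y, x))) \<le>
    (\<Sum>x\<in>?A. \<Sum>y\<in>?B. pr ?Z (y, x) * (ln C - ln (\<beta> x y)))"
  proof (rule gibbs)
    fix x y assume "0 < pr ?Z (y, x)"
    then obtain \<omega> where \<omega>: "\<omega> \<in> space M" "Y \<omega> = y" "X \<omega> = x" using pr_pos_witness by fastforce
    have "pr ?Z (y, x) \<le> pr Y y"
      unfolding pr_def by (rule finite_measure_mono[OF _ simple_function_event[OF Y]]) auto
    then show "0 < \<beta> x y" using \<beta>(2)[OF \<omega>(1)] \<omega> \<open>0 < pr ?Z (y, x)\<close> by simp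
  next
    fix x assume "x \<in> ?A"
    show "pr X x = (\<Sum>y\<in>?B. pr ?Z (y, x))" by (rule pr_marginal[OF X Y fin(2) order_refl])
  qed (use \<beta>(1) C fin pr_nonneg in auto)
  also have "\<dots> = (\<Sum>z\<in>?B \<times> ?A. pr ?Z z * (ln C - ln (\<beta> (snd z) (fst z))))"
    unfolding sw by simp
  also have "\<dots> = (\<Sum>z\<in>?B \<times> ?A. pr ?Z z) * ln C - (\<Sum>z\<in>?B \<times> ?A. pr ?Z z * ln (\<beta> (snd z) (fst z)))"
    by (simp add: right_diff_distrib sum_subtractf sum_distrib_right)
  also have "\<dots> = ln C - expectation (\<lambda>\<omega>. ln (\<beta> (X \<omega>) (Y \<omega>)))"
    using pr_sum_1[OF Z _ ZQ] pr_sum_expectation[OF Z _ ZQ, of "\<lambda>z. ln (\<beta> (snd z) (fst z))"] fin by simp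
  finally have "(\<Sum>x\<in>?A. pr X x * ln (pr X x)) - (\<Sum>z\<in>?B \<times> ?A. pr ?Z z * ln (pr ?Z z)) \<le>
    ln C - expectation (\<lambda>\<omega>. ln (\<beta> (X \<omega>) (Y \<omega>)))"
    unfolding sw .
  moreover have "ln 2 * Ent M X = - (\<Sum>x\<in>?A. pr X x * ln (pr X x))"
    by (simp add: Ent_eq[OF X fin(1) order_refl])
  moreover have "ln 2 * Ent M ?Z = - (\<Sum>z\<in>?B \<times> ?A. pr ?Z z * ln (pr ?Z z))"
    using Ent_eq[OF Z _ ZQ] fin by simp
  ultimately show ?thesis by (simp add: right_diff_distrib)
qed

end

lemma finite_copies: "finite (copies A)"
  by (auto simp: copies_def)

text \<open>Where \<open>w e = 0\<close> the convention \<open>0^0 = 1\<close> agrees with the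
  summand \<open>w e * ln (...) = 0\<close>; otherwise the colour weight is positive.\<close>

lemma ln_joints_const:
  assumes fin: "finite E" and w: "\<And>e. e \<in> E \<Longrightarrow> 0 \<le> w e"
  shows "ln (joints_const d E r c k w) = ((\<Sum>e\<in>E. w e) - 1) * ln (fact d) +
    (\<Sum>i=1..r. - color_weight E c w i * ln (fact (k i)) +
       (\<Sum>e\<in>{e\<in>E. c e = i}. w e * ln (w e / color_weight E c w i)))"
proof -
  let ?f = "\<lambda>i e. if w e = 0 then 1 else (w e / color_weight E c w i) powr w e"
  have cw: "0 < color_weight E c w i" if "e \<in> {e\<in>E. c e = i}" "w e \<noteq> 0" for e i
  proof -
    have "w e \<le> color_weight E c w i"
      unfolding color_weight_def by (rule member_le_sum) (use that fin w in auto)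
    then show ?thesis using w[of e] that by auto
  qed
  have f: "0 < ?f i e" "ln (?f i e) = w e * ln (w e / color_weight E c w i)"
    if "e \<in> {e\<in>E. c e = i}" for i e
    using cw[OF that] w[of e] that by (auto simp: ln_powr)
  have pf: "0 < (\<Prod>e\<in>{e\<in>E. c e = i}. ?f i e)" for i by (rule prod_pos) (rule f(1))
  let ?g = "\<lambda>i. (1 / fact (k i)) powr color_weight E c w i * (\<Prod>e\<in>{e\<in>E. c e = i}. ?f i e)"
  have g: "0 < ?g i" for i using pf[of i] by simp
  have lg: "ln (?g i) = - color_weight E c w i * ln (fact (k i)) +
       (\<Sum>e\<in>{e\<in>E. c e = i}. w e * ln (w e / color_weight E c w i))" for i
  proof -
    have "ln (\<Prod>e\<in>{e\<in>E. c e = i}. ?f i e) = (\<Sum>e\<in>{e\<in>E. c e = i}. ln (?f i e))"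
      by (rule ln_prod) (use fin in simp, rule less_imp_neq[OF f(1), symmetric])
    also have "\<dots> = (\<Sum>e\<in>{e\<in>E. c e = i}. w e * ln (w e / color_weight E c w i))"
      by (rule sum.cong[OF refl f(2)])
    finally show ?thesis using pf[of i] by (simp add: ln_mult ln_powr ln_div)
  qed
  have "ln (joints_const d E r c k w) = ((\<Sum>e\<in>E. w e) - 1) * ln (fact d) + ln (\<Prod>i=1..r. ?g i)"
  proof -
    have "ln (fact d powr a * x) = a * ln (fact d) + ln x" if "0 < x" for a x :: real
      using that by (simp add: ln_mult ln_powr)
    moreover have "0 < (\<Prod>i=1..r. ?g i)" by (rule prod_pos) (rule g)
    ultimately show ?thesis unfolding joints_const_def by blast
  qed
  also have "ln (\<Prod>i=1..r. ?g i) = (\<Sum>i=1..r. ln (?g i))"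
    by (rule ln_prod) (simp, rule less_imp_neq[OF g, symmetric])
  finally show ?thesis unfolding lg .
qed

section \<open>The inequality\<close>

theorem theorem1p16:
  fixes E :: "'e set" and ends :: "'e \<Rightarrow> 'd::finite set"
    and r :: nat and c :: "'e \<Rightarrow> nat" and k :: "nat \<Rightarrow> nat" and w :: "'e \<Rightarrow> real"
    and \<F> :: "nat \<Rightarrow> ('a::field ^ 'd) set multiset"
    and M :: "'w measure"
    and p :: "'w \<Rightarrow> 'a ^ 'd" and T :: "'w \<Rightarrow> 'e \<Rightarrow> ('a ^ 'd) set \<times> nat"
    and edge :: "nat \<Rightarrow> 'w \<Rightarrow> 'e"
  assumes hypergraph: "uniform_hypergraph E ends r c k"
    and w_nonneg: "\<forall>e\<in>E. 0 \<le> w e"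
    and w_covers: "covers E ends w"
    and flats: "\<forall>i\<in>{1..r}. \<forall>S\<in>#\<F> i. is_flat (k i) S"
    and prob: "prob_space M"
    and p_joint: "\<forall>\<omega>\<in>space M. p \<omega> \<in> joints E ends c \<F>"
    and T_tuple: "\<forall>\<omega>\<in>space M. T \<omega> \<in> joint_tuples E ends c \<F> (p \<omega>)"
    and edge_color: "\<forall>i\<in>{1..r}. \<forall>\<omega>\<in>space M. edge i \<omega> \<in> {e\<in>E. c e = i}"
    and edge_distr: "\<forall>i\<in>{1..r}. color_weight E c w i \<noteq> 0 \<longrightarrow>
          (\<forall>e\<in>{e\<in>E. c e = i}. \<P>(\<omega> in M. edge i \<omega> = e) = w e / color_weight E c w i)"
    and indep: "indep_discrete M (\<lambda>\<omega>. (p \<omega>, T \<omega>)) (\<lambda>\<omega>. \<lambda>i\<in>{1..r}. edge i \<omega>)"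
  shows "Ent M p +
      (\<Sum>i=1..r. color_weight E c w i *
          (Cond_Ent M (\<lambda>\<omega>. T \<omega> (edge i \<omega>)) p - Ent M (edge i)))
    \<le> (\<Sum>i=1..r. color_weight E c w i * Ent M (\<lambda>\<omega>. T \<omega> (edge i \<omega>)))
      + log 2 (joints_const CARD('d) E r c k w)"
proof -
  interpret prob_space M by (rule prob)
  let ?cw = "color_weight E c w" and ?d = "CARD('d)"
  let ?Ei = "\<lambda>i. {e\<in>E. c e = i}"
  have fin: "finite E" and cE: "c ` E \<subseteq> {1..r}"
    using hypergraph by (auto simp: uniform_hypergraph_def)
  have k: "1 \<le> k (c e)" "k (c e) \<le> ?d - 1" "card (ends e) = ?d - k (c e)" if "e \<in> E" for e
    using hypergraph that cE unfolding uniform_hypergraph_def by auto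
  have card_compl: "card (- ends e) = k (c e)" if "e \<in> E" for e
    using k[OF that] by (simp add: Compl_eq_Diff_UNIV card_Diff_subset)
  interpret weighted_cover E ends w
  proof
    fix e assume "e \<in> E"
    then show "ends e \<noteq> UNIV" using card_compl k(1) by fastforce
  qed (use fin w_nonneg w_covers in auto)
  have sum_colors: "(\<Sum>i=1..r. \<Sum>e\<in>?Ei i. g e) = (\<Sum>e\<in>E. g e)" for g :: "'e \<Rightarrow> real"
    by (rule sum.group[OF fin _ cE]) simp
  have cw_nonneg: "0 \<le> ?cw i" for i
    unfolding color_weight_def using w_nonneg by (intro sum_nonneg) auto
  have sum_cw: "(\<Sum>i=1..r. ?cw i) = W + 1"
    unfolding color_weight_def sum_colors W_def by simp

  \<comment> \<open>Finite ranges and the joint law of tuple and edge\<close>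
  let ?pT = "\<lambda>\<omega>. (p \<omega>, T \<omega>)" and ?edges = "\<lambda>\<omega>. \<lambda>i\<in>{1..r}. edge i \<omega>"
  note ind = indep[unfolded indep_discrete_def]
  have chart: "joint_chart E ends (p \<omega>) (\<lambda>e. fst (T \<omega> e))" if "\<omega> \<in> space M" for \<omega>
    using joint_tuples_chart T_tuple that by blast
  have T_fin: "finite (T ` space M)"
  proof (rule finite_subset)
    show "T ` space M \<subseteq> (\<Pi>\<^sub>E e\<in>E. copies (\<F> (c e)))" using T_tuple by (auto simp: joint_tuples_def)
    show "finite (\<Pi>\<^sub>E e\<in>E. copies (\<F> (c e)))" by (intro finite_PiE fin finite_copies)
  qed
  \<comment> \<open>Nothing assumed about \<open>p\<close> says directly that its range is finite;
    but the tuple determines it, and there are only finitely many tuples.\<close>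
  have pT_fin: "finite (?pT ` space M)"
  proof (rule inj_on_finite[of snd _ "T ` space M"])
    show "inj_on snd (?pT ` space M)"
    proof (rule inj_onI, clarsimp)
      fix \<omega> \<omega>' assume a: "\<omega> \<in> space M" "\<omega>' \<in> space M" "T \<omega> = T \<omega>'"
      show "p \<omega> = p \<omega>'"
        using joint_chart_unique[OF chart[OF a(1)] _ Union_ends] chart[OF a(2)] a(3) by simp
    qed
  qed (use T_fin in auto)
  have edges_fin: "finite (?edges ` space M)"
    by (rule finite_subset[of _ "\<Pi>\<^sub>E i\<in>{1..r}. E"]) (use edge_color fin in \<open>auto intro!: finite_PiE\<close>)
  have sf_pT: "simple_function M ?pT"
    unfolding simple_function_def using pT_fin indep_setD_ev1[OF ind] by blast
  have sf_edges: "simple_function M ?edges"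
    unfolding simple_function_def using edges_fin indep_setD_ev2[OF ind] by blast
  have sf_p: "simple_function M p"
    using simple_function_compose[OF sf_pT, of fst] by (simp add: comp_def)
  have sf_edge: "simple_function M (edge i)" if "i \<in> {1..r}" for i
    using simple_function_compose[OF sf_edges, of "\<lambda>g. g i"] that by (simp add: comp_def)
  let ?X = "\<lambda>i \<omega>. T \<omega> (edge i \<omega>)"
  have sf_X: "simple_function M (?X i)" if "i \<in> {1..r}" for i
    using simple_function_compose[OF simple_function_Pair[OF sf_pT sf_edge[OF that]], of "\<lambda>z. snd (fst z) (snd z)"]
    by (simp add: comp_def)
  have pr_edge: "pr (edge i) e = w e / ?cw i" if "i \<in> {1..r}" "?cw i \<noteq> 0" "e \<in> ?Ei i" for i e
  proof -
    have "edge i -` {e} \<inter> space M = {\<omega> \<in> space M. edge i \<omega> = e}" by auto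
    then show ?thesis using edge_distr that by (simp add: pr_def)
  qed
  have pr_prod: "pr (\<lambda>\<omega>. (?pT \<omega>, edge i \<omega>)) (y, e) = pr ?pT y * pr (edge i) e" if "i \<in> {1..r}" for i y e
  proof -
    have 1: "(\<lambda>\<omega>. (?pT \<omega>, edge i \<omega>)) -` {(y, e)} \<inter> space M =
      (?pT -` {y} \<inter> space M) \<inter> (?edges -` {g. g i = e} \<inter> space M)" using that by auto
    have 2: "edge i -` {e} \<inter> space M = ?edges -` {g. g i = e} \<inter> space M" using that by auto
    show ?thesis unfolding pr_def 1 2 by (rule indep_setD[OF ind]) blast+
  qed
  \<comment> \<open>Multiplication by the colour weight turns the edge law into the weights
    \<open>w e\<close>. If the colour weight is 0, the edge law is not prescribed, but then all
    weights of the colour are 0.\<close>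
  have exp_split: "?cw i * expectation (\<lambda>\<omega>. h (?X i \<omega>) (p \<omega>)) =
      (\<Sum>y\<in>?pT ` space M. pr ?pT y * (\<Sum>e\<in>?Ei i. w e * h (snd y e) (fst y)))"
    if i: "i \<in> {1..r}" for i and h :: "_ \<Rightarrow> _ \<Rightarrow> real"
  proof (cases "?cw i = 0")
    case True
    then have "w e = 0" if "e \<in> ?Ei i" for e
      using that fin w_nonneg unfolding color_weight_def by (subst (asm) sum_nonneg_eq_0_iff) auto
    then show ?thesis using True by simp
  next
    case False
    have "expectation (\<lambda>\<omega>. h (?X i \<omega>) (p \<omega>)) =
      (\<Sum>z\<in>?pT ` space M \<times> ?Ei i. pr (\<lambda>\<omega>. (?pT \<omega>, edge i \<omega>)) z * h (snd (fst z) (snd z)) (fst (fst z)))"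
      by (subst pr_sum_expectation[OF simple_function_Pair[OF sf_pT sf_edge[OF i]]])
        (use pT_fin fin edge_color i in auto)
    also have "\<dots> = (\<Sum>y\<in>?pT ` space M. \<Sum>e\<in>?Ei i. pr ?pT y * (w e / ?cw i) * h (snd y e) (fst y))"
      unfolding sum.cartesian_product split_beta
    proof (rule sum.cong)
      fix z assume "z \<in> ?pT ` space M \<times> ?Ei i"
      then obtain y e where z: "z = (y, e)" "e \<in> ?Ei i" by auto
      show "pr (\<lambda>\<omega>. (?pT \<omega>, edge i \<omega>)) z * h (snd (fst z) (snd z)) (fst (fst z)) =
          pr ?pT (fst z) * (w (snd z) / ?cw i) * h (snd (fst z) (snd z)) (fst (fst z))"
        unfolding z(1) by (simp only: fst_conv snd_conv pr_prod[OF i] pr_edge[OF i False z(2)])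
    qed simp
    finally show ?thesis using False by (simp add: sum_distrib_left sum_divide_distrib mult_ac)
  qed

  \<comment> \<open>The bound at a fixed degree\<close>
  have "finite (p ` space M)" using sf_p by (simp add: simple_function_def)
  \<comment> \<open>Values of probability 0 are dropped because \<open>exists_handicap\<close> asks
    for positive \<open>\<mu>\<close>.\<close>
  define J where "J = {q \<in> p ` space M. 0 < pr p q}"
  have J_fin: "finite J" unfolding J_def using \<open>finite (p ` space M)\<close> by simp
  obtain idx :: "'a ^ 'd \<Rightarrow> nat" where idx: "inj_on idx J"
    using finite_imp_inj_to_nat_seg[OF J_fin] by blast
  define Ts where "Ts q = (\<lambda>\<omega> e. fst (T \<omega> e)) ` {\<omega> \<in> space M. p \<omega> = q}" for q
  let ?H = "ln 2 * Ent M p"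
  have H: "?H = - (\<Sum>q\<in>p ` space M. pr p q * ln (pr p q))"
    using Ent_eq[OF sf_p \<open>finite (p ` space M)\<close> order_refl] by simp
  let ?L = "\<Sum>i=1..r. ?cw i * (ln 2 * (Ent M (\<lambda>\<omega>. (p \<omega>, ?X i \<omega>)) - Ent M (?X i)))"
  have bound: "?L \<le> (\<Sum>i=1..r. ?cw i * ln ((n + card J + k i) choose k i)) -
      W * ln ((n + ?d) choose ?d) + W * ?H + excess * ln (real (n + card J) + 1)" for n
  proof -
    let ?n = "n + card J"
    have c1: "0 < pr p q" if "q \<in> J" for q using that by (simp add: J_def)
    have c2: "(\<Sum>q\<in>J. pr p q) \<le> 1"
    proof -
      have "(\<Sum>q\<in>J. pr p q) \<le> (\<Sum>q\<in>p ` space M. pr p q)"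
        by (rule sum_mono2) (simp_all add: \<open>finite (p ` space M)\<close> pr_nonneg J_def)
      then show ?thesis using pr_sum_1[OF sf_p \<open>finite (p ` space M)\<close> order_refl] by simp
    qed
    have c3: "finite (Ts q)" for q
    proof (rule finite_subset)
      show "Ts q \<subseteq> (\<lambda>t e. fst (t e)) ` (T ` space M)" by (auto simp: Ts_def)
    qed (use T_fin in simp)
    have c4: "Ts q \<noteq> {}" if "q \<in> J" for q using that by (auto simp: Ts_def J_def)
    have c5: "joint_chart E ends q t" if t: "t \<in> Ts q" for q t
    proof -
      obtain \<omega> where "\<omega> \<in> space M" "p \<omega> = q" "t = (\<lambda>e. fst (T \<omega> e))" using t by (auto simp: Ts_def)
      then show ?thesis using chart by blast
    qed
    obtain \<alpha> where \<alpha>1: "\<And>q t e. q \<in> J \<Longrightarrow> t \<in> Ts q \<Longrightarrow> e \<in> E \<Longrightarrow> 0 < contribution idx ?n J (t e) \<alpha> q"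
      and \<alpha>2: "\<And>q t. q \<in> J \<Longrightarrow> t \<in> Ts q \<Longrightarrow> W * (ln (pr p q) + ln ((n + ?d) choose ?d)) \<le>
       (\<Sum>e\<in>E. w e * ln (contribution idx ?n J (t e) \<alpha> q)) + excess * ln (real ?n + 1)"
      by (rule exists_handicap[where J = J and idx = idx and \<mu> = "pr p" and Ts = Ts and n = n])
        (rule J_fin, rule idx, erule c1, rule c2, rule c3, erule c4, erule c5, blast)
    \<comment> \<open>Off the flat \<open>\<beta>\<close> is 0, so its sum over all values of
      \<open>p\<close> is a sum of contributions on one flat, at most a binomial
      coefficient.\<close>
    define \<beta> where "\<beta> x q = (if q \<in> J \<inter> fst x then real (contribution idx ?n J (fst x) \<alpha> q) else 0)"
      for x :: "('a ^ 'd) set \<times> nat" and q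
    have \<beta>_T: "\<beta> (T \<omega> e) (p \<omega>) = contribution idx ?n J (fst (T \<omega> e)) \<alpha> (p \<omega>)" "0 < \<beta> (T \<omega> e) (p \<omega>)"
      if "\<omega> \<in> space M" "p \<omega> \<in> J" "e \<in> E" for \<omega> e
      using that joint_chart_mem[OF chart[OF that(1)] that(3)] \<alpha>1[OF that(2) _ that(3), of "\<lambda>e. fst (T \<omega> e)"]
      by (auto simp: \<beta>_def Ts_def)
    have color: "ln 2 * (Ent M (\<lambda>\<omega>. (p \<omega>, ?X i \<omega>)) - Ent M (?X i)) \<le>
        ln ((?n + k i) choose k i) - expectation (\<lambda>\<omega>. ln (\<beta> (?X i \<omega>) (p \<omega>)))" if i: "i \<in> {1..r}" for i
    proof (rule gibbs_entropy[OF sf_X[OF i] sf_p])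
      fix \<omega> assume \<omega>: "\<omega> \<in> space M"
      then have e: "edge i \<omega> \<in> E" "c (edge i \<omega>) = i" using edge_color i by auto
      show "0 < \<beta> (?X i \<omega>) (p \<omega>)" if "0 < pr p (p \<omega>)"
        by (rule \<beta>_T(2)[OF \<omega> _ e(1)]) (use that \<omega> in \<open>simp add: J_def\<close>)
      obtain N where N: "fst (?X i \<omega>) = range (\<lambda>v. p \<omega> + (N ** proj_off (ends (edge i \<omega>))) *v v)"
        using chart[OF \<omega>] e(1) unfolding joint_chart_def by blast
      \<comment> \<open>The columns indexed by the edge vanish, leaving \<open>k i\<close> effective
        variables on the flat.\<close>
      have "(N ** proj_off (ends (edge i \<omega>))) $ a $ j = 0" if "j \<notin> - ends (edge i \<omega>)" for a j
        using that by (auto simp: matrix_matrix_mult_def proj_off_def intro!: sum.neutral)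
      then have "(\<Sum>q\<in>J \<inter> fst (?X i \<omega>). contribution idx ?n J (fst (?X i \<omega>)) \<alpha> q) \<le> (?n + k i) choose k i"
        using contribution_sum_le[OF N J_fin idx, of "- ends (edge i \<omega>)"] card_compl[OF e(1)] e(2) by simp
      moreover have "(\<Sum>q\<in>p ` space M. \<beta> (?X i \<omega>) q) = (\<Sum>q\<in>J \<inter> fst (?X i \<omega>). real (contribution idx ?n J (fst (?X i \<omega>)) \<alpha> q))"
        by (rule sum.mono_neutral_cong_right) (use \<open>finite (p ` space M)\<close> in \<open>auto simp: \<beta>_def J_def\<close>)
      ultimately show "(\<Sum>q\<in>p ` space M. \<beta> (?X i \<omega>) q) \<le> real ((?n + k i) choose k i)"
        by (metis of_nat_le_iff of_nat_sum)
    qed (auto simp: \<beta>_def)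
    have "?L \<le> (\<Sum>i=1..r. ?cw i * (ln ((?n + k i) choose k i) - expectation (\<lambda>\<omega>. ln (\<beta> (?X i \<omega>) (p \<omega>)))))"
      by (intro sum_mono mult_left_mono color cw_nonneg)
    also have "\<dots> = (\<Sum>i=1..r. ?cw i * ln ((?n + k i) choose k i)) -
        (\<Sum>i=1..r. ?cw i * expectation (\<lambda>\<omega>. ln (\<beta> (?X i \<omega>) (p \<omega>))))"
      by (simp add: right_diff_distrib sum_subtractf)
    \<comment> \<open>The edges drawn separately for each colour recombine into a sum over all edges
      of one tuple, the shape to which the inequality for the handicaps applies.\<close>
    also have "(\<Sum>i=1..r. ?cw i * expectation (\<lambda>\<omega>. ln (\<beta> (?X i \<omega>) (p \<omega>)))) =
        (\<Sum>y\<in>?pT ` space M. pr ?pT y * (\<Sum>e\<in>E. w e * ln (\<beta> (snd y e) (fst y))))"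
    proof -
      have "(\<Sum>i=1..r. ?cw i * expectation (\<lambda>\<omega>. ln (\<beta> (?X i \<omega>) (p \<omega>)))) =
        (\<Sum>i=1..r. \<Sum>y\<in>?pT ` space M. pr ?pT y * (\<Sum>e\<in>?Ei i. w e * ln (\<beta> (snd y e) (fst y))))"
        by (rule sum.cong[OF refl exp_split])
      also have "\<dots> = (\<Sum>y\<in>?pT ` space M. pr ?pT y * (\<Sum>i=1..r. \<Sum>e\<in>?Ei i. w e * ln (\<beta> (snd y e) (fst y))))"
        unfolding sum_distrib_left by (rule sum.swap)
      finally show ?thesis unfolding sum_colors .
    qed
    finally have L: "?L \<le> (\<Sum>i=1..r. ?cw i * ln ((?n + k i) choose k i)) -
        (\<Sum>y\<in>?pT ` space M. pr ?pT y * (\<Sum>e\<in>E. w e * ln (\<beta> (snd y e) (fst y))))" .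
    \<comment> \<open>The targets are proportional to the law of \<open>p\<close>, and the mean of
      their logarithm brings in \<open>- ?H\<close>.\<close>
    have "W * (- ?H + ln ((n + ?d) choose ?d)) - excess * ln (real ?n + 1) =
      (\<Sum>y\<in>?pT ` space M. pr ?pT y * (W * (ln (pr p (fst y)) + ln ((n + ?d) choose ?d)) - excess * ln (real ?n + 1)))"
    proof -
      have "(\<Sum>y\<in>?pT ` space M. pr ?pT y * ln (pr p (fst y))) = (\<Sum>q\<in>p ` space M. pr p q * ln (pr p q))"
        using pr_sum_expectation[OF sf_pT pT_fin order_refl, of "\<lambda>y. ln (pr p (fst y))"]
          pr_sum_expectation[OF sf_p \<open>finite (p ` space M)\<close> order_refl, of "\<lambda>q. ln (pr p q)"] by simp
      then have s: "(\<Sum>y\<in>?pT ` space M. pr ?pT y * ln (pr p (fst y))) = - ?H" using H by simp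
      let ?a = "W * ln ((n + ?d) choose ?d) - excess * ln (real ?n + 1)"
      have "(\<Sum>y\<in>?pT ` space M. pr ?pT y * (W * (ln (pr p (fst y)) + ln ((n + ?d) choose ?d)) - excess * ln (real ?n + 1))) =
        (\<Sum>y\<in>?pT ` space M. W * (pr ?pT y * ln (pr p (fst y))) + ?a * pr ?pT y)"
        by (rule sum.cong) (simp_all add: algebra_simps)
      also have "\<dots> = W * (\<Sum>y\<in>?pT ` space M. pr ?pT y * ln (pr p (fst y))) + ?a * (\<Sum>y\<in>?pT ` space M. pr ?pT y)"
        by (simp only: sum.distrib sum_distrib_left)
      also have "\<dots> = W * (- ?H + ln ((n + ?d) choose ?d)) - excess * ln (real ?n + 1)"
        unfolding s pr_sum_1[OF sf_pT pT_fin order_refl] by (simp add: algebra_simps)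
      finally show ?thesis ..
    qed
    also have "\<dots> \<le> (\<Sum>y\<in>?pT ` space M. pr ?pT y * (\<Sum>e\<in>E. w e * ln (\<beta> (snd y e) (fst y))))"
    proof (rule sum_mono)
      fix y assume "y \<in> ?pT ` space M"
      then obtain \<omega> where \<omega>: "\<omega> \<in> space M" "y = (p \<omega>, T \<omega>)" by blast
      show "pr ?pT y * (W * (ln (pr p (fst y)) + ln ((n + ?d) choose ?d)) - excess * ln (real ?n + 1)) \<le>
        pr ?pT y * (\<Sum>e\<in>E. w e * ln (\<beta> (snd y e) (fst y)))"
      proof (cases "p \<omega> \<in> J")
        case True
        have "(\<Sum>e\<in>E. w e * ln (\<beta> (T \<omega> e) (p \<omega>))) =
          (\<Sum>e\<in>E. w e * ln (contribution idx ?n J (fst (T \<omega> e)) \<alpha> (p \<omega>)))"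
          by (rule sum.cong) (simp_all add: \<beta>_T(1)[OF \<omega>(1) True])
        moreover have "(\<lambda>e. fst (T \<omega> e)) \<in> Ts (p \<omega>)" using \<omega>(1) by (auto simp: Ts_def)
        ultimately show ?thesis
          using \<alpha>2[OF True, of "\<lambda>e. fst (T \<omega> e)"] \<omega>(2) by (intro mult_left_mono pr_nonneg) simp
      next
        case False
        have "pr ?pT y \<le> pr p (p \<omega>)"
          unfolding pr_def by (rule finite_measure_mono[OF _ simple_function_event[OF sf_p]]) (auto simp: \<omega>(2))
        then have "pr ?pT y = 0" using False \<omega>(1) pr_nonneg[of ?pT y] by (auto simp: J_def)
        then show ?thesis by simp
      qed
    qed
    finally show ?thesis using L by (simp add: algebra_simps)
  qed

  \<comment> \<open>The limit of large degree\<close>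
  have coeff: "(\<Sum>i=1..r. ?cw i * real (k i)) = W * real ?d - excess"
  proof -
    have "(\<Sum>i=1..r. ?cw i * real (k i)) = (\<Sum>i=1..r. \<Sum>e\<in>?Ei i. w e * real (k (c e)))"
      unfolding color_weight_def sum_distrib_right by (intro sum.cong) auto
    also have "\<dots> = (\<Sum>e\<in>E. w e * (\<Sum>j\<in>- ends e. 1))"
      unfolding sum_colors by (rule sum.cong) (auto simp: card_compl)
    also have "\<dots> = (\<Sum>j\<in>UNIV. W - (cov j - 1))"
      unfolding sum_swap by (rule sum.cong) auto
    also have "\<dots> = W * real ?d - excess"
      unfolding excess_def by (simp add: sum_subtractf)
    finally show ?thesis .
  qed
  \<comment> \<open>By \<open>coeff\<close> the multiples of \<open>ln (real n)\<close> inserted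
    here cancel for every \<open>n\<close>. The forms \<open>n + 0 + ?d\<close> and
    \<open>choose 1\<close> are there to match \<open>ln_binomial_asymp\<close>.\<close>
  let ?R = "\<lambda>n. (\<Sum>i=1..r. ?cw i * (ln ((n + card J + k i) choose k i) - real (k i) * ln (real n))) -
      W * (ln ((n + 0 + ?d) choose ?d) - real ?d * ln (real n)) + W * ?H +
      excess * (ln ((n + card J + 1) choose 1) - real 1 * ln (real n))"
  have "?R \<longlonglongrightarrow> (\<Sum>i=1..r. ?cw i * (- ln (fact (k i)))) - W * (- ln (fact ?d)) + W * ?H + excess * (- ln (fact 1))"
    by (intro tendsto_intros ln_binomial_asymp)
  moreover have "?L \<le> ?R n" for n
  proof -
    have "(\<Sum>i=1..r. ?cw i * (ln ((n + card J + k i) choose k i) - real (k i) * ln (real n))) =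
      (\<Sum>i=1..r. ?cw i * ln ((n + card J + k i) choose k i)) - (\<Sum>i=1..r. ?cw i * real (k i)) * ln (real n)"
      by (simp add: right_diff_distrib sum_subtractf sum_distrib_right mult.assoc)
    moreover have "real ((n + card J + 1) choose 1) = real (n + card J) + 1" by simp
    ultimately show ?thesis using bound[of n] unfolding coeff by (simp add: algebra_simps)
  qed
  ultimately have main: "?L \<le> (\<Sum>i=1..r. ?cw i * (- ln (fact (k i)))) - W * (- ln (fact ?d)) + W * ?H + excess * (- ln (fact 1))"
    by (intro LIMSEQ_le_const) auto

  \<comment> \<open>Return to the entropies of the statement\<close>
  have He: "?cw i * (ln 2 * Ent M (edge i)) = - (\<Sum>e\<in>?Ei i. w e * ln (w e / ?cw i))" if i: "i \<in> {1..r}" for i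
  proof (cases "?cw i = 0")
    case True
    then show ?thesis by simp
  next
    case False
    have "ln 2 * Ent M (edge i) = - (\<Sum>e\<in>?Ei i. pr (edge i) e * ln (pr (edge i) e))"
      using Ent_eq[OF sf_edge[OF i], of "?Ei i"] fin edge_color i by (simp add: image_subset_iff)
    also have "(\<Sum>e\<in>?Ei i. pr (edge i) e * ln (pr (edge i) e)) = (\<Sum>e\<in>?Ei i. w e * ln (w e / ?cw i)) / ?cw i"
      unfolding sum_divide_distrib by (rule sum.cong) (auto simp: pr_edge[OF i False])
    finally show ?thesis using False by simp
  qed
  have CE: "Cond_Ent M (?X i) p = Ent M (\<lambda>\<omega>. (p \<omega>, ?X i \<omega>)) - Ent M p" if "i \<in> {1..r}" for i
    by (rule Cond_Ent_eq[OF sf_X[OF that] sf_p])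
  have "ln 2 * (Ent M p + (\<Sum>i=1..r. ?cw i * (Cond_Ent M (?X i) p - Ent M (edge i))) -
      (\<Sum>i=1..r. ?cw i * Ent M (?X i))) =
    ?H + (\<Sum>i=1..r. ?cw i * (ln 2 * (Ent M (\<lambda>\<omega>. (p \<omega>, ?X i \<omega>)) - Ent M (?X i))) - ?cw i * ?H -
      ?cw i * (ln 2 * Ent M (edge i)))"
  proof -
    have "ln 2 * (\<Sum>i=1..r. ?cw i * (Cond_Ent M (?X i) p - Ent M (edge i))) - ln 2 * (\<Sum>i=1..r. ?cw i * Ent M (?X i)) =
      (\<Sum>i=1..r. ?cw i * (ln 2 * (Ent M (\<lambda>\<omega>. (p \<omega>, ?X i \<omega>)) - Ent M (?X i))) - ?cw i * ?H -
        ?cw i * (ln 2 * Ent M (edge i)))"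
      unfolding sum_distrib_left sum_subtractf[symmetric] by (rule sum.cong) (simp_all add: CE algebra_simps)
    then show ?thesis by (simp add: algebra_simps)
  qed
  also have "\<dots> = ?L - W * ?H + (\<Sum>i=1..r. \<Sum>e\<in>?Ei i. w e * ln (w e / ?cw i))"
  proof -
    have m1: "(\<Sum>i=1..r. ?cw i * (ln 2 * Ent M (edge i))) = - (\<Sum>i=1..r. \<Sum>e\<in>?Ei i. w e * ln (w e / ?cw i))"
    proof -
      have "(\<Sum>i=1..r. ?cw i * (ln 2 * Ent M (edge i))) = (\<Sum>i=1..r. - (\<Sum>e\<in>?Ei i. w e * ln (w e / ?cw i)))"
        by (rule sum.cong[OF refl He])
      then show ?thesis by (simp only: sum_negf)
    qed
    \<comment> \<open>The colour weights add up to \<open>W + 1\<close>; the extra \<open>?H\<close>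
      cancels the entropy of \<open>p\<close> that stands outside the sum.\<close>
    have m2: "(\<Sum>i=1..r. ?cw i * ?H) = W * ?H + ?H"
      unfolding sum_distrib_right[symmetric] sum_cw distrib_right by simp
    show ?thesis unfolding sum_subtractf m1 m2 by simp
  qed
  also have "\<dots> \<le> ln (joints_const ?d E r c k w)"
  proof -
    have "ln (joints_const ?d E r c k w) = W * ln (fact ?d) + (\<Sum>i=1..r. - ?cw i * ln (fact (k i)) +
        (\<Sum>e\<in>?Ei i. w e * ln (w e / ?cw i)))"
      unfolding W_def by (rule ln_joints_const) (use fin w_nonneg in auto)
    then show ?thesis using main by (simp add: sum.distrib sum_negf sum_subtractf)
  qed
  finally have "Ent M p + (\<Sum>i=1..r. ?cw i * (Cond_Ent M (?X i) p - Ent M (edge i))) -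
      (\<Sum>i=1..r. ?cw i * Ent M (?X i)) \<le> ln (joints_const ?d E r c k w) / ln 2"
    by (simp add: le_divide_eq mult.commute)
  then show ?thesis by (simp add: log_def)
qed

end
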